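(* Let $j\ge1$ and let $V\in L^1_{j+1}$ be real-valued. Then for $0\le l\le j-1$ the functions \[\frac{d^l}{dk^l}\Big(\frac{T(k)-T(0)}{k}\Big)\quad\text{and}\quad\frac{d^l}{dk^l}\Big(\frac{R_\pm(k)-R_\pm(0)}{k}\Big)\] (as functions of $k\in\mathbb{R}$) belong to $\mathcal{A}$.
   Context: $H=-\frac{d^2}{dx^2}+V$; $L^1_\sigma$: functions with $\int(1+|x|)^\sigma|V|<\infty$. $\mathcal{A}$: Wiener algebra of functions $f(k)=\int_{\mathbb{R}}\mathrm{e}^{\mathrm{i}kp}\hat f(p)dp$, $\hat f\in L^1(\mathbb{R})$. $f_\pm(x,k)$ are the Jost solutions of $Hf=k^2f$ with $f_\pm(x,k)\sim\mathrm{e}^{\pm\mathrm{i}kx}$ as $x\to\pm\infty$. With $W(f,g)=fg'-f'g$, $W(k)=W(f_-(\cdot,k),f_+(\cdot,k))$, $W_\pm(k)=W(f_\mp(\cdot,k),f_\pm(\cdot,-k))$; $T(k)=\frac{2\mathrm{i}k}{W(k)}$, $R_\pm(k)=\mp\frac{W_\pm(k)}{W(k)}$ for real $k\ne0$, extended continuously to $k=0$. *)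

theory Defs
  imports "HOL-Analysis.Analysis"
begin

definition L1_weighted :: "nat \<Rightarrow> (real \<Rightarrow> real) \<Rightarrow> bool" where
  "L1_weighted \<sigma> V \<longleftrightarrow> V \<in> borel_measurable lborel \<and>
     integrable lborel (\<lambda>x. (1 + \<bar>x\<bar>) ^ \<sigma> * \<bar>V x\<bar>)"

definition wiener_algebra :: "(real \<Rightarrow> complex) set" where
  "wiener_algebra = {f. \<exists>h :: real \<Rightarrow> complex. integrable lborel h \<and>
     (\<forall>k. f k = (LINT p|lborel. exp (\<i> * complex_of_real (k * p)) * h p))}"

text \<open>f solves -f'' + V f = k^2 f (in the Caratheodory sense appropriate for
  locally integrable V): f is C^1 with derivative f' and f' is the integral of (V - k^2) f.\<close>
definition schrod_sol :: "(real \<Rightarrow> real) \<Rightarrow> real \<Rightarrow> (real \<Rightarrow> complex) \<Rightarrow> bool" where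
  "schrod_sol V k f \<longleftrightarrow> (\<exists>f'. (\<forall>x. (f has_vector_derivative f' x) (at x)) \<and>
     (\<forall>a b. a \<le> b \<longrightarrow>
        ((\<lambda>t. complex_of_real (V t - k\<^sup>2) * f t) has_integral (f' b - f' a)) {a..b}))"

definition jost_plus :: "(real \<Rightarrow> real) \<Rightarrow> (real \<Rightarrow> real \<Rightarrow> complex) \<Rightarrow> bool" where
  "jost_plus V fp \<longleftrightarrow> (\<forall>k. schrod_sol V k (fp k) \<and>
     ((\<lambda>x. fp k x - exp (\<i> * complex_of_real (k * x))) \<longlongrightarrow> 0) at_top)"

definition jost_minus :: "(real \<Rightarrow> real) \<Rightarrow> (real \<Rightarrow> real \<Rightarrow> complex) \<Rightarrow> bool" where
  "jost_minus V fm \<longleftrightarrow> (\<forall>k. schrod_sol V k (fm k) \<and>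
     ((\<lambda>x. fm k x - exp (- \<i> * complex_of_real (k * x))) \<longlongrightarrow> 0) at_bot)"

text \<open>Wronskian W(f,g) = f g' - f' g (constant for solutions; evaluated at x = 0).\<close>
definition wronskian :: "(real \<Rightarrow> complex) \<Rightarrow> (real \<Rightarrow> complex) \<Rightarrow> complex" where
  "wronskian f g = f 0 * vector_derivative g (at 0) - vector_derivative f (at 0) * g 0"

definition ext0 :: "(real \<Rightarrow> complex) \<Rightarrow> real \<Rightarrow> complex" where
  "ext0 g k = (if k \<noteq> 0 then g k else Lim (at 0) g)"

definition transmission :: "(real \<Rightarrow> real \<Rightarrow> complex) \<Rightarrow> (real \<Rightarrow> real \<Rightarrow> complex) \<Rightarrow> real \<Rightarrow> complex" where
  "transmission fp fm = ext0 (\<lambda>k. 2 * \<i> * complex_of_real k / wronskian (fm k) (fp k))"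

definition reflection_plus :: "(real \<Rightarrow> real \<Rightarrow> complex) \<Rightarrow> (real \<Rightarrow> real \<Rightarrow> complex) \<Rightarrow> real \<Rightarrow> complex" where
  "reflection_plus fp fm = ext0 (\<lambda>k. - (wronskian (fm k) (fp (-k)) / wronskian (fm k) (fp k)))"

definition reflection_minus :: "(real \<Rightarrow> real \<Rightarrow> complex) \<Rightarrow> (real \<Rightarrow> real \<Rightarrow> complex) \<Rightarrow> real \<Rightarrow> complex" where
  "reflection_minus fp fm = ext0 (\<lambda>k. wronskian (fp k) (fm (-k)) / wronskian (fm k) (fp k))"

text \<open>For l = 0..j-1 the l-th derivative of (F k - F 0)/k (continuously extended to k = 0)
  exists and lies in the Wiener algebra: g l is the l-th derivative.\<close>
definition diff_quot_derivs_in_wiener :: "nat \<Rightarrow> (real \<Rightarrow> complex) \<Rightarrow> bool" where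
  "diff_quot_derivs_in_wiener j F \<longleftrightarrow> (\<exists>g :: nat \<Rightarrow> real \<Rightarrow> complex.
     (\<forall>k. k \<noteq> 0 \<longrightarrow> g 0 k = (F k - F 0) / complex_of_real k) \<and>
     (\<forall>l. l + 1 \<le> j - 1 \<longrightarrow> (\<forall>k. (g l has_vector_derivative g (Suc l) k) (at k))) \<and>
     (\<forall>l. l \<le> j - 1 \<longrightarrow> g l \<in> wiener_algebra))"

end

theory Submission
  imports Defs "HOL-Probability.Probability" "HOL-Real_Asymp.Real_Asymp"
begin

text \<open>
  On each half-line Marchenko's kernel represents \<open>exp (- i k x) f\<^sub>+ x k - 1\<close> as the Fourier transform of an integrable
  function whose decay is controlled by that of \<open>V\<close>. Hence the value \<open>\<alpha> k\<close> and the outgoing derivative \<open>\<delta> k\<close>, corrected by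
  \<open>i k \<alpha> k\<close>, of the Jost solutions at 0 lie in the algebra of functions which, together with their difference quotient at 0,
  are a constant plus a function with \<open>j - 1\<close> derivatives in the Wiener algebra. Wiener's lemma makes this algebra closed
  under inversion, and the Wronskians are polynomials in \<open>\<alpha>\<close>, \<open>\<delta>\<close> of the two half-lines.

  If \<open>W 0 \<noteq> 0\<close>, numerators and denominators are divided by \<open>k + i\<close>. If \<open>W 0 = 0\<close>, one has to invert \<open>W k / k\<close>, which seems to cost
  one order of regularity. It is recovered from the zero-energy solution: \<open>\<alpha> 0 \<delta> k - \<delta> 0 \<alpha> k = i k + k\<^sup>2 G k\<close>, where \<open>G\<close> is the
  integral over the half-line of \<open>f\<^sub>+ x 0 f\<^sub>+ x k - exp (i k x)\<close>, and for a resonance \<open>W k / k\<close> is a polynomial in \<open>\<alpha>\<close>,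
  \<open>\<delta> - i k \<alpha>\<close> and \<open>i + k G k\<close> of the two half-lines.
\<close>

section \<open>The Fourier transform and the Wiener algebra\<close>

text \<open>Derivative count, with \<open>m = j - 1\<close>: \<open>V\<close> has weight
  \<open>m + 2\<close>; passing to a tail integral costs one power, so the kernels at 0 have weight
  \<open>m + 1\<close>; a difference quotient at 0 costs another and leaves exactly the
  \<open>m\<close> derivatives required. With a resonance, \<open>W k / k\<close> is itself a
  difference quotient, and inverting it inside the algebra calls for a difference quotient of it,
  that is, a second-order one, for which the moments of the kernels fall short by one. The functions
  \<open>G\<close> supply this second-order remainder directly, as transforms of integrable
  functions of weight \<open>m\<close>.

  The potential is cut at 0 because the Volterra estimates are uniform only towards the end at which
  a Jost solution is normalised, and the Wronskians need nothing but the data at 0. The Jost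
  solutions are given, not constructed: the kernel is identified with them by uniqueness for a
  Volterra equation. Since \<open>W\<close> grows linearly in \<open>k\<close>, it lies in the
  algebra only after division by a linear factor; \<open>k + i\<close> has no real zero.\<close>

abbreviation L1 :: "(real \<Rightarrow> 'a::{banach, second_countable_topology}) \<Rightarrow> bool" where
  "L1 f \<equiv> integrable lborel f"

abbreviation l1norm :: "(real \<Rightarrow> 'a::{banach, second_countable_topology}) \<Rightarrow> real" where
  "l1norm f \<equiv> LINT x|lborel. norm (f x)"

abbreviation lborel2 :: "(real \<times> real) measure" where
  "lborel2 \<equiv> lborel \<Otimes>\<^sub>M lborel"

lemmas L1_dominated = Bochner_Integration.integrable_bound
lemmas L1_add = Bochner_Integration.integrable_add
lemmas LINT_cong = Bochner_Integration.integral_cong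
lemmas LINT_add = Bochner_Integration.integral_add

definition ft :: "(real \<Rightarrow> complex) \<Rightarrow> real \<Rightarrow> complex" where
  "ft h k = (LINT p|lborel. iexp (k * p) * h p)"

lemma norm_exp_i_real [simp]: "norm (iexp x) = 1"
  by simp

lemma integrable_exp_i_mult [intro]:
  assumes "L1 h"
  shows "L1 (\<lambda>p. iexp (k * p) * h p)"
proof (rule L1_dominated[OF assms])
  show "(\<lambda>p. iexp (k * p) * h p) \<in> borel_measurable lborel"
    using assms by measurable
qed (auto simp: norm_mult)

lemma norm_ft_le:
  assumes "L1 h"
  shows "norm (ft h k) \<le> (l1norm h)"
proof -
  have "norm (ft h k) \<le> (LINT p|lborel. norm (iexp (k * p) * h p))"
    unfolding ft_def by (rule integral_norm_bound)
  then show ?thesis by (simp add: norm_mult)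
qed

lemma ft_add:
  assumes "L1 h" "L1 g"
  shows "ft (\<lambda>p. h p + g p) k = ft h k + ft g k"
  using integrable_exp_i_mult[OF assms(1)] integrable_exp_i_mult[OF assms(2)]
  by (simp add: ft_def distrib_left)

lemma ft_diff:
  assumes "L1 h" "L1 g"
  shows "ft (\<lambda>p. h p - g p) k = ft h k - ft g k"
  using integrable_exp_i_mult[OF assms(1)] integrable_exp_i_mult[OF assms(2)]
  by (simp add: ft_def right_diff_distrib)

lemma ft_cmult: "ft (\<lambda>p. c * h p) k = c * ft h k"
proof -
  have "ft (\<lambda>p. c * h p) k = (LINT p|lborel. c * (iexp (k * p) * h p))"
    by (simp add: ft_def mult.left_commute)
  then show ?thesis unfolding ft_def by simp
qed

lemma ft_translate: "ft (\<lambda>p. h (p - s)) k = iexp (k * s) * ft h k"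
proof -
  have "ft (\<lambda>p. h (p - s)) k = (LINT p|lborel. iexp (k * (s + 1 * p)) * h (s + 1 * p - s))"
    unfolding ft_def by (subst lborel_integral_real_affine[where c = 1 and t = s]) simp_all
  also have "\<dots> = (LINT p|lborel. iexp (k * s) * (iexp (k * p) * h p))"
    by (intro LINT_cong) (auto simp: algebra_simps exp_add)
  finally show ?thesis unfolding ft_def by simp
qed

lemma ft_reflect: "ft (\<lambda>p. h (- p)) k = ft h (- k)"
  unfolding ft_def by (subst lborel_integral_real_affine[where c = "-1" and t = 0]) simp_all

section \<open>Superpositions and convolution\<close>

lemma pair_integrableI:
  fixes c :: "real \<Rightarrow> real \<Rightarrow> 'a::{banach, second_countable_topology}"
  assumes "(\<lambda>(t, p). c t p) \<in> borel_measurable lborel2"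
    and "\<And>t. L1 (c t)"
    and "L1 w" "\<And>t. (LINT p|lborel. norm (c t p)) \<le> w t"
  shows "integrable lborel2 (\<lambda>(t, p). c t p)"
proof (rule lborel_pair.Fubini_integrable)
  note [measurable] = assms(1)
  show "L1 (\<lambda>x. LINT y|lborel. norm (case (x, y) of (t, p) \<Rightarrow> c t p))"
  proof (rule L1_dominated[OF assms(3)])
    show "AE x in lborel. norm (LINT y|lborel. norm (case (x, y) of (t, p) \<Rightarrow> c t p)) \<le> norm (w x)"
    proof (intro AE_I2)
      fix x
      have "0 \<le> (LINT y|lborel. norm (c x y))" by (rule integral_nonneg_AE) auto
      with assms(4)[of x] show "norm (LINT y|lborel. norm (case (x, y) of (t, p) \<Rightarrow> c t p)) \<le> norm (w x)"
        by simp
    qed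
  qed measurable
qed (use assms in auto)

text \<open>Fubini together with the integral Minkowski inequality. Convolutions, Gaussian smoothing
  and all kernels defined by integrals are superpositions of functions \<open>c t\<close>, so their
  transforms are computed under the integral sign.\<close>

lemma ft_superposition:
  assumes c: "integrable lborel2 (\<lambda>(t, p). c t p)"
  shows "L1 (\<lambda>p. LINT t|lborel. c t p)"
    and "ft (\<lambda>p. LINT t|lborel. c t p) k = (LINT t|lborel. ft (c t) k)"
    and "L1 (\<lambda>t. ft (c t) k)"
    and "(LINT p|lborel. norm (LINT t|lborel. c t p)) \<le> (LINT t|lborel. LINT p|lborel. norm (c t p))"
proof -
  note [measurable] = borel_measurable_integrable[OF c]
  show i1: "L1 (\<lambda>p. LINT t|lborel. c t p)"
    by (rule lborel_pair.integrable_snd[OF c])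
  have e: "integrable lborel2 (\<lambda>(t, p). iexp (k * p) * c t p)"
    by (rule L1_dominated[OF c]) (auto simp: norm_mult split_beta')
  have "ft (\<lambda>p. LINT t|lborel. c t p) k = (LINT p|lborel. LINT t|lborel. iexp (k * p) * c t p)"
    unfolding ft_def by simp
  also have "\<dots> = (LINT t|lborel. ft (c t) k)"
    unfolding ft_def by (rule lborel_pair.Fubini_integral[OF e])
  finally show "ft (\<lambda>p. LINT t|lborel. c t p) k = (LINT t|lborel. ft (c t) k)" .
  show "L1 (\<lambda>t. ft (c t) k)"
    unfolding ft_def by (rule lborel_pair.integrable_fst[OF e])
  have n: "integrable lborel2 (\<lambda>(t, p). norm (c t p))"
    using integrable_norm[OF c] by (simp add: split_beta')
  have "(LINT p|lborel. norm (LINT t|lborel. c t p)) \<le> (LINT p|lborel. LINT t|lborel. norm (c t p))"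
    by (intro integral_mono i1 integrable_norm lborel_pair.integrable_snd[OF n] integral_norm_bound)
  also have "\<dots> = (LINT t|lborel. LINT p|lborel. norm (c t p))"
    by (rule lborel_pair.Fubini_integral[OF n])
  finally show "(LINT p|lborel. norm (LINT t|lborel. c t p)) \<le> (LINT t|lborel. LINT p|lborel. norm (c t p))" .
qed

lemma integral_real_translate:
  fixes f :: "real \<Rightarrow> 'a::{banach, second_countable_topology}"
  shows "(LINT p|lborel. f (p - s)) = (LINT p|lborel. f p)"
  by (subst lborel_integral_real_affine[where c = 1 and t = s]) simp_all

lemma integrable_real_translate:
  fixes f :: "real \<Rightarrow> 'a::{banach, second_countable_topology}"
  assumes "L1 f"
  shows "L1 (\<lambda>p. f (p - s))"
  using lborel_integrable_real_affine[OF assms, of 1 "-s"] by simp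

lemma pair_integrable_convolution:
  assumes h: "L1 h" and g: "L1 (g :: real \<Rightarrow> complex)"
  shows "integrable lborel2 (\<lambda>(t, p). h t * g (p - t))"
proof (rule pair_integrableI)
  note [measurable] = borel_measurable_integrable[OF h] borel_measurable_integrable[OF g]
  show "(\<lambda>(t, p). h t * g (p - t)) \<in> borel_measurable lborel2" by measurable
  show "L1 (\<lambda>p. h t * g (p - t))" for t
    using integrable_real_translate[OF g] by simp
  show "L1 (\<lambda>t. norm (h t) * (l1norm g))"
    using h by simp
  show "(LINT p|lborel. norm (h t * g (p - t))) \<le> norm (h t) * (l1norm g)" for t
    by (simp add: norm_mult integral_real_translate[of "\<lambda>p. norm (g p)"])
qed

lemma ft_convolution:
  assumes h: "L1 h" and g: "L1 g"
  shows "L1 (\<lambda>p. LINT t|lborel. h t * g (p - t))"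
    and "ft (\<lambda>p. LINT t|lborel. h t * g (p - t)) k = ft h k * ft g k"
    and "(LINT p|lborel. norm (LINT t|lborel. h t * g (p - t)))
           \<le> (l1norm h) * (l1norm g)"
proof -
  note c = pair_integrable_convolution[OF h g]
  show "L1 (\<lambda>p. LINT t|lborel. h t * g (p - t))"
    by (rule ft_superposition(1)[OF c])
  have "ft (\<lambda>p. LINT t|lborel. h t * g (p - t)) k = (LINT t|lborel. ft (\<lambda>p. h t * g (p - t)) k)"
    by (rule ft_superposition(2)[OF c])
  also have "\<dots> = (LINT t|lborel. iexp (k * t) * h t * ft g k)"
    by (simp add: ft_cmult ft_translate mult_ac)
  also have "\<dots> = ft h k * ft g k"
    unfolding ft_def[of h] by simp
  finally show "ft (\<lambda>p. LINT t|lborel. h t * g (p - t)) k = ft h k * ft g k" .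
  have "(LINT t|lborel. LINT p|lborel. norm (h t * g (p - t))) = (l1norm h) * (l1norm g)"
    by (simp add: norm_mult integral_real_translate[of "\<lambda>p. norm (g p)"])
  with ft_superposition(4)[OF c]
  show "(LINT p|lborel. norm (LINT t|lborel. h t * g (p - t)))
           \<le> (l1norm h) * (l1norm g)" by simp
qed

text \<open>A bound in place of a norm: any representing \<open>h\<close> will do, so neither an
  infimum nor injectivity of \<open>ft\<close> enters.\<close>

definition wnorm_le :: "real \<Rightarrow> (real \<Rightarrow> complex) \<Rightarrow> bool" where
  "wnorm_le N F \<longleftrightarrow> (\<exists>h. L1 h \<and> F = ft h \<and> (l1norm h) \<le> N)"

lemma wiener_algebra_iff: "F \<in> wiener_algebra \<longleftrightarrow> (\<exists>h. L1 h \<and> F = ft h)"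
  unfolding wiener_algebra_def by (auto simp: ft_def fun_eq_iff)

lemma wiener_algebra_iff_wnorm_le: "F \<in> wiener_algebra \<longleftrightarrow> (\<exists>N. wnorm_le N F)"
  unfolding wiener_algebra_iff wnorm_le_def by auto

lemma wnorm_le_imp_wiener: "wnorm_le N F \<Longrightarrow> F \<in> wiener_algebra"
  unfolding wiener_algebra_iff_wnorm_le by auto

lemma wnorm_le_norm_le: "wnorm_le N F \<Longrightarrow> norm (F k) \<le> N"
  unfolding wnorm_le_def using norm_ft_le order_trans by blast

lemma wnorm_le_mono: "wnorm_le N F \<Longrightarrow> N \<le> M \<Longrightarrow> wnorm_le M F"
  unfolding wnorm_le_def by force

lemma wnorm_le_zero: "wnorm_le 0 (\<lambda>_. 0)"
  unfolding wnorm_le_def by (rule exI[of _ "\<lambda>_. 0"]) (auto simp: ft_def)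

lemma wnorm_le_add:
  assumes "wnorm_le N F" "wnorm_le M G"
  shows "wnorm_le (N + M) (\<lambda>k. F k + G k)"
proof -
  obtain h g where h: "L1 h" "F = ft h" "(l1norm h) \<le> N"
    and g: "L1 g" "G = ft g" "(l1norm g) \<le> M"
    using assms unfolding wnorm_le_def by blast
  have "(LINT p|lborel. norm (h p + g p)) \<le> (LINT p|lborel. norm (h p) + norm (g p))"
    using h g by (intro integral_mono) (auto simp: norm_triangle_ineq)
  also have "\<dots> \<le> N + M" using h g by simp
  finally show ?thesis unfolding wnorm_le_def
    by (intro exI[of _ "\<lambda>p. h p + g p"]) (use h g in \<open>auto simp: ft_add fun_eq_iff\<close>)
qed

lemma wnorm_le_cmult:
  assumes "wnorm_le N F"
  shows "wnorm_le (norm c * N) (\<lambda>k. c * F k)"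
proof -
  obtain h where h: "L1 h" "F = ft h" "(l1norm h) \<le> N"
    using assms unfolding wnorm_le_def by blast
  then show ?thesis unfolding wnorm_le_def
    by (intro exI[of _ "\<lambda>p. c * h p"]) (auto simp: ft_cmult fun_eq_iff norm_mult mult_left_mono)
qed

lemma wnorm_le_mult:
  assumes "wnorm_le N F" "wnorm_le M G"
  shows "wnorm_le (N * M) (\<lambda>k. F k * G k)"
proof -
  obtain h g where h: "L1 h" "F = ft h" "(l1norm h) \<le> N"
    and g: "L1 g" "G = ft g" "(l1norm g) \<le> M"
    using assms unfolding wnorm_le_def by blast
  have "0 \<le> (l1norm h)" "0 \<le> (l1norm g)"
    by (auto intro!: integral_nonneg_AE)
  then have "(l1norm h) * (l1norm g) \<le> N * M"
    using h g by (intro mult_mono) linarith+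
  then show ?thesis unfolding wnorm_le_def
    by (intro exI[of _ "\<lambda>p. LINT t|lborel. h t * g (p - t)"])
       (use h g ft_convolution[of h g] in \<open>auto simp: fun_eq_iff\<close>)
qed

lemma wnorm_le_power:
  assumes "wnorm_le N F"
  shows "wnorm_le (N ^ Suc n) (\<lambda>k. F k ^ Suc n)"
proof (induction n)
  case (Suc n)
  from wnorm_le_mult[OF assms Suc] show ?case by simp
qed (use assms in simp)

text \<open>Completeness of the algebra in the form needed for Newman's series: an absolutely
  convergent series is summed on the side of the representing functions.\<close>

lemma wnorm_le_suminf:
  assumes "\<And>n. wnorm_le (N n) (F n)" and N: "summable N"
  shows "wnorm_le (suminf N) (\<lambda>k. \<Sum>n. F n k)"
proof -
  have "\<exists>h. \<forall>n. L1 (h n) \<and> F n = ft (h n) \<and> (LINT p|lborel. norm (h n p)) \<le> N n"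
    using assms(1) unfolding wnorm_le_def by metis
  then obtain h where h: "\<And>n. L1 (h n)" "\<And>n. F n = ft (h n)"
    "\<And>n. (LINT p|lborel. norm (h n p)) \<le> N n" by blast
  have nn: "0 \<le> (LINT p|lborel. norm (h n p))" for n by (rule integral_nonneg_AE) auto
  have s0: "summable (\<lambda>n. LINT p|lborel. norm (h n p))"
    by (rule summable_comparison_test'[OF N, of 0]) (use h(3) nn in auto)
  \<comment> \<open>The sum of the norms has a finite integral, so it is finite almost
    everywhere.\<close>
  have fin: "AE p in lborel. summable (\<lambda>n. norm (h n p))"
  proof -
    have "(\<integral>\<^sup>+p. (\<Sum>n. ennreal (norm (h n p))) \<partial>lborel) = (\<Sum>n. \<integral>\<^sup>+p. ennreal (norm (h n p)) \<partial>lborel)"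
      using h(1) by (intro nn_integral_suminf) auto
    also have "\<dots> = (\<Sum>n. ennreal (LINT p|lborel. norm (h n p)))"
      using h(1) by (subst nn_integral_eq_integral) auto
    also have "\<dots> = ennreal (\<Sum>n. LINT p|lborel. norm (h n p))"
      by (rule suminf_ennreal2) (use nn s0 in auto)
    also have "\<dots> \<noteq> \<infinity>" by simp
    finally have *: "(\<integral>\<^sup>+p. (\<Sum>n. ennreal (norm (h n p))) \<partial>lborel) \<noteq> \<infinity>" .
    have "AE p in lborel. (\<Sum>n. ennreal (norm (h n p))) \<noteq> \<infinity>"
      by (rule nn_integral_PInf_AE[OF _ *]) (use h(1) in \<open>auto intro!: borel_measurable_suminf_order\<close>)
    then show ?thesis
      by eventually_elim (auto intro: summable_suminf_not_top)
  qed
  define g where "g = (\<lambda>p. \<Sum>n. h n p)"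
  have gi: "L1 g" unfolding g_def
    by (rule integrable_suminf[OF h(1) fin s0])
  have "ft g k = (\<Sum>n. F n k)" for k
  proof -
    have "(LINT p|lborel. (\<Sum>n. iexp (k * p) * h n p))
       = (\<Sum>n. LINT p|lborel. iexp (k * p) * h n p)"
    proof (rule integral_suminf)
      show "L1 (\<lambda>p. iexp (k * p) * h n p)" for n
        by (rule integrable_exp_i_mult[OF h(1)])
    qed (use fin s0 in \<open>auto simp: norm_mult\<close>)
    moreover have "(LINT p|lborel. (\<Sum>n. iexp (k * p) * h n p)) = ft g k"
      unfolding ft_def g_def
      by (rule integral_cong_AE) (use h(1) fin in \<open>auto intro!: suminf_mult elim!: eventually_mono summable_norm_cancel\<close>)
    ultimately show ?thesis by (simp add: h(2) ft_def)
  qed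
  moreover have "(l1norm g) \<le> suminf N"
  proof -
    have i: "L1 (\<lambda>p. \<Sum>n. norm (h n p))"
      by (rule integrable_suminf) (use h(1) fin s0 in auto)
    have "(l1norm g) \<le> (LINT p|lborel. (\<Sum>n. norm (h n p)))"
      by (rule integral_mono_AE) (use gi i fin in \<open>auto simp: g_def elim!: eventually_mono intro!: summable_norm\<close>)
    also have "\<dots> = (\<Sum>n. LINT p|lborel. norm (h n p))"
      by (rule integral_suminf) (use h(1) fin s0 in auto)
    also have "\<dots> \<le> suminf N" by (rule suminf_le[OF h(3) s0 N])
    finally show ?thesis .
  qed
  ultimately show ?thesis unfolding wnorm_le_def
    by (intro exI[of _ g]) (use gi in auto)
qed

section \<open>Continuity and derivatives of Fourier transforms\<close>

lemma has_vector_derivative_iff_quotient: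
  fixes f :: "real \<Rightarrow> 'a::real_normed_vector"
  shows "(f has_vector_derivative D) (at x) \<longleftrightarrow> ((\<lambda>y. (f y - f x) /\<^sub>R (y - x)) \<longlongrightarrow> D) (at x)"
proof -
  have "norm (f y - f x - (y - x) *\<^sub>R D) / norm (y - x) = norm ((f y - f x) /\<^sub>R (y - x) - D)" if "y \<noteq> x" for y
  proof -
    have "(f y - f x) /\<^sub>R (y - x) - D = (f y - f x - (y - x) *\<^sub>R D) /\<^sub>R (y - x)"
      using that by (simp add: scaleR_right_diff_distrib)
    then show ?thesis by (simp add: divide_inverse_commute)
  qed
  then have "((\<lambda>y. norm (f y - f x - (y - x) *\<^sub>R D) / norm (y - x)) \<longlongrightarrow> 0) (at x)
     \<longleftrightarrow> ((\<lambda>y. norm ((f y - f x) /\<^sub>R (y - x) - D)) \<longlongrightarrow> 0) (at x)"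
    by (intro filterlim_cong) (auto simp: eventually_at_filter)
  also have "\<dots> \<longleftrightarrow> ((\<lambda>y. (f y - f x) /\<^sub>R (y - x)) \<longlongrightarrow> D) (at x)"
    by (simp add: tendsto_norm_zero_iff LIM_zero_iff)
  finally show ?thesis
    unfolding has_vector_derivative_def has_derivative_iff_norm by (simp add: bounded_linear_scaleR_left)
qed

lemma norm_exp_i_diff_le:
  "norm (iexp x - iexp y) \<le> \<bar>x - y\<bar>"
proof -
  have "iexp x - iexp y
      = iexp y * (iexp (x - y) - 1)"
    by (simp add: exp_diff algebra_simps)
  then have "norm (iexp x - iexp y) = norm (iexp (x - y) - 1)"
    by (simp add: norm_mult)
  also have "\<dots> \<le> \<bar>x - y\<bar>" using iexp_approx1[of "x - y" 0] by simp
  finally show ?thesis .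
qed

lemma has_vector_derivative_exp_i:
  "((\<lambda>y. iexp (y * p)) has_vector_derivative \<i> * p * iexp (k * p)) (at k)"
proof -
  have "((\<lambda>z. exp (\<i> * (z * p))) has_field_derivative \<i> * p * exp (\<i> * (complex_of_real k * p))) (at (complex_of_real k))"
    by (auto intro!: derivative_eq_intros)
  then show ?thesis
    using has_vector_derivative_real_field[of "\<lambda>z. exp (\<i> * (z * p))"] by simp
qed

lemma ft_continuous:
  assumes h: "L1 h"
  shows "isCont (ft h) k"
  unfolding isCont_def tendsto_at_iff_sequentially comp_def
proof (intro allI impI)
  fix X assume X: "\<forall>i. X i \<in> UNIV - {k}" "X \<longlonglongrightarrow> k"
  note [measurable] = borel_measurable_integrable[OF h]
  show "(\<lambda>i. ft h (X i)) \<longlonglongrightarrow> ft h k"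
    unfolding ft_def
  proof (rule integral_dominated_convergence)
    show "L1 (\<lambda>p. norm (h p))" using h by simp
    show "AE p in lborel. (\<lambda>i. iexp (X i * p) * h p) \<longlonglongrightarrow> iexp (k * p) * h p"
      by (intro AE_I2 tendsto_intros X)
  qed (auto simp: norm_mult)
qed

text \<open>The difference quotients of \<open>iexp (k * p)\<close> in \<open>k\<close> are bounded
  by \<open>\<bar>p\<bar>\<close>, so \<open>p * h p\<close> dominates and dominated convergence
  along sequences applies.\<close>

lemma ft_has_vector_derivative:
  fixes h :: "real \<Rightarrow> complex"
  assumes h: "L1 h" and h': "L1 (\<lambda>p. complex_of_real p * h p)"
  shows "(ft h has_vector_derivative ft (\<lambda>p. \<i> * (p * h p)) k) (at k)"
  unfolding has_vector_derivative_iff_quotient tendsto_at_iff_sequentially comp_def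
proof (intro allI impI)
  fix X assume X: "\<forall>i. X i \<in> UNIV - {k}" "X \<longlonglongrightarrow> k"
  note [measurable] = borel_measurable_integrable[OF h]
  let ?e = "\<lambda>k p. iexp (k * p)"
  have "(\<lambda>i. LINT p|lborel. ((?e (X i) p - ?e k p) /\<^sub>R (X i - k)) * h p) \<longlonglongrightarrow> (LINT p|lborel. ?e k p * (\<i> * (p * h p)))"
  proof (rule integral_dominated_convergence)
    show "L1 (\<lambda>p. norm (complex_of_real p * h p))" using h' by simp
    show "AE p in lborel. norm (((?e (X i) p - ?e k p) /\<^sub>R (X i - k)) * h p) \<le> norm (complex_of_real p * h p)" for i
    proof (intro AE_I2)
      fix p
      have "norm (?e (X i) p - ?e k p) \<le> \<bar>X i - k\<bar> * \<bar>p\<bar>"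
        using norm_exp_i_diff_le[of "X i * p" "k * p"] by (simp add: abs_mult[symmetric] left_diff_distrib)
      then have "norm (?e (X i) p - ?e k p) / \<bar>X i - k\<bar> \<le> \<bar>p\<bar>"
        using X(1) by (simp add: field_simps)
      then have "norm ((?e (X i) p - ?e k p) /\<^sub>R (X i - k)) \<le> \<bar>p\<bar>"
        by (simp add: divide_inverse_commute)
      then show "norm (((?e (X i) p - ?e k p) /\<^sub>R (X i - k)) * h p) \<le> norm (complex_of_real p * h p)"
        unfolding norm_mult by (intro mult_right_mono) auto
    qed
    show "AE p in lborel. (\<lambda>i. ((?e (X i) p - ?e k p) /\<^sub>R (X i - k)) * h p) \<longlonglongrightarrow> ?e k p * (\<i> * (p * h p))"
    proof (intro AE_I2)
      fix p
      have "(\<lambda>i. (?e (X i) p - ?e k p) /\<^sub>R (X i - k)) \<longlonglongrightarrow> \<i> * p * ?e k p"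
        using has_vector_derivative_exp_i[of p k] X
        unfolding has_vector_derivative_iff_quotient tendsto_at_iff_sequentially comp_def by blast
      then have "(\<lambda>i. ((?e (X i) p - ?e k p) /\<^sub>R (X i - k)) * h p) \<longlonglongrightarrow> \<i> * p * ?e k p * h p"
        by (intro tendsto_intros)
      then show "(\<lambda>i. ((?e (X i) p - ?e k p) /\<^sub>R (X i - k)) * h p) \<longlonglongrightarrow> ?e k p * (\<i> * (p * h p))"
        by (simp add: mult_ac)
    qed
  qed measurable
  moreover have "(LINT p|lborel. ((?e (X i) p - ?e k p) /\<^sub>R (X i - k)) * h p) = (ft h (X i) - ft h k) /\<^sub>R (X i - k)" for i
  proof -
    have "(LINT p|lborel. ((?e (X i) p - ?e k p) /\<^sub>R (X i - k)) * h p)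
        = (LINT p|lborel. (?e (X i) p * h p - ?e k p * h p) /\<^sub>R (X i - k))"
      by (simp add: left_diff_distrib)
    also have "\<dots> = (ft h (X i) - ft h k) /\<^sub>R (X i - k)"
      unfolding ft_def by (simp only: integral_scaleR_right Bochner_Integration.integral_diff[OF integrable_exp_i_mult[OF h] integrable_exp_i_mult[OF h]])
    finally show ?thesis .
  qed
  ultimately show "(\<lambda>i. (ft h (X i) - ft h k) /\<^sub>R (X i - k)) \<longlonglongrightarrow> ft (\<lambda>p. \<i> * (p * h p)) k"
    unfolding ft_def[of "\<lambda>p. \<i> * (p * h p)"] by (simp only:)
qed

section \<open>Integration by parts and the multiplication formula\<close>

lemma integral_vector_derivative_eq_0:
  fixes G :: "real \<Rightarrow> complex"
  assumes d: "\<And>x. (G has_vector_derivative G' x) (at x)" and i: "L1 G'"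
    and lim: "(G \<longlongrightarrow> 0) at_top" "(G \<longlongrightarrow> 0) at_bot"
  shows "integral\<^sup>L lborel G' = 0"
proof (rule LIMSEQ_unique)
  have s: "set_integrable lborel {- real n..real n} G'" for n
    using i unfolding set_integrable_def by (intro integrable_mult_indicator) auto
  have e: "(LINT x|lborel. indicator {- real n..real n} x *\<^sub>R G' x) = G (real n) - G (- real n)" for n
  proof -
    have "(LINT x|lborel. indicator {- real n..real n} x *\<^sub>R G' x) = integral {- real n..real n} G'"
      using set_borel_integral_eq_integral(2)[OF s] by (simp add: set_lebesgue_integral_def)
    also have "\<dots> = G (real n) - G (- real n)"
      by (intro integral_unique fundamental_theorem_of_calculus) (auto intro: has_vector_derivative_at_within d)
    finally show ?thesis .
  qed
  show "(\<lambda>n. LINT x|lborel. indicator {- real n..real n} x *\<^sub>R G' x) \<longlonglongrightarrow> integral\<^sup>L lborel G'"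
  proof (rule integral_dominated_convergence)
    show "AE x in lborel. (\<lambda>n. indicator {- real n..real n} x *\<^sub>R G' x) \<longlonglongrightarrow> G' x"
    proof (intro AE_I2 tendsto_eventually)
      fix x
      obtain N :: nat where "\<bar>x\<bar> \<le> real N" using real_arch_simple by blast
      then show "\<forall>\<^sub>F n in sequentially. indicator {- real n..real n} x *\<^sub>R G' x = G' x"
        by (intro eventually_sequentiallyI[of N]) (auto simp: indicator_def)
    qed
    show "L1 (\<lambda>x. norm (G' x))" using i by simp
  qed (use i in \<open>auto simp: indicator_def\<close>)
  have "(\<lambda>n. G (real n) - G (- real n)) \<longlonglongrightarrow> 0 - 0"
    by (intro tendsto_diff filterlim_compose[OF lim(1) filterlim_real_sequentially]
        filterlim_compose[OF lim(2)] filterlim_compose[OF filterlim_uminus_at_bot_at_top filterlim_real_sequentially])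
  then show "(\<lambda>n. LINT x|lborel. indicator {- real n..real n} x *\<^sub>R G' x) \<longlonglongrightarrow> 0"
    unfolding e by simp
qed

text \<open>The total derivative of \<open>iexp (p * x) * F x\<close> has integral 0.\<close>

lemma ft_of_derivative:
  assumes d: "\<And>x. (F has_vector_derivative F' x) (at x)"
    and i: "L1 F" "L1 F'"
    and lim: "(F \<longlongrightarrow> 0) at_top" "(F \<longlongrightarrow> 0) at_bot"
  shows "ft F' p = - \<i> * p * ft F p"
proof -
  let ?e = "\<lambda>x. iexp (p * x)"
  have "integral\<^sup>L lborel (\<lambda>x. \<i> * p * (?e x * F x) + ?e x * F' x) = 0"
  proof (rule integral_vector_derivative_eq_0[where G = "\<lambda>x. ?e x * F x"])
    show "((\<lambda>x. ?e x * F x) has_vector_derivative \<i> * p * (?e x * F x) + ?e x * F' x) (at x)" for x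
      using has_vector_derivative_mult[OF has_vector_derivative_exp_i[of p x] d[of x]]
      by (simp add: mult_ac add.commute)
    show "L1 (\<lambda>x. \<i> * p * (?e x * F x) + ?e x * F' x)"
      by (intro L1_add integrable_mult_right integrable_exp_i_mult i)
    show "((\<lambda>x. ?e x * F x) \<longlongrightarrow> 0) at_top" "((\<lambda>x. ?e x * F x) \<longlongrightarrow> 0) at_bot"
      using lim by (auto simp: tendsto_norm_zero_iff[of "\<lambda>x. ?e x * F x", symmetric] norm_mult
          simp del: of_real_mult intro!: tendsto_norm_zero)
  qed
  then have "\<i> * p * ft F p + ft F' p = 0"
    unfolding ft_def
    by (simp only: LINT_add[OF integrable_mult_right[OF integrable_exp_i_mult[OF i(1)]]
          integrable_exp_i_mult[OF i(2)]] integral_mult_right_zero)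
  then show ?thesis by (simp add: add_eq_0_iff)
qed

lemma ft_exchange:
  assumes h: "L1 h" and g: "L1 g"
  shows "(LINT p|lborel. ft h p * g p) = (LINT q|lborel. h q * ft g q)"
proof -
  note [measurable] = borel_measurable_integrable[OF h] borel_measurable_integrable[OF g]
  have *: "integrable lborel2 (\<lambda>(p, q). iexp (p * q) * h q * g p)"
  proof (rule pair_integrableI)
    show "L1 (\<lambda>p. norm (g p) * (l1norm h))" using g by simp
    show "L1 (\<lambda>q. iexp (p * q) * h q * g p)" for p
      by (intro integrable_mult_left integrable_exp_i_mult h)
  qed (auto simp: norm_mult mult_ac)
  have "(LINT p|lborel. ft h p * g p) = (LINT p|lborel. LINT q|lborel. iexp (p * q) * h q * g p)"
    by (simp add: ft_def)
  also have "\<dots> = (LINT q|lborel. LINT p|lborel. iexp (p * q) * h q * g p)"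
    by (rule lborel_pair.Fubini_integral[OF *, symmetric])
  also have "\<dots> = (LINT q|lborel. LINT p|lborel. h q * (iexp (q * p) * g p))"
    by (simp add: mult_ac)
  also have "\<dots> = (LINT q|lborel. h q * ft g q)"
    by (simp add: ft_def)
  finally show ?thesis .
qed

lemma ft_std_normal:
  "ft (\<lambda>u. complex_of_real (std_normal_density u)) t = complex_of_real (exp (- t\<^sup>2 / 2))"
proof -
  have "complex_of_real (exp (- t\<^sup>2 / 2)) = char std_normal_distribution t"
    by (simp add: char_std_normal_distribution)
  also have "\<dots> = (LINT x|lborel. std_normal_density x *\<^sub>R iexp (t * x))"
    unfolding char_def by (subst integral_density) auto
  finally show ?thesis by (simp add: ft_def scaleR_conv_of_real mult.commute)
qed

lemma measurable_ft [measurable]: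
  assumes "h \<in> borel_measurable borel"
  shows "ft h \<in> borel_measurable borel"
proof -
  have [measurable]: "h \<in> borel_measurable lborel" using assms by simp
  have "(\<lambda>k. LINT p|lborel. iexp (k * p) * h p) \<in> borel_measurable lborel"
    by measurable
  then show ?thesis unfolding ft_def[abs_def] by simp
qed

lemma integrable_std_normal: "L1 (\<lambda>u. complex_of_real (std_normal_density u))"
  by (intro integrable_of_real integrable_normal_density) auto

section \<open>Fourier inversion\<close>

text \<open>Fourier inversion by Gaussian regularisation: the multiplier \<open>exp (- (d p)^2 / 2)\<close>, moved to the
  other side by \<open>ft_exchange\<close>, becomes averaging against a Gaussian of width \<open>d\<close>.\<close>

lemma ft_gaussian:
  assumes "d > 0"
  shows "ft (\<lambda>p. iexp (k * p) * complex_of_real (exp (- (d * p)\<^sup>2 / 2))) q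
     = complex_of_real (sqrt (2 * pi) / d * exp (- ((k + q) / d)\<^sup>2 / 2))"
proof -
  have "ft (\<lambda>p. iexp (k * p) * complex_of_real (exp (- (d * p)\<^sup>2 / 2))) q
      = (LINT p|lborel. iexp ((k + q) * p) * complex_of_real (exp (- (d * p)\<^sup>2 / 2)))"
    unfolding ft_def by (simp add: exp_add[symmetric] mult.assoc[symmetric] del: of_real_exp) (simp add: algebra_simps)
  also have "\<dots> = \<bar>1 / d\<bar> *\<^sub>R (LINT u|lborel. iexp ((k + q) * (0 + 1 / d * u)) * complex_of_real (exp (- (d * (0 + 1 / d * u))\<^sup>2 / 2)))"
    using assms by (intro lborel_integral_real_affine) auto
  also have "(LINT u|lborel. iexp ((k + q) * (0 + 1 / d * u)) * complex_of_real (exp (- (d * (0 + 1 / d * u))\<^sup>2 / 2)))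
     = (LINT u|lborel. complex_of_real (sqrt (2 * pi)) * (iexp ((k + q) / d * u) * complex_of_real (std_normal_density u)))"
    using assms by (intro LINT_cong) (auto simp: std_normal_density_def)
  also have "\<dots> = complex_of_real (sqrt (2 * pi)) * ft (\<lambda>u. complex_of_real (std_normal_density u)) ((k + q) / d)"
    by (simp add: ft_def)
  finally show ?thesis
    using assms unfolding ft_std_normal by (simp add: scaleR_conv_of_real)
qed

lemma integrable_gaussian:
  assumes "d > 0"
  shows "L1 (\<lambda>p. complex_of_real (exp (- (d * p)\<^sup>2 / 2)))"
proof -
  have "L1 (\<lambda>u. sqrt (2 * pi) * std_normal_density u)"
    by (intro integrable_mult_right integrable_normal_density) auto
  then have "L1 (\<lambda>u::real. exp (- u\<^sup>2 / 2))"
    by (simp add: std_normal_density_def)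
  from lborel_integrable_real_affine[OF this, of d 0] assms
  show ?thesis by (intro integrable_of_real) simp
qed

lemma ft_inversion:
  assumes F: "L1 F" and cont: "\<And>k. isCont F k" and B: "\<And>k. norm (F k) \<le> B"
    and h: "L1 (ft F)"
  shows "F k = ft (\<lambda>p. ft F (- p) / (2 * pi)) k"
proof -
  let ?\<phi> = "\<lambda>u. complex_of_real (std_normal_density u)"
  have h': "L1 (\<lambda>p. ft F (- p))"
    using lborel_integrable_real_affine[OF h, of "-1" 0] by simp
  have eq: "(LINT p|lborel. ft F (- p) * (iexp (k * p) * complex_of_real (exp (- (d * p)\<^sup>2 / 2))))
      = 2 * pi * (LINT u|lborel. ?\<phi> u * F (k + d * u))" if d: "d > 0" for d
  proof -
    let ?g = "\<lambda>p. iexp (k * p) * complex_of_real (exp (- (d * p)\<^sup>2 / 2))"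
    have gi: "L1 ?g" by (intro integrable_exp_i_mult integrable_gaussian d)
    have Fm: "L1 (\<lambda>q. F (- q))"
      using lborel_integrable_real_affine[OF F, of "-1" 0] by simp
    have "(LINT p|lborel. ft F (- p) * ?g p) = (LINT p|lborel. ft (\<lambda>q. F (- q)) p * ?g p)"
      by (simp add: ft_reflect)
    also have "\<dots> = (LINT q|lborel. F (- q) * ft ?g q)"
      by (rule ft_exchange[OF Fm gi])
    also have "\<dots> = (LINT q|lborel. F (- q) * complex_of_real (sqrt (2 * pi) / d * exp (- ((k + q) / d)\<^sup>2 / 2)))"
      by (simp only: ft_gaussian[OF d])
    \<comment> \<open>Substituting \<open>q = - k - d * u\<close> turns the Gaussian centred at
      \<open>- k\<close> into the standard normal density, up to a constant, and
      \<open>F (- q)\<close> into \<open>F (k + d * u)\<close>.\<close>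
    also have "\<dots> = \<bar>- d\<bar> *\<^sub>R (LINT u|lborel. F (- (- k + (- d) * u)) * complex_of_real (sqrt (2 * pi) / d * exp (- ((k + (- k + (- d) * u)) / d)\<^sup>2 / 2)))"
      using d by (intro lborel_integral_real_affine) auto
    also have "\<dots> = (LINT u|lborel. complex_of_real (2 * pi) * (?\<phi> u * F (k + d * u)))"
    proof -
      have R: "2 * pi * std_normal_density u = sqrt (2 * pi) * exp (- u\<^sup>2 / 2)" for u
      proof -
        have "2 * pi * std_normal_density u = 2 * pi / sqrt (2 * pi) * exp (- u\<^sup>2 / 2)"
          by (simp add: std_normal_density_def)
        then show ?thesis by (simp only: real_div_sqrt pi_ge_zero mult_nonneg_nonneg zero_le_numeral)
      qed
      have S: "complex_of_real (sqrt (2 * pi)) * complex_of_real (exp (- u\<^sup>2 / 2)) = complex_of_real (2 * pi) * ?\<phi> u" for u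
        by (simp only: of_real_mult[symmetric] R)
      have "\<bar>- d\<bar> *\<^sub>R (F (- (- k + (- d) * u)) * complex_of_real (sqrt (2 * pi) / d * exp (- ((k + (- k + (- d) * u)) / d)\<^sup>2 / 2)))
          = complex_of_real (2 * pi) * (?\<phi> u * F (k + d * u))" for u
        using d S[of u] by (auto simp: scaleR_conv_of_real add.commute simp del: real_sqrt_mult)
      then show ?thesis
        by (subst integral_scaleR_right[symmetric]) (simp only:)
    qed
    finally show ?thesis by simp
  qed
  define D where "D n = 1 / real (Suc n)" for n
  have D: "D n > 0" "D \<longlonglongrightarrow> 0" for n
    unfolding D_def using LIMSEQ_inverse_real_of_nat by (auto simp: inverse_eq_divide)
  have [measurable]: "F \<in> borel_measurable borel" using F by auto
  \<comment> \<open>As the width \<open>D n\<close> tends to 0, the multiplier tends to 1 on this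
    side, while on the other side the Gaussian average of \<open>F\<close> tends to
    \<open>F k\<close> by continuity.\<close>
  have "(\<lambda>n. LINT p|lborel. ft F (- p) * (iexp (k * p) * complex_of_real (exp (- (D n * p)\<^sup>2 / 2))))
      \<longlonglongrightarrow> (LINT p|lborel. ft F (- p) * (iexp (k * p) * complex_of_real (exp (- (0 * p)\<^sup>2 / 2))))"
  proof (rule integral_dominated_convergence)
    show "L1 (\<lambda>p. norm (ft F (- p)))" using h' by simp
    show "AE p in lborel. (\<lambda>n. ft F (- p) * (iexp (k * p) * complex_of_real (exp (- (D n * p)\<^sup>2 / 2))))
       \<longlonglongrightarrow> ft F (- p) * (iexp (k * p) * complex_of_real (exp (- (0 * p)\<^sup>2 / 2)))"
      by (intro AE_I2 tendsto_intros D) auto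
    show "AE p in lborel. norm (ft F (- p) * (iexp (k * p) * complex_of_real (exp (- (D n * p)\<^sup>2 / 2)))) \<le> norm (ft F (- p))" for n
      by (intro AE_I2) (auto simp: norm_mult simp del: of_real_exp of_real_mult intro!: mult_left_le)
  qed measurable
  also have "(LINT p|lborel. ft F (- p) * (iexp (k * p) * complex_of_real (exp (- (0 * p)\<^sup>2 / 2)))) = ft (\<lambda>p. ft F (- p)) k"
    by (simp add: ft_def mult.commute)
  finally have lim1: "(\<lambda>n. 2 * pi * (LINT u|lborel. ?\<phi> u * F (k + D n * u))) \<longlonglongrightarrow> ft (\<lambda>p. ft F (- p)) k"
    unfolding eq[OF D(1)] by simp
  have "(\<lambda>n. LINT u|lborel. ?\<phi> u * F (k + D n * u)) \<longlonglongrightarrow> (LINT u|lborel. ?\<phi> u * F k)"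
  proof (rule integral_dominated_convergence)
    show "L1 (\<lambda>u. std_normal_density u * B)"
      by (intro integrable_mult_left integrable_normal_density) auto
    show "AE u in lborel. (\<lambda>n. ?\<phi> u * F (k + D n * u)) \<longlonglongrightarrow> ?\<phi> u * F k"
    proof (intro AE_I2 tendsto_mult tendsto_const isCont_tendsto_compose[OF cont])
      fix u show "(\<lambda>n. k + D n * u) \<longlonglongrightarrow> k"
        using tendsto_add[OF tendsto_const[of k] tendsto_mult_right[OF D(2), of u]] by simp
    qed
    show "AE u in lborel. norm (?\<phi> u * F (k + D n * u)) \<le> std_normal_density u * B" for n
      by (intro AE_I2) (auto simp: norm_mult intro!: mult_left_mono B)
  qed measurable
  also have "(LINT u|lborel. ?\<phi> u * F k) = F k"
    using ft_std_normal[of 0] by (simp add: ft_def)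
  finally have "(\<lambda>n. 2 * pi * (LINT u|lborel. ?\<phi> u * F (k + D n * u))) \<longlonglongrightarrow> 2 * pi * F k"
    by (intro tendsto_intros)
  with lim1 have "ft (\<lambda>p. ft F (- p)) k = 2 * pi * F k" by (rule LIMSEQ_unique)
  moreover have "ft (\<lambda>p. ft F (- p) / (2 * pi)) k = ft (\<lambda>p. ft F (- p)) k / (2 * pi)"
    using ft_cmult[of "1 / (2 * pi)" "\<lambda>p. ft F (- p)" k] by simp
  ultimately show ?thesis by simp
qed

section \<open>A smooth class inside the Wiener algebra\<close>

lemma bounded_of_continuous_vanishing:
  fixes F :: "real \<Rightarrow> complex"
  assumes cont: "\<And>k. isCont F k" and lim: "(F \<longlongrightarrow> 0) at_top" "(F \<longlongrightarrow> 0) at_bot"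
  shows "\<exists>B. \<forall>k. norm (F k) \<le> B"
proof -
  obtain N where N: "\<And>x. x \<ge> N \<Longrightarrow> norm (F x) < 1"
    using tendstoD[OF lim(1), of 1] unfolding eventually_at_top_linorder by auto
  obtain M where M: "\<And>x. x \<le> M \<Longrightarrow> norm (F x) < 1"
    using tendstoD[OF lim(2), of 1] unfolding eventually_at_bot_linorder by auto
  have "bounded (F ` {M..N})"
    by (intro compact_imp_bounded compact_continuous_image continuous_at_imp_continuous_on) (auto simp: cont)
  then obtain C where C: "\<And>x. x \<in> {M..N} \<Longrightarrow> norm (F x) \<le> C" unfolding bounded_iff by blast
  have "norm (F k) \<le> max C 1" for k
    using N[of k] M[of k] C[of k] by (cases "k \<le> M"; cases "k \<ge> N") auto
  then show ?thesis by blast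
qed

text \<open>Two integrable derivatives and decay at infinity are enough for \<open>ft F p\<close> to
  be of order \<open>1 / (1 + p^2)\<close>, hence integrable; inversion then puts \<open>F\<close>
  into the algebra with an explicit norm bound.\<close>

definition nice :: "(real \<Rightarrow> complex) \<Rightarrow> (real \<Rightarrow> complex) \<Rightarrow> (real \<Rightarrow> complex) \<Rightarrow> bool" where
  "nice F F1 F2 \<longleftrightarrow> (\<forall>x. (F has_vector_derivative F1 x) (at x)) \<and> (\<forall>x. (F1 has_vector_derivative F2 x) (at x)) \<and>
     L1 F \<and> L1 F1 \<and> L1 F2 \<and>
     (F \<longlongrightarrow> 0) at_top \<and> (F \<longlongrightarrow> 0) at_bot \<and> (F1 \<longlongrightarrow> 0) at_top \<and> (F1 \<longlongrightarrow> 0) at_bot"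

lemma integrable_inverse_1_plus_square_lborel:
  "L1 (\<lambda>x::real. inverse (1 + x\<^sup>2))" "(LINT x|lborel. inverse (1 + x\<^sup>2)) = pi"
  using integrable_inverse_1_plus_square LBINT_inverse_1_plus_square
  by (simp_all add: set_integrable_def interval_lebesgue_integral_def set_lebesgue_integral_def)

text \<open>Two integrations by parts give \<open>ft F2 p = - p^2 * ft F p\<close>. The integral
  \<open>pi\<close> of \<open>1 / (1 + p^2)\<close> cancels the \<open>1 / (2 * pi)\<close> of the
  inversion formula up to a factor 1/2, which is dropped.\<close>

lemma wnorm_le_nice:
  assumes "nice F F1 F2"
  shows "wnorm_le ((l1norm F) + (l1norm F2)) F"
proof -
  note n = assms[unfolded nice_def]
  define C where "C = (l1norm F) + (l1norm F2)"
  have C0: "C \<ge> 0" unfolding C_def by (intro add_nonneg_nonneg integral_nonneg_AE) auto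
  have cont: "isCont F k" for k using n by (meson has_vector_derivative_continuous)
  obtain B where B: "\<And>k. norm (F k) \<le> B"
    using bounded_of_continuous_vanishing[of F] cont n by blast
  have F2: "ft F2 p = - (complex_of_real p)\<^sup>2 * ft F p" for p
    using ft_of_derivative[of F F1 p] ft_of_derivative[of F1 F2 p] n
    by (simp add: power2_eq_square algebra_simps)
  have bd: "norm (ft F p) \<le> C * inverse (1 + p\<^sup>2)" for p
  proof -
    have "p\<^sup>2 * norm (ft F p) = norm (ft F2 p)" unfolding F2 by (simp add: norm_mult norm_power)
    also have "\<dots> \<le> (l1norm F2)" using n by (intro norm_ft_le) auto
    finally have "p\<^sup>2 * norm (ft F p) \<le> (l1norm F2)" .
    moreover have "norm (ft F p) \<le> (l1norm F)" using n by (intro norm_ft_le) auto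
    ultimately have "(1 + p\<^sup>2) * norm (ft F p) \<le> C" unfolding C_def by (simp add: distrib_right)
    moreover have "1 + p\<^sup>2 > 0" by (simp add: add_pos_nonneg)
    ultimately show ?thesis by (simp add: field_simps)
  qed
  have [measurable]: "F \<in> borel_measurable borel" using n by auto
  have Ci: "L1 (\<lambda>p. C * inverse (1 + p\<^sup>2))"
    using integrable_inverse_1_plus_square_lborel by (intro integrable_mult_right) auto
  have hi: "L1 (ft F)"
  proof (rule L1_dominated[OF Ci])
    show "AE p in lborel. norm (ft F p) \<le> norm (C * inverse (1 + p\<^sup>2))"
      using bd C0 by (intro AE_I2) (metis abs_of_nonneg norm_ge_zero order_trans real_norm_def)
  qed measurable
  have hi': "L1 (\<lambda>p. ft F (- p) / (2 * pi))"
    using lborel_integrable_real_affine[OF hi, of "-1" 0] by simp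
  have "F = ft (\<lambda>p. ft F (- p) / (2 * pi))"
    using ft_inversion[OF _ cont B hi] n by auto
  moreover have "(LINT p|lborel. norm (ft F (- p) / (2 * pi))) \<le> C"
  proof -
    have "(LINT p|lborel. norm (ft F (- p) / (2 * pi))) \<le> (LINT p|lborel. C / (2 * pi) * inverse (1 + p\<^sup>2))"
    proof (rule integral_mono)
      show "norm (ft F (- p) / (2 * pi)) \<le> C / (2 * pi) * inverse (1 + p\<^sup>2)" for p
        using bd[of "- p"] by (simp add: norm_divide norm_mult divide_right_mono)
      show "L1 (\<lambda>p. C / (2 * pi) * inverse (1 + p\<^sup>2))"
        using integrable_inverse_1_plus_square_lborel by (intro integrable_mult_right) auto
    qed (use hi' in auto)
    also have "\<dots> = C / 2" by (simp add: integrable_inverse_1_plus_square_lborel)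
    finally show ?thesis using C0 by simp
  qed
  ultimately show ?thesis unfolding wnorm_le_def C_def[symmetric] using hi' by blast
qed

section \<open>Wiener's lemma\<close>

text \<open>For open \<^term>\<open>U\<close> only the positive part of \<open>indicator U p - indicator U (p - t)\<close> has to be
  controlled, since both terms have the same integral; it tends to 0 pointwise.\<close>

lemma L1_translation_open:
  fixes X :: "nat \<Rightarrow> real"
  assumes U: "open U" "emeasure lborel U < \<infinity>" and X: "X \<longlonglongrightarrow> 0"
  shows "(\<lambda>n. LINT p|lborel. \<bar>indicator U (p - X n) - indicator U p :: real\<bar>) \<longlonglongrightarrow> 0"
proof -
  have [measurable]: "U \<in> sets borel" using U by simp
  have i: "L1 (indicator U :: real \<Rightarrow> real)" using U by (intro integrable_real_indicator) auto
  have it: "L1 (\<lambda>p. indicator U (p - t) :: real)" for t using integrable_real_translate[OF i] .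
  have im: "L1 (\<lambda>p. max 0 (indicator U p - indicator U (p - t) :: real))" for t
    by (rule L1_dominated[OF i]) (auto simp: indicator_def)
  have eq: "(LINT p|lborel. \<bar>indicator U (p - t) - indicator U p :: real\<bar>) = 2 * (LINT p|lborel. max 0 (indicator U p - indicator U (p - t)))" for t
  proof -
    have "(LINT p|lborel. \<bar>indicator U (p - t) - indicator U p :: real\<bar>)
        = (LINT p|lborel. 2 * max 0 (indicator U p - indicator U (p - t)) + (indicator U (p - t) - indicator U p))"
      by (intro LINT_cong) (auto simp: indicator_def)
    also have "\<dots> = 2 * (LINT p|lborel. max 0 (indicator U p - indicator U (p - t)))
       + ((LINT p|lborel. indicator U (p - t)) - (LINT p|lborel. indicator U p))"
      using i it im by simp
    also have "(LINT p|lborel. indicator U (p - t) :: real) = (LINT p|lborel. indicator U p)"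
      by (rule integral_real_translate)
    finally show ?thesis by simp
  qed
  have "(\<lambda>n. LINT p|lborel. max 0 (indicator U p - indicator U (p - X n) :: real)) \<longlonglongrightarrow> (LINT p|(lborel::real measure). 0)"
  proof (rule integral_dominated_convergence[OF _ _ i])
    show "AE p in lborel. (\<lambda>n. max 0 (indicator U p - indicator U (p - X n) :: real)) \<longlonglongrightarrow> 0"
    proof (intro AE_I2 tendsto_eventually)
      fix p
      show "\<forall>\<^sub>F n in sequentially. max 0 (indicator U p - indicator U (p - X n) :: real) = 0"
      \<comment> \<open>Openness is used here: a point of \<open>U\<close> stays in \<open>U\<close>
        under small translations. Outside \<open>U\<close> the positive part is 0 anyway.\<close>
      proof (cases "p \<in> U")
        case True
        have "(\<lambda>n. p - X n) \<longlonglongrightarrow> p" using tendsto_diff[OF tendsto_const X, of p] by simp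
        then have "\<forall>\<^sub>F n in sequentially. p - X n \<in> U" using U(1) True by (rule topological_tendstoD)
        then show ?thesis by eventually_elim auto
      qed auto
    qed
  qed (auto simp: indicator_def)
  then have "(\<lambda>n. 2 * (LINT p|lborel. max 0 (indicator U p - indicator U (p - X n) :: real))) \<longlonglongrightarrow> 2 * 0"
    by (intro tendsto_intros) simp
  then show ?thesis unfolding eq by simp
qed

text \<open>Translation is an isometry of L1, so the functions along which it is continuous form a
  closed set.\<close>

lemma L1_translation_approx:
  fixes h :: "real \<Rightarrow> complex" and X :: "nat \<Rightarrow> real"
  assumes h: "L1 h"
    and *: "\<And>e. e > 0 \<Longrightarrow> \<exists>g. L1 g \<and> (LINT p|lborel. norm (h p - g p)) \<le> e \<and>
        (\<lambda>n. LINT p|lborel. norm (g (p - X n) - g p)) \<longlonglongrightarrow> 0"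
  shows "(\<lambda>n. LINT p|lborel. norm (h (p - X n) - h p)) \<longlonglongrightarrow> 0"
proof (rule LIMSEQ_I)
  fix r :: real assume r: "r > 0"
  obtain g where g: "L1 g" "(LINT p|lborel. norm (h p - g p)) \<le> r / 4"
    "(\<lambda>n. LINT p|lborel. norm (g (p - X n) - g p)) \<longlonglongrightarrow> 0"
    using *[of "r / 4"] r by auto
  obtain N where N: "\<And>n. n \<ge> N \<Longrightarrow> norm ((LINT p|lborel. norm (g (p - X n) - g p)) - 0) < r / 2"
    using LIMSEQ_D[OF g(3), of "r / 2"] r by auto
  have "norm ((LINT p|lborel. norm (h (p - X n) - h p)) - 0) < r" if n: "n \<ge> N" for n
  proof -
    define t where "t = X n"
    note tr = integrable_real_translate[OF h, of t] integrable_real_translate[OF g(1), of t]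
    have "(LINT p|lborel. norm (h (p - t) - h p)) \<le> (LINT p|lborel. norm (h (p - t) - g (p - t)) + norm (g (p - t) - g p) + norm (h p - g p))"
    proof (intro integral_mono)
      show "norm (h (p - t) - h p) \<le> norm (h (p - t) - g (p - t)) + norm (g (p - t) - g p) + norm (h p - g p)" for p
        using norm_triangle_ineq[of "h (p - t) - g (p - t) + (g (p - t) - g p)" "- (h p - g p)"]
          norm_triangle_ineq[of "h (p - t) - g (p - t)" "g (p - t) - g p"] norm_minus_cancel[of "h p - g p"] by simp
    qed (use tr h g in auto)
    also have "\<dots> = (LINT p|lborel. norm (h (p - t) - g (p - t))) + (LINT p|lborel. norm (g (p - t) - g p)) + (LINT p|lborel. norm (h p - g p))"
      using tr h g by simp
    also have "(LINT p|lborel. norm (h (p - t) - g (p - t))) = (LINT p|lborel. norm (h p - g p))"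
      by (rule integral_real_translate[of "\<lambda>p. norm (h p - g p)"])
    also have "(LINT p|lborel. norm (h p - g p)) + (LINT p|lborel. norm (g (p - t) - g p)) + (LINT p|lborel. norm (h p - g p)) < r"
      using g(2) N[OF n] unfolding t_def by simp
    finally show ?thesis unfolding t_def by (simp add: integral_nonneg_AE)
  qed
  then show "\<exists>no. \<forall>n\<ge>no. norm ((LINT p|lborel. norm (h (p - X n) - h p)) - 0) < r" by blast
qed

text \<open>By induction over integrable functions; outer regularity replaces an indicator by that
  of an open set.\<close>

lemma L1_translation:
  fixes h :: "real \<Rightarrow> complex" and X :: "nat \<Rightarrow> real"
  assumes h: "L1 h" and X: "X \<longlonglongrightarrow> 0"
  shows "(\<lambda>n. LINT p|lborel. norm (h (p - X n) - h p)) \<longlonglongrightarrow> 0"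
  using h
proof induct
  case (base A c)
  have [measurable]: "A \<in> sets borel" using base by simp
  have Ai: "L1 (\<lambda>x. indicator A x *\<^sub>R c)"
    using base by (intro integrable_scaleR_left integrable_real_indicator) auto
  show ?case
  proof (rule L1_translation_approx[OF Ai])
    fix e :: real assume e: "e > 0"
    \<comment> \<open>The \<open>+ 1\<close> covers \<open>c = 0\<close>.\<close>
    define e' where "e' = e / (norm c + 1)"
    have e': "e' > 0" unfolding e'_def using e by (simp add: add_nonneg_pos)
    obtain U where U: "open U" "A \<subseteq> U" "emeasure lborel (U - A) < e'"
      using outer_regular_lborel[of A e'] e' by auto
    have [measurable]: "U \<in> sets borel" using U by simp
    have "emeasure lborel U = emeasure lborel (A \<union> (U - A))" using U(2) by (simp add: Un_absorb1)
    also have "\<dots> \<le> emeasure lborel A + emeasure lborel (U - A)" by (rule emeasure_subadditive) auto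
    also have "\<dots> < \<infinity>" using base(2) U(3) by (auto simp: ennreal_add_eq_top less_top[symmetric])
    finally have Uf: "emeasure lborel U < \<infinity>" .
    have Ui: "L1 (\<lambda>x. indicator U x *\<^sub>R c)"
      using Uf by (intro integrable_scaleR_left integrable_real_indicator) auto
    have "norm (indicator A p *\<^sub>R c - indicator U p *\<^sub>R c) = indicator (U - A) p * norm c" for p
      using U(2) by (auto simp: indicator_def)
    then have "(LINT p|lborel. norm (indicator A p *\<^sub>R c - indicator U p *\<^sub>R c)) = measure lborel (U - A) * norm c"
      by simp
    also have "\<dots> \<le> e' * norm c"
    proof (intro mult_right_mono)
      show "measure lborel (U - A) \<le> e'"
        using U(3) e' unfolding measure_def by (intro enn2real_leI) auto
    qed simp
    also have "\<dots> \<le> e"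
      unfolding e'_def using e by (simp add: pos_divide_le_eq[OF add_nonneg_pos] distrib_left)
    finally have 1: "(LINT p|lborel. norm (indicator A p *\<^sub>R c - indicator U p *\<^sub>R c)) \<le> e" .
    have "norm (indicator U (p - X n) *\<^sub>R c - indicator U p *\<^sub>R c) = \<bar>indicator U (p - X n) - indicator U p\<bar> * norm c" for p n
      by (simp add: scaleR_left_diff_distrib[symmetric])
    moreover have "(\<lambda>n. (LINT p|lborel. \<bar>indicator U (p - X n) - indicator U p\<bar>) * norm c) \<longlonglongrightarrow> 0 * norm c"
      by (intro tendsto_intros L1_translation_open U Uf X)
    ultimately have "(\<lambda>n. LINT p|lborel. norm (indicator U (p - X n) *\<^sub>R c - indicator U p *\<^sub>R c)) \<longlonglongrightarrow> 0"
      by simp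
    with Ui 1 show "\<exists>g. L1 g \<and> (LINT p|lborel. norm (indicator A p *\<^sub>R c - g p)) \<le> e \<and>
        (\<lambda>n. LINT p|lborel. norm (g (p - X n) - g p)) \<longlonglongrightarrow> 0" by blast
  qed
next
  case (add f g)
  show ?case
  proof (rule tendsto_sandwich[OF _ _ tendsto_const])
    show "\<forall>\<^sub>F n in sequentially. 0 \<le> (LINT p|lborel. norm (f (p - X n) + g (p - X n) - (f p + g p)))"
      by (auto intro!: always_eventually integral_nonneg_AE)
    show "(\<lambda>n. (LINT p|lborel. norm (f (p - X n) - f p)) + (LINT p|lborel. norm (g (p - X n) - g p))) \<longlonglongrightarrow> 0"
      using tendsto_add[OF add(2,4)] by simp
    show "\<forall>\<^sub>F n in sequentially. (LINT p|lborel. norm (f (p - X n) + g (p - X n) - (f p + g p)))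
        \<le> (LINT p|lborel. norm (f (p - X n) - f p)) + (LINT p|lborel. norm (g (p - X n) - g p))"
    proof (intro always_eventually allI)
      fix n
      note tr = integrable_real_translate[OF add(1), of "X n"] integrable_real_translate[OF add(3), of "X n"]
      have "(LINT p|lborel. norm (f (p - X n) + g (p - X n) - (f p + g p)))
         \<le> (LINT p|lborel. norm (f (p - X n) - f p) + norm (g (p - X n) - g p))"
        using tr add(1,3) by (intro integral_mono) (auto simp: add_diff_add norm_triangle_ineq)
      then show "(LINT p|lborel. norm (f (p - X n) + g (p - X n) - (f p + g p)))
        \<le> (LINT p|lborel. norm (f (p - X n) - f p)) + (LINT p|lborel. norm (g (p - X n) - g p))"
        using tr add(1,3) by simp
    qed
  qed
next
  case (lim f s)
  show ?case
  proof (rule L1_translation_approx[OF lim(5)])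
    fix e :: real assume e: "e > 0"
    have "(\<lambda>i. LINT p|lborel. norm (f p - s i p)) \<longlonglongrightarrow> (LINT p|(lborel :: real measure). 0)"
    proof (rule integral_dominated_convergence)
      show "L1 (\<lambda>p. 3 * norm (f p))" using lim(5) by simp
      show "AE p in lborel. (\<lambda>i. norm (f p - s i p)) \<longlonglongrightarrow> 0"
      proof (intro AE_I2)
        fix p
        show "(\<lambda>i. norm (f p - s i p)) \<longlonglongrightarrow> 0"
          using tendsto_norm[OF tendsto_diff[OF tendsto_const lim(3)], of p "f p"] by simp
      qed
      show "AE p in lborel. norm (norm (f p - s i p)) \<le> 3 * norm (f p)" for i
      proof (intro AE_I2)
        fix p
        show "norm (norm (f p - s i p)) \<le> 3 * norm (f p)"
          using lim(4)[of p i] norm_triangle_ineq4[of "f p" "s i p"] by simp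
      qed
    qed (use lim in auto)
    from LIMSEQ_D[OF this e] obtain i where "norm ((LINT p|lborel. norm (f p - s i p)) - 0) < e"
      by auto
    then show "\<exists>g. L1 g \<and> (LINT p|lborel. norm (f p - g p)) \<le> e \<and>
        (\<lambda>n. LINT p|lborel. norm (g (p - X n) - g p)) \<longlonglongrightarrow> 0"
      using lim by (intro exI[of _ "s i"]) auto
  qed
qed

section \<open>Density of smooth transforms and the Riemann-Lebesgue lemma\<close>

lemma nice_mult:
  assumes E: "nice E E1 E2"
    and H: "\<And>x. (H has_vector_derivative H1 x) (at x)" "\<And>x. (H1 has_vector_derivative H2 x) (at x)"
    and [measurable]: "H2 \<in> borel_measurable borel"
    and B: "\<And>x. norm (H x) \<le> B" "\<And>x. norm (H1 x) \<le> B" "\<And>x. norm (H2 x) \<le> B"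
  shows "nice (\<lambda>x. E x * H x) (\<lambda>x. E x * H1 x + E1 x * H x) (\<lambda>x. (E x * H2 x + E1 x * H1 x) + (E1 x * H1 x + E2 x * H x))"
proof -
  note n = E[unfolded nice_def]
  have cont: "continuous_on UNIV H" "continuous_on UNIV H1"
    using H by (auto intro!: continuous_at_imp_continuous_on has_vector_derivative_continuous)
  have [measurable]: "H \<in> borel_measurable borel" "H1 \<in> borel_measurable borel"
    using cont by (auto intro: borel_measurable_continuous_onI)
  have i: "L1 (\<lambda>x. e x * h x)"
    if "L1 e" "h \<in> borel_measurable borel" "\<And>x. norm (h x) \<le> B" for e h :: "real \<Rightarrow> complex"
  proof (rule L1_dominated)
    show "L1 (\<lambda>x. B * norm (e x))" using that by simp
    show "(\<lambda>x. e x * h x) \<in> borel_measurable lborel" using that by measurable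
    show "AE x in lborel. norm (e x * h x) \<le> norm (B * norm (e x))"
    proof (intro AE_I2)
      fix x
      have "0 \<le> B" using that(3)[of x] norm_ge_zero order_trans by blast
      then show "norm (e x * h x) \<le> norm (B * norm (e x))"
        using mult_right_mono[OF that(3)[of x], of "norm (e x)"] by (simp add: norm_mult mult.commute)
    qed
  qed
  have l: "((\<lambda>x. e x * h x) \<longlongrightarrow> 0) F"
    if "(e \<longlongrightarrow> 0) F" "\<And>x. norm (h x) \<le> B" for e h :: "real \<Rightarrow> complex" and F
  proof (rule Lim_null_comparison)
    show "\<forall>\<^sub>F x in F. norm (e x * h x) \<le> norm (e x) * B"
      using that(2) by (auto simp: norm_mult intro!: always_eventually mult_left_mono)
    show "((\<lambda>x. norm (e x) * B) \<longlongrightarrow> 0) F" using tendsto_mult_left_zero[OF tendsto_norm_zero[OF that(1)], of B] .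
  qed
  have "(E1 has_vector_derivative E2 x) (at x)" "(E has_vector_derivative E1 x) (at x)" for x using n by auto
  note d = this H
  show ?thesis unfolding nice_def
  proof (intro conjI allI)
    show "((\<lambda>x. E x * H x) has_vector_derivative E x * H1 x + E1 x * H x) (at x)" for x
      by (intro derivative_intros d)
    show "((\<lambda>x. E x * H1 x + E1 x * H x) has_vector_derivative E x * H2 x + E1 x * H1 x + (E1 x * H1 x + E2 x * H x)) (at x)" for x
      by (intro derivative_intros d)
    show "((\<lambda>x. E x * H1 x + E1 x * H x) \<longlongrightarrow> 0) at_top" "((\<lambda>x. E x * H1 x + E1 x * H x) \<longlongrightarrow> 0) at_bot"
      using n by (auto intro!: tendsto_add_zero l B)
    show "L1 (\<lambda>x. E x * H x)" "L1 (\<lambda>x. E x * H1 x + E1 x * H x)"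
      "L1 (\<lambda>x. (E x * H2 x + E1 x * H1 x) + (E1 x * H1 x + E2 x * H x))"
      using n by (intro L1_add i B; simp)+
  qed (use n in \<open>auto intro!: l B\<close>)
qed

lemma integrable_power_gaussian:
  assumes "d > 0"
  shows "L1 (\<lambda>x::real. x ^ m * exp (- (d * x)\<^sup>2 / 2))"
proof -
  have "L1 (\<lambda>x. sqrt (2 * pi) / d ^ m * (std_normal_density x * x ^ m))"
    by (intro integrable_mult_right integrable_std_normal_moment)
  then have "L1 (\<lambda>x::real. x ^ m * exp (- x\<^sup>2 / 2) / d ^ m)"
    by (simp add: std_normal_density_def mult.commute)
  from lborel_integrable_real_affine[OF this, of d 0] assms
  show ?thesis by (simp add: power_mult_distrib)
qed

lemma nice_gaussian:
  assumes "d > 0"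
  defines "E \<equiv> \<lambda>x::real. exp (- (d * x)\<^sup>2 / 2)"
  shows "nice (\<lambda>x. complex_of_real (E x)) (\<lambda>x. complex_of_real (- d\<^sup>2 * (x * E x)))
     (\<lambda>x. complex_of_real (- d\<^sup>2 * E x + d ^ 4 * (x\<^sup>2 * E x)))"
proof -
  have i: "L1 E" "L1 (\<lambda>x. x * E x)" "L1 (\<lambda>x. x\<^sup>2 * E x)"
    using integrable_power_gaussian[OF assms(1), of 0] integrable_power_gaussian[OF assms(1), of 1]
      integrable_power_gaussian[OF assms(1), of 2] unfolding E_def by simp_all
  have l: "(E \<longlongrightarrow> 0) at_top" "(E \<longlongrightarrow> 0) at_bot" "((\<lambda>x. x * E x) \<longlongrightarrow> 0) at_top" "((\<lambda>x. x * E x) \<longlongrightarrow> 0) at_bot"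
    unfolding E_def using assms by (real_asymp)+
  have d1: "(E has_real_derivative - d\<^sup>2 * (x * E x)) (at x)" for x
    unfolding E_def by (auto intro!: derivative_eq_intros simp: power2_eq_square)
  have d2: "((\<lambda>x. - d\<^sup>2 * (x * E x)) has_real_derivative - d\<^sup>2 * E x + d ^ 4 * (x\<^sup>2 * E x)) (at x)" for x
    by (auto intro!: derivative_eq_intros d1 simp: power2_eq_square power4_eq_xxxx algebra_simps)
  have "((\<lambda>x. complex_of_real (E x)) \<longlongrightarrow> complex_of_real 0) at_top" "((\<lambda>x. complex_of_real (E x)) \<longlongrightarrow> complex_of_real 0) at_bot"
    "((\<lambda>x. complex_of_real (- d\<^sup>2 * (x * E x))) \<longlongrightarrow> complex_of_real (- d\<^sup>2 * 0)) at_top"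
    "((\<lambda>x. complex_of_real (- d\<^sup>2 * (x * E x))) \<longlongrightarrow> complex_of_real (- d\<^sup>2 * 0)) at_bot"
    by (intro tendsto_of_real tendsto_mult_left l)+
  moreover have "((\<lambda>x. complex_of_real (E x)) has_vector_derivative complex_of_real (- d\<^sup>2 * (x * E x))) (at x)"
    "((\<lambda>x. complex_of_real (- d\<^sup>2 * (x * E x))) has_vector_derivative complex_of_real (- d\<^sup>2 * E x + d ^ 4 * (x\<^sup>2 * E x))) (at x)" for x
    by (rule has_vector_derivative_of_real[OF d1], rule has_vector_derivative_of_real[OF d2])
  moreover have "L1 (\<lambda>x. complex_of_real (E x))" "L1 (\<lambda>x. complex_of_real (- d\<^sup>2 * (x * E x)))"
    "L1 (\<lambda>x. complex_of_real (- d\<^sup>2 * E x + d ^ 4 * (x\<^sup>2 * E x)))"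
    by (intro integrable_of_real L1_add integrable_mult_right i)+
  ultimately show ?thesis unfolding nice_def by simp
qed

text \<open>Truncation makes all moments finite, so the transform has bounded derivatives.
  Convolution with a narrow Gaussian then multiplies the transform by a Gaussian, which makes it
  integrable together with two derivatives. Continuity of translation keeps the second change small
  in L1.\<close>

lemma L1_nice_dense:
  fixes h :: "real \<Rightarrow> complex"
  assumes h: "L1 h" and e: "e > 0"
  obtains g F1 F2 where "L1 g" "(LINT p|lborel. norm (h p - g p)) \<le> e" "nice (ft g) F1 F2"
proof -
  note [measurable] = borel_measurable_integrable[OF h]
  have "(\<lambda>n. LINT p|lborel. norm (h p - indicator {- real n..real n} p * h p)) \<longlonglongrightarrow> (LINT p|(lborel :: real measure). 0)"
  proof (rule integral_dominated_convergence)
    show "L1 (\<lambda>p. norm (h p))" using h by simp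
    show "AE p in lborel. (\<lambda>n. norm (h p - indicator {- real n..real n} p * h p)) \<longlonglongrightarrow> 0"
    proof (intro AE_I2 tendsto_eventually)
      fix p
      obtain N :: nat where "\<bar>p\<bar> \<le> real N" using real_arch_simple by blast
      then show "\<forall>\<^sub>F n in sequentially. norm (h p - indicator {- real n..real n} p * h p) = 0"
        by (intro eventually_sequentiallyI[of N]) (auto simp: indicator_def)
    qed
  qed (auto simp: indicator_def)
  from LIMSEQ_D[OF this, of "e / 2"] e obtain N where "norm ((LINT p|lborel. norm (h p - indicator {- real N..real N} p * h p)) - 0) < e / 2"
    by auto
  then have N: "(LINT p|lborel. norm (h p - indicator {- real N..real N} p * h p)) < e / 2"
    by simp
  define r where "r = (\<lambda>p. indicator {- real N..real N} p * h p)"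
  have [measurable]: "r \<in> borel_measurable borel" unfolding r_def by measurable
  have r: "L1 (\<lambda>p. complex_of_real p ^ m * r p)" for m
  proof (rule L1_dominated)
    show "L1 (\<lambda>p. real N ^ m * norm (h p))" using h by simp
    show "AE p in lborel. norm (complex_of_real p ^ m * r p) \<le> norm (real N ^ m * norm (h p))"
    proof (intro AE_I2)
      fix p
      show "norm (complex_of_real p ^ m * r p) \<le> norm (real N ^ m * norm (h p))"
      proof (cases "p \<in> {- real N..real N}")
        case True
        then have "\<bar>p\<bar> ^ m \<le> real N ^ m" by (intro power_mono) auto
        then show ?thesis using True by (simp add: r_def norm_mult norm_power mult_right_mono)
      qed (simp add: r_def)
    qed
  qed measurable
  have r0: "L1 r" using r[of 0] by simp
  have r1: "L1 (\<lambda>p. complex_of_real p * r p)" using r[of 1] by simp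
  have r1': "L1 (\<lambda>p. \<i> * (p * r p))" using r1 by simp
  have r2: "L1 (\<lambda>p. complex_of_real p * (\<i> * (p * r p)))"
    using integrable_mult_right[OF r[of 2], of \<i>] by (simp add: power2_eq_square mult_ac)
  have r2': "L1 (\<lambda>p. \<i> * (p * (\<i> * (p * r p))))" using r2 by (intro integrable_mult_right) simp
  define B where "B = (l1norm r) + (LINT p|lborel. norm (\<i> * (p * r p))) + (LINT p|lborel. norm (\<i> * (p * (\<i> * (p * r p)))))"
  have nn: "0 \<le> (l1norm f)" for f :: "real \<Rightarrow> complex" by (rule integral_nonneg_AE) auto
  have B: "norm (ft r k) \<le> B" "norm (ft (\<lambda>p. \<i> * (p * r p)) k) \<le> B" "norm (ft (\<lambda>p. \<i> * (p * (\<i> * (p * r p)))) k) \<le> B" for k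
    using norm_ft_le[OF r0, of k] norm_ft_le[OF r1', of k] norm_ft_le[OF r2', of k]
      nn[of r] nn[of "\<lambda>p. \<i> * (p * r p)"] nn[of "\<lambda>p. \<i> * (p * (\<i> * (p * r p)))"]
    unfolding B_def by linarith+
  let ?\<phi> = "\<lambda>u. complex_of_real (std_normal_density u)"
  define D where "D n = 1 / real (Suc n)" for n
  have D: "D n > 0" "D \<longlonglongrightarrow> 0" for n
    unfolding D_def using LIMSEQ_inverse_real_of_nat by (auto simp: inverse_eq_divide)
  let ?T = "\<lambda>n u. LINT p|lborel. norm (r (p - D n * u) - r p)"
  have T2: "?T n u \<le> 2 * (l1norm r)" for n u
  proof -
    note tr = integrable_real_translate[OF r0, of "D n * u"]
    have "?T n u \<le> (LINT p|lborel. norm (r (p - D n * u)) + norm (r p))"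
      using tr r0 by (intro integral_mono) (auto simp: norm_triangle_ineq4)
    also have "\<dots> = (LINT p|lborel. norm (r (p - D n * u))) + (l1norm r)"
      using tr r0 by simp
    also have "(LINT p|lborel. norm (r (p - D n * u))) = (l1norm r)"
      by (rule integral_real_translate[of "\<lambda>p. norm (r p)"])
    finally show ?thesis by simp
  qed
  have snd: "L1 std_normal_density" by (intro integrable_normal_density) auto
  have "(\<lambda>n. LINT u|lborel. std_normal_density u * ?T n u) \<longlonglongrightarrow> (LINT u|(lborel :: real measure). std_normal_density u * 0)"
  proof (rule integral_dominated_convergence)
    show "L1 (\<lambda>u. std_normal_density u * (2 * (l1norm r)))" using snd by simp
    show "AE u in lborel. (\<lambda>n. std_normal_density u * ?T n u) \<longlonglongrightarrow> std_normal_density u * 0"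
    proof (intro AE_I2 tendsto_mult tendsto_const L1_translation r0)
      fix u show "(\<lambda>n. D n * u) \<longlonglongrightarrow> 0" using tendsto_mult_left_zero[OF D(2), of u] .
    qed
    show "AE u in lborel. norm (std_normal_density u * ?T n u) \<le> std_normal_density u * (2 * (l1norm r))" for n
      using T2 by (intro AE_I2) (auto simp: abs_mult integral_nonneg_AE intro!: mult_left_mono)
  qed measurable
  from LIMSEQ_D[OF this, of "e / 2"] e obtain n where "norm ((LINT u|lborel. std_normal_density u * ?T n u) - 0) < e / 2"
    by auto
  then have n: "(LINT u|lborel. std_normal_density u * ?T n u) < e / 2"
    by simp
  define d where "d = D n"
  have d: "d > 0" unfolding d_def by (rule D)
  \<comment> \<open>With \<open>q\<close> the integral of \<open>c\<close> over \<open>u\<close>,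
    the function \<open>r + q\<close> is \<open>r\<close> convolved with a Gaussian of width
    \<open>d\<close>. Working with the difference \<open>q\<close> bounds the error by averages of
    the translation errors \<open>?T n u\<close>.\<close>
  define c where "c u p = ?\<phi> u * (r (p - d * u) - r p)" for u p
  have ci: "integrable lborel2 (\<lambda>(u, p). c u p)"
  proof (rule pair_integrableI)
    show "(\<lambda>(u, p). c u p) \<in> borel_measurable lborel2" unfolding c_def by measurable
    show "L1 (c u)" for u
      unfolding c_def using integrable_real_translate[OF r0, of "d * u"] r0 by simp
    show "L1 (\<lambda>u. std_normal_density u * (2 * (l1norm r)))" using snd by simp
    show "(LINT p|lborel. norm (c u p)) \<le> std_normal_density u * (2 * (l1norm r))" for u
      unfolding c_def using T2[of n u] by (simp add: norm_mult d_def mult_left_mono)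
  qed
  define q where "q p = (LINT u|lborel. c u p)" for p
  have q: "L1 q" unfolding q_def by (rule ft_superposition(1)[OF ci])
  have "(l1norm q) \<le> (LINT u|lborel. LINT p|lborel. norm (c u p))"
    unfolding q_def by (rule ft_superposition(4)[OF ci])
  also have "\<dots> = (LINT u|lborel. std_normal_density u * ?T n u)"
    unfolding c_def d_def by (simp add: norm_mult)
  finally have q_le: "(l1norm q) < e / 2" using n by simp
  have "ft q k = (complex_of_real (exp (- (d * k)\<^sup>2 / 2)) - 1) * ft r k" for k
  proof -
    have "ft (c u) k = (iexp (k * d * u) * ?\<phi> u - ?\<phi> u) * ft r k" for u
      unfolding c_def ft_cmult ft_diff[OF integrable_real_translate[OF r0] r0] ft_translate by (simp add: algebra_simps)
    then have "ft q k = (LINT u|lborel. (iexp (k * d * u) * ?\<phi> u - ?\<phi> u) * ft r k)"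
      unfolding q_def[abs_def] ft_superposition(2)[OF ci] by (simp only:)
    also have "\<dots> = (ft ?\<phi> (k * d) - ft ?\<phi> 0) * ft r k"
      using integrable_exp_i_mult[OF integrable_std_normal, of "k * d"] integrable_std_normal
      by (simp add: ft_def)
    finally show ?thesis by (simp add: ft_std_normal mult.commute)
  qed
  then have g_ft: "ft (\<lambda>p. r p + q p) = (\<lambda>k. complex_of_real (exp (- (d * k)\<^sup>2 / 2)) * ft r k)"
    by (intro ext) (simp add: ft_add[OF r0 q] left_diff_distrib)
  have hr: "(LINT p|lborel. norm (h p - r p)) < e / 2" using N unfolding r_def .
  have m: "ft (\<lambda>p. \<i> * (p * (\<i> * (p * r p)))) \<in> borel_measurable borel" by measurable
  note nc = nice_mult[OF nice_gaussian[OF d] ft_has_vector_derivative[OF r0 r1] ft_has_vector_derivative[OF r1' r2] m B]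
  have gi: "L1 (\<lambda>p. r p + q p)" using r0 q by simp
  have "(LINT p|lborel. norm (h p - (r p + q p))) \<le> (LINT p|lborel. norm (h p - r p) + norm (q p))"
  proof (rule integral_mono)
    show "norm (h p - (r p + q p)) \<le> norm (h p - r p) + norm (q p)" for p
      using norm_triangle_ineq4[of "h p - r p" "q p"] by (simp add: diff_diff_add)
  qed (use h r0 q in auto)
  also have "\<dots> \<le> e" using h r0 q hr q_le by simp
  finally have "(LINT p|lborel. norm (h p - (r p + q p))) \<le> e" .
  from that[OF gi this, unfolded g_ft, OF nc] show thesis .
qed

lemma wnorm_le_ft: "L1 h \<Longrightarrow> wnorm_le (l1norm h) (ft h)"
  unfolding wnorm_le_def by auto

text \<open>Riemann-Lebesgue lemma: by density it is enough that \<open>nice\<close> functions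
  vanish at infinity.\<close>

lemma wiener_tendsto_0:
  assumes "F \<in> wiener_algebra"
  shows "(F \<longlongrightarrow> 0) at_top" "(F \<longlongrightarrow> 0) at_bot"
proof -
  obtain h where h: "L1 h" "F = ft h" using assms unfolding wiener_algebra_iff by auto
  have "(F \<longlongrightarrow> 0) at_top \<and> (F \<longlongrightarrow> 0) at_bot"
  proof (intro conjI tendstoI)
    fix e :: real assume e: "e > 0"
    obtain g F1 F2 where g: "L1 g" "(LINT p|lborel. norm (h p - g p)) \<le> e / 2" "nice (ft g) F1 F2"
      using L1_nice_dense[OF h(1), of "e / 2"] e by auto
    have *: "dist (F k) 0 < e" if "dist (ft g k) 0 < e / 2" for k
    proof -
      have "F k = ft g k + ft (\<lambda>p. h p - g p) k" using h g by (simp add: ft_diff)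
      moreover have "norm (ft (\<lambda>p. h p - g p) k) \<le> e / 2" using norm_ft_le[of "\<lambda>p. h p - g p" k] h g by simp
      ultimately show ?thesis using that norm_triangle_ineq[of "ft g k" "ft (\<lambda>p. h p - g p) k"] by simp
    qed
    have "(ft g \<longlongrightarrow> 0) at_top" "(ft g \<longlongrightarrow> 0) at_bot" using g(3) unfolding nice_def by auto
    then have ev: "\<forall>\<^sub>F k in at_top. dist (ft g k) 0 < e / 2" "\<forall>\<^sub>F k in at_bot. dist (ft g k) 0 < e / 2"
      using e by (auto dest: tendstoD[of _ _ _ "e / 2"])
    show "\<forall>\<^sub>F k in at_top. dist (F k) 0 < e" by (rule eventually_mono[OF ev(1)]) (rule *)
    show "\<forall>\<^sub>F k in at_bot. dist (F k) 0 < e" by (rule eventually_mono[OF ev(2)]) (rule *)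
  qed
  then show "(F \<longlongrightarrow> 0) at_top" "(F \<longlongrightarrow> 0) at_bot" by auto
qed

section \<open>Lower bounds and powers of inverses\<close>

lemma wiener_continuous: "F \<in> wiener_algebra \<Longrightarrow> isCont F k"
  unfolding wiener_algebra_iff using ft_continuous by auto

text \<open>Since \<open>c\<close> is the limit at infinity, only a compact interval remains, where
  the minimum is attained.\<close>

lemma nonvanishing_bounded_below:
  assumes F: "F \<in> wiener_algebra" and c: "c \<noteq> 0" and nz: "\<And>k. c + F k \<noteq> 0"
  obtains m where "m > 0" "\<And>k. norm (c + F k) \<ge> m"
proof -
  have e: "norm c / 2 > 0" using c by simp
  obtain N where N: "\<And>x. x \<ge> N \<Longrightarrow> norm (F x) < norm c / 2"
    using tendstoD[OF wiener_tendsto_0(1)[OF F] e] unfolding eventually_at_top_linorder by auto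
  obtain M where M: "\<And>x. x \<le> M \<Longrightarrow> norm (F x) < norm c / 2"
    using tendstoD[OF wiener_tendsto_0(2)[OF F] e] unfolding eventually_at_bot_linorder by auto
  have far: "norm (c + F x) \<ge> norm c / 2" if "norm (F x) < norm c / 2" for x
    using that norm_triangle_ineq4[of "c + F x" "F x"] by simp
  have cont: "continuous_on {min M N..max M N} (\<lambda>k. norm (c + F k))"
    by (intro continuous_at_imp_continuous_on ballI continuous_intros wiener_continuous F)
  obtain k0 where k0: "\<And>k. k \<in> {min M N..max M N} \<Longrightarrow> norm (c + F k0) \<le> norm (c + F k)"
  proof -
    have "{min M N..max M N} \<noteq> {}" by (simp add: min_le_iff_disj le_max_iff_disj)
    from continuous_attains_inf[OF compact_Icc this cont] show ?thesis using that by blast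
  qed
  show thesis
  proof (rule that[of "min (norm c / 2) (norm (c + F k0))"])
    show "min (norm c / 2) (norm (c + F k0)) > 0" using c nz by simp
    show "min (norm c / 2) (norm (c + F k0)) \<le> norm (c + F k)" for k
    proof (cases "k \<in> {min M N..max M N}")
      case False
      then show ?thesis using far[of k] N[of k] M[of k] by (auto simp: min_def max_def split: if_splits)
    qed (use k0 in \<open>auto simp: min_le_iff_disj\<close>)
  qed
qed

lemma norm_power_inverse_diff_le:
  fixes a b :: complex
  assumes d: "\<delta> > 0" and a: "norm a \<ge> \<delta>" and b: "norm b \<ge> \<delta>"
  shows "norm (inverse a ^ m - inverse b ^ m) \<le> inverse \<delta> ^ m * (m * (norm (a - b) / \<delta>))"
proof -
  have nz: "a \<noteq> 0" "b \<noteq> 0" using assms by auto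
  \<comment> \<open>Scaled by \<open>\<delta>\<close>, the inverses lie in the unit disc, where
    \<open>u ^ m - v ^ m\<close> is at most \<open>m * norm (u - v)\<close>. Thus \<open>m\<close>
    enters only linearly besides the power of \<open>inverse \<delta>\<close>.\<close>
  define u v where "u = \<delta> * inverse a" and "v = \<delta> * inverse b"
  have uv: "norm u \<le> 1" "norm v \<le> 1"
    using assms nz unfolding u_def v_def by (auto simp: norm_mult norm_inverse inverse_eq_divide norm_divide)
  have e: "inverse a ^ m = inverse \<delta> ^ m * u ^ m" "inverse b ^ m = inverse \<delta> ^ m * v ^ m"
    using d by (simp_all add: u_def v_def power_mult_distrib field_simps)
  have "norm (u - v) = \<delta> * norm (a - b) / (norm a * norm b)"
  proof -
    have "u - v = \<delta> * (b - a) * (inverse a * inverse b)"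
      using nz by (simp add: u_def v_def field_simps)
    then have "norm (u - v) = \<delta> * norm (b - a) / (norm a * norm b)"
      using d by (simp add: norm_mult norm_inverse divide_inverse)
    then show ?thesis by (simp add: norm_minus_commute)
  qed
  also have "\<dots> \<le> \<delta> * norm (a - b) / (\<delta> * \<delta>)"
    using assms nz by (intro divide_left_mono mult_mono mult_pos_pos) auto
  also have "\<dots> = norm (a - b) / \<delta>" using d by simp
  finally have uv': "norm (u - v) \<le> norm (a - b) / \<delta>" .
  have "norm (inverse a ^ m - inverse b ^ m) = inverse \<delta> ^ m * norm (u ^ m - v ^ m)"
    unfolding e using d by (simp add: right_diff_distrib[symmetric] norm_mult norm_power norm_inverse del: of_real_inverse)
  also have "\<dots> \<le> inverse \<delta> ^ m * (m * norm (u - v))"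
    using d by (intro mult_left_mono norm_power_diff uv) auto
  also have "\<dots> \<le> inverse \<delta> ^ m * (m * (norm (a - b) / \<delta>))"
    using d uv' by (intro mult_left_mono) auto
  finally show ?thesis .
qed

text \<open>The Wiener norm is estimated through two derivatives, and differentiating an
  \<open>m\<close>-th power twice costs only a factor \<open>m * (m + 1)\<close>: the norm grows
  like the supremum norm up to a polynomial. The value at infinity is subtracted because nonzero
  constants are not in the algebra.\<close>

lemma wnorm_le_nice_inverse_power:
  assumes P0: "nice P0 P1 P2" and d: "\<delta> > 0" and c: "norm c \<ge> \<delta>" and P: "\<And>k. norm (c + P0 k) \<ge> \<delta>"
  defines "L \<equiv> \<lambda>f. LINT x|lborel. norm (f (x :: real) :: complex)"
  shows "wnorm_le ((L P0 / \<delta> + L P2 / \<delta> + L (\<lambda>x. P1 x * P1 x) / \<delta>\<^sup>2) * real (n + 1) * real (n + 2) * inverse \<delta> ^ (n + 1))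
      (\<lambda>k. inverse (c + P0 k) ^ (n + 1) - inverse c ^ (n + 1))"
proof -
  define m where "m = n + 1"
  have m: "m \<ge> 1" unfolding m_def by simp
  note p = P0[unfolded nice_def]
  define I where "I = (\<lambda>k. inverse (c + P0 k))"
  have nz: "c + P0 k \<noteq> 0" for k using P[of k] d by auto
  have I_le: "norm (I k) \<le> inverse \<delta>" for k
    unfolding I_def norm_inverse using P[of k] d by (intro le_imp_inverse_le) auto
  have Ip: "norm (I k ^ r) \<le> inverse \<delta> ^ r" for k r
    unfolding norm_power by (intro power_mono I_le) auto
  have P0d: "(P0 has_vector_derivative P1 x) (at x)" "(P1 has_vector_derivative P2 x) (at x)" for x using p by auto
  have Id: "((\<lambda>k. I k ^ r) has_vector_derivative - real r * P1 x * I x ^ (r + 1)) (at x)" for r x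
  proof -
    have "((\<lambda>z. inverse z ^ r) has_field_derivative - real r * inverse z ^ (r + 1)) (at z)" if "z \<noteq> 0" for z :: complex
    proof (cases r)
      case (Suc q)
      show ?thesis using DERIV_power_Suc[OF DERIV_inverse[OF that], of q] unfolding Suc by (simp add: algebra_simps)
    qed simp
    note inv = this[OF nz[of x]]
    have "((\<lambda>k. c + P0 k) has_vector_derivative P1 x) (at x)"
      using has_vector_derivative_add[OF has_vector_derivative_const P0d(1)[of x], of c] by simp
    from field_vector_diff_chain_at[OF this inv]
    show ?thesis unfolding I_def by (simp add: o_def mult_ac)
  qed
  have [measurable]: "P0 \<in> borel_measurable borel" "P1 \<in> borel_measurable borel" "P2 \<in> borel_measurable borel"
    using p by auto
  have [measurable]: "I \<in> borel_measurable borel" unfolding I_def by measurable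
  obtain B1 where B1: "\<And>x. norm (P1 x) \<le> B1"
    using bounded_of_continuous_vanishing[of P1] p by (blast intro: has_vector_derivative_continuous)
  have B10: "0 \<le> B1" using B1[of 0] norm_ge_zero order_trans by blast
  have P11: "L1 (\<lambda>x. P1 x * P1 x)"
  proof (rule L1_dominated)
    show "L1 (\<lambda>x. B1 * norm (P1 x))" using p by simp
    show "AE x in lborel. norm (P1 x * P1 x) \<le> norm (B1 * norm (P1 x))"
      using B1 B10 by (auto simp: norm_mult intro!: AE_I2 mult_right_mono)
  qed measurable
  have bi: "L1 (\<lambda>x. u x * I x ^ r)" if "L1 u" for u r
  proof (rule L1_dominated)
    show "L1 (\<lambda>x. inverse \<delta> ^ r * norm (u x))" using that by simp
    show "(\<lambda>x. u x * I x ^ r) \<in> borel_measurable lborel" using that by measurable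
    show "AE x in lborel. norm (u x * I x ^ r) \<le> norm (inverse \<delta> ^ r * norm (u x))"
      using d Ip by (auto simp: norm_mult abs_mult mult.commute intro!: AE_I2 mult_left_mono)
  qed
  have bL: "L (\<lambda>x. u x * I x ^ r) \<le> inverse \<delta> ^ r * L u" if "L1 u" for u r
  proof -
    have "L (\<lambda>x. u x * I x ^ r) \<le> (LINT x|lborel. inverse \<delta> ^ r * norm (u x))"
      unfolding L_def
    proof (rule integral_mono)
      show "L1 (\<lambda>x. norm (u x * I x ^ r))" by (rule integrable_norm[OF bi[OF that]])
      show "norm (u x * I x ^ r) \<le> inverse \<delta> ^ r * norm (u x)" for x
        unfolding norm_mult by (subst mult.commute) (rule mult_right_mono[OF Ip norm_ge_zero])
    qed (use that in auto)
    then show ?thesis unfolding L_def by simp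
  qed
  define Q where "Q = (\<lambda>k. I k ^ m - inverse c ^ m)"
  define Q1 where "Q1 = (\<lambda>k. - real m * P1 k * I k ^ (m + 1))"
  define Q2 where "Q2 = (\<lambda>k. - real m * (P2 k * I k ^ (m + 1)) + real m * real (m + 1) * (P1 k * P1 k * I k ^ (m + 2)))"
  have Q_le: "norm (Q k) \<le> inverse \<delta> ^ m * (m * (norm (P0 k) / \<delta>))" for k
    using norm_power_inverse_diff_le[OF d P[of k] c, of m] unfolding Q_def I_def by simp
  have Q_i: "L1 Q"
  proof (rule L1_dominated)
    show "L1 (\<lambda>k. inverse \<delta> ^ m * (m * (norm (P0 k) / \<delta>)))" using p by simp
    show "AE k in lborel. norm (Q k) \<le> norm (inverse \<delta> ^ m * (m * (norm (P0 k) / \<delta>)))"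
      using Q_le d by (auto intro!: AE_I2 simp: abs_mult)
  qed (auto simp: Q_def)
  have nice: "nice Q Q1 Q2" unfolding nice_def
  proof (intro conjI allI)
    show "(Q has_vector_derivative Q1 x) (at x)" for x
      using has_vector_derivative_diff[OF Id[of m x] has_vector_derivative_const[of "inverse c ^ m"]]
      unfolding Q_def Q1_def by simp
    show "(Q1 has_vector_derivative Q2 x) (at x)" for x
    proof -
      have "((\<lambda>k. - real m * P1 k * I k ^ (m + 1)) has_vector_derivative
         - real m * P1 x * (- real (m + 1) * P1 x * I x ^ (m + 1 + 1)) + - real m * P2 x * I x ^ (m + 1)) (at x)"
        by (intro has_vector_derivative_mult has_vector_derivative_mult_right P0d Id)
      then show ?thesis unfolding Q1_def Q2_def by (simp add: algebra_simps)
    qed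
    show "L1 Q1" using bi[of P1 "m + 1"] p unfolding Q1_def by (simp add: mult.assoc)
    show "L1 Q2" using bi[of P2 "m + 1"] bi[OF P11, of "m + 2"] p unfolding Q2_def
      by (intro L1_add integrable_mult_right) auto
    have lQ: "(Q \<longlongrightarrow> 0) A" if "(P0 \<longlongrightarrow> 0) A" for A
    proof (rule Lim_null_comparison)
      show "\<forall>\<^sub>F k in A. norm (Q k) \<le> inverse \<delta> ^ m * (m * (norm (P0 k) / \<delta>))" using Q_le by auto
      have "((\<lambda>k. inverse \<delta> ^ m * (m * (norm (P0 k) / \<delta>))) \<longlongrightarrow> inverse \<delta> ^ m * (m * (norm (0::complex) / \<delta>))) A"
        using d by (intro tendsto_intros that) auto
      then show "((\<lambda>k. inverse \<delta> ^ m * (m * (norm (P0 k) / \<delta>))) \<longlongrightarrow> 0) A" by simp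
    qed
    show "(Q \<longlongrightarrow> 0) at_top" "(Q \<longlongrightarrow> 0) at_bot" using p by (auto intro!: lQ)
    have lQ1: "(Q1 \<longlongrightarrow> 0) A" if "(P1 \<longlongrightarrow> 0) A" for A
    proof (rule Lim_null_comparison)
      show "\<forall>\<^sub>F k in A. norm (Q1 k) \<le> real m * (norm (P1 k) * inverse \<delta> ^ (m + 1))"
        unfolding Q1_def norm_mult norm_minus_cancel norm_of_real abs_minus_cancel abs_of_nat mult.assoc
        by (intro always_eventually allI mult_left_mono Ip norm_ge_zero of_nat_0_le_iff)
      have "((\<lambda>k. real m * (norm (P1 k) * inverse \<delta> ^ (m + 1))) \<longlongrightarrow> real m * (norm (0::complex) * inverse \<delta> ^ (m + 1))) A"
        by (intro tendsto_intros that)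
      then show "((\<lambda>k. real m * (norm (P1 k) * inverse \<delta> ^ (m + 1))) \<longlongrightarrow> 0) A" by simp
    qed
    show "(Q1 \<longlongrightarrow> 0) at_top" "(Q1 \<longlongrightarrow> 0) at_bot" using p by (auto intro!: lQ1)
  qed (use Q_i in auto)
  have L0: "0 \<le> L f" for f unfolding L_def by (rule integral_nonneg_AE) auto
  have LQ: "L Q \<le> inverse \<delta> ^ m * (m * (L P0 / \<delta>))"
  proof -
    have "L Q \<le> (LINT k|lborel. inverse \<delta> ^ m * (m * (norm (P0 k) / \<delta>)))"
      unfolding L_def using Q_i p Q_le by (intro integral_mono) auto
    then show ?thesis unfolding L_def by simp
  qed
  have LQ2: "L Q2 \<le> real m * (inverse \<delta> ^ (m + 1) * L P2) + real m * real (m + 1) * (inverse \<delta> ^ (m + 2) * L (\<lambda>x. P1 x * P1 x))"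
  proof -
    note b = bi[of P2 "m + 1"] bi[OF P11, of "m + 2"]
    have "L Q2 \<le> (LINT x|lborel. real m * norm (P2 x * I x ^ (m + 1)) + real m * real (m + 1) * norm (P1 x * P1 x * I x ^ (m + 2)))"
      unfolding L_def
    proof (rule integral_mono)
      show "L1 (\<lambda>x. norm (Q2 x))" using nice unfolding nice_def by simp
      show "L1 (\<lambda>x. real m * norm (P2 x * I x ^ (m + 1)) + real m * real (m + 1) * norm (P1 x * P1 x * I x ^ (m + 2)))"
        using b p by (intro L1_add integrable_mult_right integrable_norm) auto
      show "norm (Q2 x) \<le> real m * norm (P2 x * I x ^ (m + 1)) + real m * real (m + 1) * norm (P1 x * P1 x * I x ^ (m + 2))" for x
        unfolding Q2_def by (rule order_trans[OF norm_triangle_ineq]) (simp add: norm_mult del: of_nat_add of_nat_Suc)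
    qed
    also have "\<dots> = real m * L (\<lambda>x. P2 x * I x ^ (m + 1)) + real m * real (m + 1) * L (\<lambda>x. P1 x * P1 x * I x ^ (m + 2))"
      unfolding L_def using b p by (subst LINT_add) auto
    also have "\<dots> \<le> real m * (inverse \<delta> ^ (m + 1) * L P2) + real m * real (m + 1) * (inverse \<delta> ^ (m + 2) * L (\<lambda>x. P1 x * P1 x))"
      using p by (intro add_mono mult_left_mono bL P11) auto
    finally show ?thesis .
  qed
  have "L Q + L Q2 \<le> (L P0 / \<delta> + L P2 / \<delta> + L (\<lambda>x. P1 x * P1 x) / \<delta>\<^sup>2) * real m * real (m + 1) * inverse \<delta> ^ m"
  proof -
    have M: "real m \<le> real m * real (m + 1)" using m by simp
    have "L Q + L Q2 \<le> real m * (inverse \<delta> ^ m * (L P0 / \<delta> + L P2 / \<delta>)) + real m * real (m + 1) * (inverse \<delta> ^ m * (L (\<lambda>x. P1 x * P1 x) / \<delta>\<^sup>2))"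
      using LQ LQ2 by (simp add: algebra_simps divide_inverse power2_eq_square power_inverse)
    also have "\<dots> \<le> real m * real (m + 1) * (inverse \<delta> ^ m * (L P0 / \<delta> + L P2 / \<delta>)) + real m * real (m + 1) * (inverse \<delta> ^ m * (L (\<lambda>x. P1 x * P1 x) / \<delta>\<^sup>2))"
      using d L0 by (intro add_right_mono mult_right_mono M mult_nonneg_nonneg add_nonneg_nonneg) auto
    finally show ?thesis by (simp add: algebra_simps)
  qed
  with wnorm_le_mono[OF wnorm_le_nice[OF nice]] show ?thesis
    unfolding L_def Q_def I_def m_def by simp
qed

text \<open>Newman's proof of Wiener's lemma: with \<open>P\<close> a smooth approximation of \<open>c + F\<close> and \<open>D = c + F - P\<close>, expand
  \<open>1 / (P + D)\<close> in powers of \<open>D / P\<close>. The Wiener norm of \<open>D ^ n\<close> is at most \<open>\<epsilon> ^ n\<close>, while that of \<open>1 / P ^ (n + 1)\<close> grows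
  only like \<open>n\<^sup>2 / (2 \<epsilon>) ^ n\<close> because \<open>P\<close> is smooth and bounded below by \<open>2 \<epsilon>\<close>.\<close>

theorem wiener_inverse:
  assumes F: "F \<in> wiener_algebra" and c: "c \<noteq> 0" and nz: "\<And>k. c + F k \<noteq> 0"
  shows "(\<lambda>k. inverse (c + F k) - inverse c) \<in> wiener_algebra"
proof -
  obtain m where m: "m > 0" "\<And>k. norm (c + F k) \<ge> m"
    using nonvanishing_bounded_below[OF F c nz] by blast
  \<comment> \<open>With this choice \<open>norm (P k)\<close> is at least
    \<open>3 * e - e = \<delta>\<close>, and the ratio \<open>e / \<delta>\<close> of the series is
    1/2.\<close>
  define e where "e = m / 3"
  have e: "e > 0" unfolding e_def using m by simp
  define \<delta> where "\<delta> = 2 * e"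
  have d: "\<delta> > 0" unfolding \<delta>_def using e by simp
  obtain h where h: "L1 h" "F = ft h" using F unfolding wiener_algebra_iff by auto
  obtain g P1 P2 where g: "L1 g" "(LINT p|lborel. norm (h p - g p)) \<le> e" "nice (ft g) P1 P2"
    using L1_nice_dense[OF h(1) e] by auto
  define D where "D = ft (\<lambda>p. h p - g p)"
  define P where "P = (\<lambda>k. c + ft g k)"
  have PD: "c + F k = P k + D k" for k unfolding P_def D_def using h g by (simp add: ft_diff)
  have wD: "wnorm_le e D" unfolding D_def using g h by (intro wnorm_le_mono[OF wnorm_le_ft]) auto
  have De: "norm (D k) \<le> e" for k using wD wnorm_le_norm_le by blast
  have P\<delta>: "norm (P k) \<ge> \<delta>" for k
    using m(2)[of k] De[of k] norm_triangle_ineq[of "P k" "D k"] unfolding PD \<delta>_def e_def by simp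
  have c\<delta>: "norm c \<ge> \<delta>"
  proof (rule tendsto_lowerbound)
    have "(P \<longlongrightarrow> c + 0) at_top" unfolding P_def using g(3) unfolding nice_def by (intro tendsto_intros) auto
    then show "((\<lambda>k. norm (P k)) \<longlongrightarrow> norm c) at_top" by (intro tendsto_norm) simp
  qed (use P\<delta> in auto)
  define L where "L = (\<lambda>f. LINT x|lborel. norm (f (x :: real) :: complex))"
  define M where "M = L (ft g) / \<delta> + L P2 / \<delta> + L (\<lambda>x. P1 x * P1 x) / \<delta>\<^sup>2"
  define B where "B n = M * real (n + 1) * real (n + 2) * inverse \<delta> ^ (n + 1)" for n
  define Q where "Q n k = inverse (P k) ^ (n + 1) - inverse c ^ (n + 1)" for n k
  have wQ: "wnorm_le (B n) (Q n)" for n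
    unfolding B_def Q_def M_def L_def P_def
    by (rule wnorm_le_nice_inverse_power[OF g(3) d c\<delta>]) (use P\<delta> P_def in auto)
  \<comment> \<open>Only the term \<open>n = 0\<close> has a nonzero limit at infinity, namely
    \<open>inverse c\<close>; the others contain a power of \<open>D\<close>, which lies in the
    algebra.\<close>
  define T where "T n k = (- D k) ^ n * inverse (P k) ^ (n + 1) - (if n = 0 then inverse c else 0)" for n k
  define N where "N n = e ^ n * (inverse \<delta> ^ (n + 1) + B n)" for n
  have wT: "wnorm_le (N n) (T n)" for n
  proof (cases n)
    case 0
    have "T n = Q n" unfolding T_def Q_def 0 by simp
    moreover have "B n \<le> N n" unfolding N_def 0 using d by simp
    ultimately show ?thesis using wnorm_le_mono[OF wQ[of n]] by simp
  next
    case (Suc r)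
    have "wnorm_le (norm (-1::complex) * e) (\<lambda>k. - 1 * D k)" by (rule wnorm_le_cmult[OF wD])
    then have "wnorm_le e (\<lambda>k. - D k)" by simp
    from wnorm_le_power[OF this, of r] have w: "wnorm_le (e ^ n) (\<lambda>k. (- D k) ^ n)" unfolding Suc .
    \<comment> \<open>The power of \<open>1 / P\<close> is split into its limit
      \<open>inverse c ^ (n + 1)\<close> and \<open>Q n\<close>; multiplied by
      \<open>(- D k) ^ n\<close>, both parts are in the algebra.\<close>
    have "wnorm_le (norm (inverse c ^ (n + 1)) * e ^ n + e ^ n * B n) (\<lambda>k. inverse c ^ (n + 1) * (- D k) ^ n + (- D k) ^ n * Q n k)"
      by (intro wnorm_le_add wnorm_le_cmult wnorm_le_mult w wQ)
    moreover have "inverse c ^ (n + 1) * (- D k) ^ n + (- D k) ^ n * Q n k = T n k" for k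
      unfolding T_def Q_def Suc by (simp add: algebra_simps)
    moreover have "norm (inverse c ^ (n + 1)) * e ^ n + e ^ n * B n \<le> N n"
    proof -
      have "norm (inverse c ^ (n + 1)) \<le> inverse \<delta> ^ (n + 1)"
        unfolding norm_power norm_inverse using c\<delta> d by (intro power_mono le_imp_inverse_le) auto
      then show ?thesis unfolding N_def using e by (simp add: distrib_left mult.commute)
    qed
    ultimately show ?thesis using wnorm_le_mono by simp
  qed
  have N_eq: "N n = inverse \<delta> * ((1 + M * real (n + 1) * real (n + 2)) * (1 / 2) ^ n)" for n
  proof -
    have "e ^ n * inverse \<delta> ^ (n + 1) = inverse \<delta> * (1 / 2) ^ n"
      using e unfolding \<delta>_def by (induction n) (auto simp: field_simps)
    moreover have "N n = (e ^ n * inverse \<delta> ^ (n + 1)) * (1 + M * real (n + 1) * real (n + 2))"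
      unfolding N_def B_def by (simp add: algebra_simps)
    ultimately have "N n = inverse \<delta> * (1 / 2) ^ n * (1 + M * real (n + 1) * real (n + 2))"
      by (simp only:)
    then show ?thesis by (simp add: mult_ac)
  qed
  \<comment> \<open>Any ratio strictly between 1/2 and 1 absorbs the quadratic factor.\<close>
  have "summable (\<lambda>n. (1 + M * real (n + 1) * real (n + 2)) * (1 / 2) ^ n)"
  proof (rule summable_comparison_test_bigo)
    show "summable (\<lambda>n. norm ((3 / 4 :: real) ^ n))" by (simp add: summable_geometric)
    show "(\<lambda>n. (1 + M * real (n + 1) * real (n + 2)) * (1 / 2) ^ n) \<in> O(\<lambda>n. (3 / 4 :: real) ^ n)"
      by real_asymp
  qed
  then have sN: "summable N" unfolding N_eq[abs_def] by (rule summable_mult)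
  have "wnorm_le (suminf N) (\<lambda>k. \<Sum>n. T n k)" by (rule wnorm_le_suminf[OF wT sN])
  moreover have "(\<Sum>n. T n k) = inverse (c + F k) - inverse c" for k
  proof (rule sums_unique[symmetric])
    have nzP: "P k \<noteq> 0" using P\<delta>[of k] d by auto
    have "norm (- D k * inverse (P k)) < 1"
    proof -
      have "norm (D k) < norm (P k)" using De[of k] P\<delta>[of k] e unfolding \<delta>_def by linarith
      then show ?thesis using nzP by (simp add: norm_mult norm_inverse divide_inverse[symmetric] norm_divide)
    qed
    from sums_mult[OF geometric_sums[OF this], of "inverse (P k)"]
    have "(\<lambda>n. inverse (P k) * (- D k * inverse (P k)) ^ n) sums (inverse (P k) * (1 / (1 - - D k * inverse (P k))))" .
    moreover have "inverse (P k) * (1 / (1 - - D k * inverse (P k))) = inverse (c + F k)"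
      using nzP nz[of k] unfolding PD by (simp add: field_simps)
    moreover have "inverse (P k) * (- D k * inverse (P k)) ^ n = (- D k) ^ n * inverse (P k) ^ (n + 1)" for n
      unfolding power_mult_distrib by simp
    ultimately have "(\<lambda>n. (- D k) ^ n * inverse (P k) ^ (n + 1)) sums inverse (c + F k)" by (simp only:)
    from sums_diff[OF this sums_single[of 0 "\<lambda>_. inverse c"]]
    show "(\<lambda>n. T n k) sums (inverse (c + F k) - inverse c)" unfolding T_def by simp
  qed
  ultimately show ?thesis using wnorm_le_imp_wiener by simp
qed

section \<open>Derivatives and difference quotients in the Wiener algebra\<close>

lemma wiener_zero: "(\<lambda>_. 0) \<in> wiener_algebra"
  using wnorm_le_zero wnorm_le_imp_wiener by blast

lemma wiener_add: "F \<in> wiener_algebra \<Longrightarrow> G \<in> wiener_algebra \<Longrightarrow> (\<lambda>k. F k + G k) \<in> wiener_algebra"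
  unfolding wiener_algebra_iff_wnorm_le using wnorm_le_add by blast

lemma wiener_cmult: "F \<in> wiener_algebra \<Longrightarrow> (\<lambda>k. c * F k) \<in> wiener_algebra"
  unfolding wiener_algebra_iff_wnorm_le using wnorm_le_cmult by blast

lemma wiener_mult: "F \<in> wiener_algebra \<Longrightarrow> G \<in> wiener_algebra \<Longrightarrow> (\<lambda>k. F k * G k) \<in> wiener_algebra"
  unfolding wiener_algebra_iff_wnorm_le using wnorm_le_mult by blast

lemma wiener_reflect:
  assumes "F \<in> wiener_algebra"
  shows "(\<lambda>k. F (- k)) \<in> wiener_algebra"
proof -
  obtain h where h: "L1 h" "F = ft h" using assms unfolding wiener_algebra_iff by auto
  have "L1 (\<lambda>p. h (- p))"
    using lborel_integrable_real_affine[OF h(1), of "-1" 0] by simp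
  then show ?thesis unfolding wiener_algebra_iff
    by (intro exI[of _ "\<lambda>p. h (- p)"]) (auto simp: ft_reflect h(2) fun_eq_iff)
qed

text \<open>The recursion passes to the derivative, so closure under products and inverses follows
  by induction on \<open>m\<close> from the formula for the first derivative.\<close>

primrec wdiff :: "nat \<Rightarrow> (real \<Rightarrow> complex) \<Rightarrow> bool" where
  "wdiff 0 F \<longleftrightarrow> F \<in> wiener_algebra"
| "wdiff (Suc m) F \<longleftrightarrow> F \<in> wiener_algebra \<and> (\<exists>F'. (\<forall>k. (F has_vector_derivative F' k) (at k)) \<and> wdiff m F')"

lemma wdiff_wiener: "wdiff m F \<Longrightarrow> F \<in> wiener_algebra"
  by (cases m) auto

lemma wdiff_SucD: "wdiff (Suc m) F \<Longrightarrow> wdiff m F"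
proof (induction m arbitrary: F)
  case (Suc m)
  then obtain F' where "\<And>k. (F has_vector_derivative F' k) (at k)" "wdiff (Suc m) F'" by (subst (asm) wdiff.simps) blast
  then show ?case using Suc.IH Suc.prems by auto
qed simp

lemma wdiff_zero: "wdiff m (\<lambda>_. 0)"
proof (induction m)
  case (Suc m)
  then show ?case by (auto simp: wiener_zero intro!: exI[of _ "\<lambda>_. 0"] derivative_eq_intros)
qed (simp add: wiener_zero)

lemma wdiff_add: "wdiff m F \<Longrightarrow> wdiff m G \<Longrightarrow> wdiff m (\<lambda>k. F k + G k)"
proof (induction m arbitrary: F G)
  case (Suc m)
  then obtain F' G' where
    "\<And>k. (F has_vector_derivative F' k) (at k)" "wdiff m F'" "\<And>k. (G has_vector_derivative G' k) (at k)" "wdiff m G'"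
    by auto
  then show ?case using Suc
    by (auto intro!: wiener_add exI[of _ "\<lambda>k. F' k + G' k"] has_vector_derivative_add)
qed (simp add: wiener_add)

lemma wdiff_cmult: "wdiff m F \<Longrightarrow> wdiff m (\<lambda>k. c * F k)"
proof (induction m arbitrary: F)
  case (Suc m)
  then obtain F' where "\<And>k. (F has_vector_derivative F' k) (at k)" "wdiff m F'" by auto
  then show ?case using Suc
    by (auto intro!: wiener_cmult exI[of _ "\<lambda>k. c * F' k"] has_vector_derivative_mult_right)
qed (simp add: wiener_cmult)

lemma wdiff_diff: "wdiff m F \<Longrightarrow> wdiff m G \<Longrightarrow> wdiff m (\<lambda>k. F k - G k)"
  using wdiff_add[of m F "\<lambda>k. - 1 * G k"] wdiff_cmult[of m G "- 1"] by simp

lemma wdiff_mult: "wdiff m F \<Longrightarrow> wdiff m G \<Longrightarrow> wdiff m (\<lambda>k. F k * G k)"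
proof (induction m arbitrary: F G)
  case (Suc m)
  then obtain F' G' where d:
    "\<And>k. (F has_vector_derivative F' k) (at k)" "wdiff m F'" "\<And>k. (G has_vector_derivative G' k) (at k)" "wdiff m G'"
    by auto
  have "wdiff m (\<lambda>k. F k * G' k + F' k * G k)"
    by (intro wdiff_add Suc.IH d wdiff_SucD[OF Suc.prems(1)] wdiff_SucD[OF Suc.prems(2)])
  then show ?case using Suc.prems d
    by (auto intro!: wiener_mult exI[of _ "\<lambda>k. F k * G' k + F' k * G k"] has_vector_derivative_mult)
qed (simp add: wiener_mult)

lemma wdiff_reflect: "wdiff m F \<Longrightarrow> wdiff m (\<lambda>k. F (- k))"
proof (induction m arbitrary: F)
  case (Suc m)
  then obtain F' where d: "\<And>k. (F has_vector_derivative F' k) (at k)" "wdiff m F'" by auto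
  have "((\<lambda>k. F (- k)) has_vector_derivative - 1 * F' (- k)) (at k)" for k
  proof -
    have "(uminus has_vector_derivative (- 1 :: real)) (at k)"
      using has_vector_derivative_minus[OF has_vector_derivative_id[of "at k"]] by simp
    from vector_diff_chain_at[OF this d(1)[of "- k"]] show ?thesis by (simp add: o_def)
  qed
  then show ?case using Suc d
    by (auto intro!: wiener_reflect exI[of _ "\<lambda>k. - 1 * F' (- k)"] wdiff_cmult simp del: mult_minus1)
qed (simp add: wiener_reflect)

lemma wdiff_inverse:
  assumes "c \<noteq> 0" "\<And>k. c + F k \<noteq> 0"
  shows "wdiff m F \<Longrightarrow> wdiff m (\<lambda>k. inverse (c + F k) - inverse c)"
proof (induction m)
  case (Suc m)
  then obtain F' where d: "\<And>k. (F has_vector_derivative F' k) (at k)" "wdiff m F'" by auto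
  define G where "G k = inverse (c + F k) - inverse c" for k
  have G: "wdiff m G" unfolding G_def using Suc wdiff_SucD by blast
  \<comment> \<open>This is \<open>- F' / (c + F)^2\<close> with \<open>1 / (c + F)\<close> replaced
    by \<open>G + 1 / c\<close>, which displays it as a combination of products inside the
    algebra.\<close>
  define G' where "G' k = - 1 * (F' k * (G k * G k + 2 * inverse c * G k)) + (- inverse c * inverse c) * F' k" for k
  have "wdiff m G'" unfolding G'_def by (intro wdiff_add wdiff_cmult wdiff_mult d G)
  moreover have "((\<lambda>k. inverse (c + F k) - inverse c) has_vector_derivative G' k) (at k)" for k
  proof -
    have "((\<lambda>k. c + F k) has_vector_derivative F' k) (at k)"
      using has_vector_derivative_add[OF has_vector_derivative_const d(1)[of k], of c] by simp
    from field_vector_diff_chain_at[OF this DERIV_inverse[OF assms(2)[of k]]]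
    have "((\<lambda>k. inverse (c + F k)) has_vector_derivative F' k * - (inverse (c + F k) ^ Suc (Suc 0))) (at k)"
      by (simp add: o_def)
    from has_vector_derivative_diff[OF this has_vector_derivative_const[of "inverse c"]]
    have "((\<lambda>k. inverse (c + F k) - inverse c) has_vector_derivative F' k * - (inverse (c + F k) ^ Suc (Suc 0))) (at k)"
      by simp
    also have "F' k * - (inverse (c + F k) ^ Suc (Suc 0)) = G' k"
    proof -
      have "inverse (c + F k) = G k + inverse c" unfolding G_def by simp
      then show ?thesis unfolding G'_def by (simp only:) (simp add: algebra_simps)
    qed
    finally show ?thesis .
  qed
  ultimately show ?case
    using Suc.prems wiener_inverse[OF wdiff_wiener[OF Suc.prems] assms] by auto
qed (use wiener_inverse assms in auto)

text \<open>These functions form an algebra which is closed under inversion of nonvanishing functions with \<open>c \<noteq> 0\<close>.\<close>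

definition wquot :: "nat \<Rightarrow> complex \<Rightarrow> (real \<Rightarrow> complex) \<Rightarrow> bool" where
  "wquot m c F \<longleftrightarrow> wdiff m (\<lambda>k. F k - c) \<and> (\<exists>Q. wdiff m Q \<and> (\<forall>k. F k = F 0 + complex_of_real k * Q k))"

lemma wquot_const: "wquot m c (\<lambda>_. c)"
  unfolding wquot_def using wdiff_zero by (auto intro!: exI[of _ "\<lambda>_. 0"])

lemma wquot_add:
  assumes "wquot m c F" "wquot m d G"
  shows "wquot m (c + d) (\<lambda>k. F k + G k)"
proof -
  obtain Q R where F: "wdiff m (\<lambda>k. F k - c)" "wdiff m Q" "\<And>k. F k = F 0 + complex_of_real k * Q k"
    and G: "wdiff m (\<lambda>k. G k - d)" "wdiff m R" "\<And>k. G k = G 0 + complex_of_real k * R k"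
    using assms unfolding wquot_def by blast
  have "wdiff m (\<lambda>k. F k + G k - (c + d))" using wdiff_add[OF F(1) G(1)] by (simp add: algebra_simps)
  moreover have "F k + G k = F 0 + G 0 + complex_of_real k * (Q k + R k)" for k
    using F(3)[of k] G(3)[of k] by (simp add: algebra_simps)
  ultimately show ?thesis unfolding wquot_def using wdiff_add[OF F(2) G(2)] by blast
qed

lemma wquot_mult:
  assumes "wquot m c F" "wquot m d G"
  shows "wquot m (c * d) (\<lambda>k. F k * G k)"
proof -
  obtain Q R where F: "wdiff m (\<lambda>k. F k - c)" "wdiff m Q" "\<And>k. F k = F 0 + complex_of_real k * Q k"
    and G: "wdiff m (\<lambda>k. G k - d)" "wdiff m R" "\<And>k. G k = G 0 + complex_of_real k * R k"
    using assms unfolding wquot_def by blast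
  have "wdiff m (\<lambda>k. (F k - c) * (G k - d) + (c * (G k - d) + d * (F k - c)))"
    by (intro wdiff_add wdiff_mult wdiff_cmult F G)
  then have 1: "wdiff m (\<lambda>k. F k * G k - c * d)" by (simp add: algebra_simps)
  \<comment> \<open>Leibniz rule for difference quotients, \<open>F * R + G 0 * Q\<close>. Here
    \<open>F\<close> is split into \<open>F - c\<close> and \<open>c\<close>, since only the former
    is in the algebra.\<close>
  have 2: "wdiff m (\<lambda>k. (F k - c) * R k + (c * R k + G 0 * Q k))"
    by (intro wdiff_add wdiff_mult wdiff_cmult F G)
  have "F k * G k = F 0 * G 0 + complex_of_real k * ((F k - c) * R k + (c * R k + G 0 * Q k))" for k
  proof -
    have "F k * G k = F k * (G 0 + complex_of_real k * R k)" using G(3)[of k] by simp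
    also have "\<dots> = F k * G 0 + complex_of_real k * (F k * R k)" by (simp add: algebra_simps)
    also have "F k * G 0 = (F 0 + complex_of_real k * Q k) * G 0" using F(3)[of k] by simp
    finally show ?thesis by (simp add: algebra_simps)
  qed
  then show ?thesis unfolding wquot_def using 1 2 by blast
qed

lemma wquot_cmult: "wquot m d F \<Longrightarrow> wquot m (c * d) (\<lambda>k. c * F k)"
  using wquot_mult[OF wquot_const] .

lemma wquot_uminus: "wquot m d F \<Longrightarrow> wquot m (- d) (\<lambda>k. - F k)"
  using wquot_cmult[of m d F "-1"] by simp

lemma wquot_diff: "wquot m c F \<Longrightarrow> wquot m d G \<Longrightarrow> wquot m (c - d) (\<lambda>k. F k - G k)"
  using wquot_add[OF _ wquot_uminus, of m c F d G] by simp

lemma wquot_reflect: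
  assumes "wquot m c F"
  shows "wquot m c (\<lambda>k. F (- k))"
proof -
  obtain Q where F: "wdiff m (\<lambda>k. F k - c)" "wdiff m Q" "\<And>k. F k = F 0 + complex_of_real k * Q k"
    using assms unfolding wquot_def by blast
  have "F (- k) = F (- 0) + complex_of_real k * (- 1 * Q (- k))" for k using F(3)[of "- k"] by simp
  then show ?thesis unfolding wquot_def using wdiff_reflect[OF F(1)] wdiff_cmult[OF wdiff_reflect[OF F(2)]] by blast
qed

lemma wquot_inverse:
  assumes "wquot m c F" "c \<noteq> 0" and nz: "\<And>k. F k \<noteq> 0"
  shows "wquot m (inverse c) (\<lambda>k. inverse (F k))"
proof -
  obtain Q where F: "wdiff m (\<lambda>k. F k - c)" "wdiff m Q" "\<And>k. F k = F 0 + complex_of_real k * Q k"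
    using assms unfolding wquot_def by blast
  have 1: "wdiff m (\<lambda>k. inverse (F k) - inverse c)"
    using wdiff_inverse[of c "\<lambda>k. F k - c" m] assms(2) nz F(1) by simp
  \<comment> \<open>The difference quotient of \<open>1 / F\<close> is
    \<open>- Q / (F 0 * F)\<close>, with \<open>1 / F\<close> again split at its limit
    \<open>1 / c\<close>.\<close>
  have 2: "wdiff m (\<lambda>k. - inverse (F 0) * (Q k * (inverse (F k) - inverse c) + inverse c * Q k))"
    by (intro wdiff_cmult wdiff_add wdiff_mult F 1)
  have "inverse (F k) = inverse (F 0) + complex_of_real k * (- inverse (F 0) * (Q k * (inverse (F k) - inverse c) + inverse c * Q k))" for k
  proof -
    have "complex_of_real k * Q k = F k - F 0" using F(3)[of k] by simp
    moreover have "complex_of_real k * (- inverse (F 0) * (Q k * (inverse (F k) - inverse c) + inverse c * Q k))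
      = - inverse (F 0) * ((complex_of_real k * Q k) * inverse (F k))" by (simp add: algebra_simps)
    ultimately have "complex_of_real k * (- inverse (F 0) * (Q k * (inverse (F k) - inverse c) + inverse c * Q k))
      = - inverse (F 0) * ((F k - F 0) * inverse (F k))" by (simp only:)
    then show ?thesis using nz[of k] nz[of 0] by (simp add: right_diff_distrib left_diff_distrib)
  qed
  then show ?thesis unfolding wquot_def using 1 2 by blast
qed

lemma wquot_divide:
  assumes "wquot m c F" "wquot m d G" "d \<noteq> 0" "\<And>k. G k \<noteq> 0"
  shows "wquot m (c / d) (\<lambda>k. F k / G k)"
  unfolding divide_inverse by (intro wquot_mult wquot_inverse assms)

section \<open>The multiplier \<open>1 / (k + i)\<close>\<close>

lemma integrable_exp_neg_Ici: "L1 (\<lambda>p::real. indicator {0..} p * exp (- p))"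
proof -
  have "L1 (\<lambda>p::real. indicator {0<..} p * exp (- p))"
    using integrable_I0i_exp_mscale[of 1] by (simp add: set_integrable_def)
  moreover have "AE p in lborel. indicator {0<..} p * exp (- p) = indicator {0..} p * exp (- p :: real)"
    using AE_lborel_singleton[of "0::real"] by eventually_elim (auto simp: indicator_def)
  ultimately show ?thesis
    using integrable_cong_AE[of "\<lambda>p::real. indicator {0<..} p * exp (- p)" lborel "\<lambda>p. indicator {0..} p * exp (- p)"] by simp
qed

text \<open>This factor brings the linearly growing Wronskian back to bounded size without vanishing
  anywhere on the real line.\<close>

lemma inverse_add_ii_wiener: "(\<lambda>k. inverse (complex_of_real k + \<i>)) \<in> wiener_algebra"
proof -
  \<comment> \<open>The one-sided exponential: its decay rate is the imaginary shift in
    \<open>k + i\<close>, and its side the sign of that shift.\<close>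
  define h where "h p = - \<i> * complex_of_real (indicator {0..} p * exp (- p))" for p :: real
  have hi: "L1 h" unfolding h_def
    by (intro integrable_mult_right integrable_of_real integrable_exp_neg_Ici)
  have [measurable]: "h \<in> borel_measurable borel" using hi by auto
  have "ft h k = inverse (complex_of_real k + \<i>)" for k
  proof -
    have nz: "complex_of_real k + \<i> \<noteq> 0" by (auto simp: complex_eq_iff)
    define G where "G x = inverse (complex_of_real k + \<i>) * (1 - exp ((\<i> * k - 1) * complex_of_real x))" for x :: real
    have si: "set_integrable lborel {0..real n} (\<lambda>p. iexp (k * p) * h p)" for n
      unfolding set_integrable_def by (intro integrable_mult_indicator integrable_exp_i_mult hi) auto
    have e: "(LINT p|lborel. indicator {0..real n} p *\<^sub>R (iexp (k * p) * h p)) = G (real n)" for n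
    proof -
      have "(LINT p|lborel. indicator {0..real n} p *\<^sub>R (iexp (k * p) * h p))
          = integral {0..real n} (\<lambda>p. iexp (k * p) * h p)"
        using set_borel_integral_eq_integral(2)[OF si] by (simp add: set_lebesgue_integral_def)
      also have "\<dots> = integral {0..real n} (\<lambda>p. - \<i> * exp ((\<i> * k - 1) * complex_of_real p))"
      proof (intro Henstock_Kurzweil_Integration.integral_cong)
        fix p assume "p \<in> {0..real n}"
        then have "iexp (k * p) * h p = - \<i> * (iexp (k * p) * exp (- complex_of_real p))"
          by (simp add: h_def exp_of_real[symmetric])
        also have "iexp (k * p) * exp (- complex_of_real p) = exp ((\<i> * k - 1) * complex_of_real p)"
          by (simp add: exp_add[symmetric] left_diff_distrib mult.assoc)
        finally show "iexp (k * p) * h p = - \<i> * exp ((\<i> * k - 1) * complex_of_real p)" .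
      qed
      also have "\<dots> = G (real n) - G 0"
      proof (intro integral_unique fundamental_theorem_of_calculus)
        fix x
        have "((\<lambda>z. inverse (complex_of_real k + \<i>) * (1 - exp ((\<i> * k - 1) * z))) has_field_derivative
            inverse (complex_of_real k + \<i>) * (- ((\<i> * k - 1) * exp ((\<i> * k - 1) * complex_of_real x)))) (at (complex_of_real x))"
          by (auto intro!: derivative_eq_intros)
        also have "inverse (complex_of_real k + \<i>) * (- ((\<i> * k - 1) * exp ((\<i> * k - 1) * complex_of_real x)))
            = - \<i> * exp ((\<i> * k - 1) * complex_of_real x)"
        proof -
          have "inverse z * (- (\<i> * z * w)) = - \<i> * w" if "z \<noteq> 0" for z w :: complex
            using that by (simp add: field_simps)
          from this[OF nz] have "inverse (complex_of_real k + \<i>) * (- (\<i> * (complex_of_real k + \<i>) * exp ((\<i> * k - 1) * complex_of_real x)))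
            = - \<i> * exp ((\<i> * k - 1) * complex_of_real x)" .
          moreover have "\<i> * (complex_of_real k + \<i>) = \<i> * k - 1" by (simp add: algebra_simps)
          ultimately show ?thesis by (simp only:)
        qed
        finally show "(G has_vector_derivative - \<i> * exp ((\<i> * k - 1) * complex_of_real x)) (at x within {0..real n})"
          unfolding G_def
          by (rule has_vector_derivative_at_within[OF has_vector_derivative_real_field])
      qed auto
      finally show ?thesis by (simp add: G_def)
    qed
    have "(\<lambda>n. LINT p|lborel. indicator {0..real n} p *\<^sub>R (iexp (k * p) * h p))
        \<longlonglongrightarrow> (LINT p|lborel. iexp (k * p) * h p)"
    proof (rule integral_dominated_convergence)
      show "L1 (\<lambda>p. norm (h p))" using hi by simp
      show "AE p in lborel. (\<lambda>n. indicator {0..real n} p *\<^sub>R (iexp (k * p) * h p)) \<longlonglongrightarrow> iexp (k * p) * h p"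
      proof (intro AE_I2 tendsto_eventually)
        fix p :: real
        obtain N :: nat where "p \<le> real N" using real_arch_simple by blast
        then show "\<forall>\<^sub>F n in sequentially. indicator {0..real n} p *\<^sub>R (iexp (k * p) * h p) = iexp (k * p) * h p"
          by (intro eventually_sequentiallyI[of N]) (auto simp: indicator_def h_def)
      qed
      show "AE p in lborel. norm (indicator {0..real n} p *\<^sub>R (iexp (k * p) * h p)) \<le> norm (h p)" for n
        by (auto simp: norm_mult indicator_def)
    qed measurable
    moreover have "(\<lambda>n. G (real n)) \<longlonglongrightarrow> inverse (complex_of_real k + \<i>) * (1 - 0)"
      unfolding G_def
    proof (intro tendsto_intros)
      have "norm (exp ((\<i> * k - 1) * complex_of_real x)) = exp (- x)" for x by simp
      moreover have "(\<lambda>n. exp (- real n)) \<longlonglongrightarrow> 0" by real_asymp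
      ultimately show "(\<lambda>n. exp ((\<i> * k - 1) * complex_of_real (real n))) \<longlonglongrightarrow> 0"
        by (intro tendsto_norm_zero_cancel[of "\<lambda>n. exp ((\<i> * k - 1) * complex_of_real (real n))"]) (simp only:)
    qed
    ultimately have "(LINT p|lborel. iexp (k * p) * h p) = inverse (complex_of_real k + \<i>) * (1 - 0)"
      unfolding e by (rule LIMSEQ_unique)
    then show ?thesis by (simp add: ft_def)
  qed
  then show ?thesis unfolding wiener_algebra_iff using hi by (intro exI[of _ h]) auto
qed

lemma inverse_add_ii_wdiff: "wdiff m (\<lambda>k. inverse (complex_of_real k + \<i>))"
proof (induction m)
  case (Suc m)
  have nz: "complex_of_real k + \<i> \<noteq> 0" for k by (auto simp: complex_eq_iff)
  have "((\<lambda>k. inverse (complex_of_real k + \<i>)) has_vector_derivative - 1 * (inverse (complex_of_real k + \<i>) * inverse (complex_of_real k + \<i>))) (at k)" for k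
  proof -
    have "((\<lambda>z. inverse (z + \<i>)) has_field_derivative - 1 * (inverse (complex_of_real k + \<i>) * inverse (complex_of_real k + \<i>))) (at (complex_of_real k))"
      using nz by (auto intro!: derivative_eq_intros)
    then show ?thesis by (rule has_vector_derivative_real_field)
  qed
  moreover have "wdiff m (\<lambda>k. - 1 * (inverse (complex_of_real k + \<i>) * inverse (complex_of_real k + \<i>)))"
    by (intro wdiff_cmult wdiff_mult Suc)
  ultimately show ?case unfolding wdiff.simps using inverse_add_ii_wiener
    by (intro conjI exI[of _ "\<lambda>k. - 1 * (inverse (complex_of_real k + \<i>) * inverse (complex_of_real k + \<i>))"] allI)
qed (simp add: inverse_add_ii_wiener)

lemma wquot_inverse_add_ii: "wquot m 0 (\<lambda>k. inverse (complex_of_real k + \<i>))"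
proof -
  have nz: "complex_of_real k + \<i> \<noteq> 0" for k by (auto simp: complex_eq_iff)
  have "inverse (complex_of_real k + \<i>) = inverse (complex_of_real 0 + \<i>) + complex_of_real k * (\<i> * inverse (complex_of_real k + \<i>))" for k
  proof -
    have "inverse z = - \<i> + (z - \<i>) * (\<i> * inverse z)" if "z \<noteq> 0" for z :: complex
      using that by (simp add: left_diff_distrib)
    from this[OF nz[of k]] show ?thesis by simp
  qed
  then show ?thesis unfolding wquot_def using inverse_add_ii_wdiff[of m] wdiff_cmult[OF inverse_add_ii_wdiff[of m], of \<i>] by auto
qed

section \<open>Polynomial weights, derivatives and difference quotients\<close>

lemma integrable_weighted_superposition:
  fixes c :: "real \<Rightarrow> real \<Rightarrow> complex"
  assumes [measurable]: "(\<lambda>(t, p). c t p) \<in> borel_measurable lborel2"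
    and i: "\<And>t. L1 (\<lambda>p. (1 + \<bar>p\<bar>) ^ m * norm (c t p))"
    and w: "L1 w" "\<And>t. (LINT p|lborel. (1 + \<bar>p\<bar>) ^ m * norm (c t p)) \<le> w t"
  shows "L1 (\<lambda>p. (1 + \<bar>p\<bar>) ^ m * norm (LINT t|lborel. c t p))"
proof -
  have "integrable lborel2 (\<lambda>(t, p). complex_of_real ((1 + \<bar>p\<bar>) ^ m) * c t p)"
  proof (rule pair_integrableI[OF _ _ w(1)])
    show "L1 (\<lambda>p. complex_of_real ((1 + \<bar>p\<bar>) ^ m) * c t p)" for t
      by (rule L1_dominated[OF i[of t]]) (auto simp: norm_mult norm_power abs_mult simp flip: of_real_add)
    show "(LINT p|lborel. norm (complex_of_real ((1 + \<bar>p\<bar>) ^ m) * c t p)) \<le> w t" for t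
      using w(2)[of t] by (simp add: norm_mult norm_power del: of_real_power)
  qed measurable
  from integrable_norm[OF ft_superposition(1)[OF this]]
  show ?thesis by (simp add: norm_mult norm_power del: of_real_power)
qed

lemma integrable_of_weighted:
  fixes h :: "real \<Rightarrow> complex"
  assumes [measurable]: "h \<in> borel_measurable borel" and "L1 (\<lambda>p. (1 + \<bar>p\<bar>) ^ m * norm (h p))"
  shows "L1 h"
proof (rule L1_dominated[OF assms(2)])
  show "AE p in lborel. norm (h p) \<le> norm ((1 + \<bar>p\<bar>) ^ m * norm (h p))"
  proof (intro AE_I2)
    fix p :: real
    have "1 \<le> (1 + \<bar>p\<bar>) ^ m" by (intro one_le_power) auto
    then show "norm (h p) \<le> norm ((1 + \<bar>p\<bar>) ^ m * norm (h p))"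
      using mult_right_mono[of 1 "(1 + \<bar>p\<bar>) ^ m" "norm (h p)"] by simp
  qed
qed measurable

lemma integrable_weighted_mono:
  fixes h g :: "real \<Rightarrow> complex"
  assumes [measurable]: "g \<in> borel_measurable borel" and "L1 (\<lambda>p. (1 + \<bar>p\<bar>) ^ n * norm (h p))"
    and "\<And>p. (1 + \<bar>p\<bar>) ^ m * norm (g p) \<le> (1 + \<bar>p\<bar>) ^ n * norm (h p)"
  shows "L1 (\<lambda>p. (1 + \<bar>p\<bar>) ^ m * norm (g p))"
  by (rule L1_dominated[OF assms(2)]) (use assms(3) in \<open>auto simp: abs_mult\<close>)

text \<open>Each power of the weight pays for one derivative, since differentiating the transform
  multiplies \<open>h\<close> by \<open>\<i> * p\<close>.\<close>

lemma wdiff_ft: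
  fixes h :: "real \<Rightarrow> complex"
  assumes "h \<in> borel_measurable borel" "L1 (\<lambda>p. (1 + \<bar>p\<bar>) ^ m * norm (h p))"
  shows "wdiff m (ft h)"
  using assms
proof (induction m arbitrary: h)
  case 0
  have "L1 h" by (rule integrable_of_weighted[OF 0])
  then show ?case unfolding wdiff.simps wiener_algebra_iff by blast
next
  case (Suc m)
  note [measurable] = Suc.prems(1)
  have h: "L1 h" using integrable_of_weighted Suc.prems by blast
  have w: "L1 (\<lambda>p. (1 + \<bar>p\<bar>) ^ m * norm (\<i> * (complex_of_real p * h p)))"
  proof (rule integrable_weighted_mono[OF _ Suc.prems(2)])
    fix p :: real
    have "\<bar>p\<bar> * ((1 + \<bar>p\<bar>) ^ m * norm (h p)) \<le> (1 + \<bar>p\<bar>) * ((1 + \<bar>p\<bar>) ^ m * norm (h p))"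
      by (intro mult_right_mono) auto
    then show "(1 + \<bar>p\<bar>) ^ m * norm (\<i> * (complex_of_real p * h p)) \<le> (1 + \<bar>p\<bar>) ^ Suc m * norm (h p)"
      by (simp add: norm_mult mult_ac)
  qed measurable
  have w': "wdiff m (ft (\<lambda>p. \<i> * (complex_of_real p * h p)))" by (rule Suc.IH[OF _ w]) measurable
  have "L1 (\<lambda>p. \<i> * (complex_of_real p * h p))" by (rule integrable_of_weighted[OF _ w]) measurable
  then have h': "L1 (\<lambda>p. complex_of_real p * h p)"
    using integrable_mult_right[of "- \<i>" lborel "\<lambda>p. \<i> * (complex_of_real p * h p)"] by (simp add: mult.assoc[symmetric])
  show ?case unfolding wdiff.simps wiener_algebra_iff using ft_has_vector_derivative[OF h h'] w' h by blast
qed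

text \<open>The difference quotient at 0 of a single exponential is a transform; superposing over
  \<open>p\<close> gives the same for difference quotients of transforms.\<close>

lemma exp_i_minus_1_eq_ft:
  assumes p: "p \<ge> 0"
  shows "iexp (k * p) - 1 = \<i> * complex_of_real k * ft (\<lambda>s. complex_of_real (indicator {0..p} s)) k"
proof -
  have s: "set_integrable lborel {0..p} (\<lambda>s. \<i> * complex_of_real k * iexp (s * k))"
    by (intro borel_integrable_atLeastAtMost') (intro continuous_intros)
  have "\<i> * complex_of_real k * ft (\<lambda>s. complex_of_real (indicator {0..p} s)) k
      = (LINT s|lborel. indicator {0..p} s *\<^sub>R (\<i> * complex_of_real k * iexp (s * k)))"
    unfolding ft_def by (subst integral_mult_right_zero[symmetric], intro LINT_cong)
      (auto simp: indicator_def mult_ac)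
  also have "\<dots> = integral {0..p} (\<lambda>s. \<i> * complex_of_real k * iexp (s * k))"
    using set_borel_integral_eq_integral(2)[OF s] unfolding set_lebesgue_integral_def .
  also have "\<dots> = iexp (p * k) - iexp (0 * k)"
    by (intro integral_unique fundamental_theorem_of_calculus p has_vector_derivative_at_within[OF has_vector_derivative_exp_i])
  finally show ?thesis by (simp add: mult.commute)
qed

text \<open>The integral over \<open>p\<close> of \<open>c p s\<close> is the tail of
  \<open>h\<close> from \<open>s\<close> on, for \<open>s \<ge> 0\<close>. One power is lost because
  integrating the weight \<open>(1 + \<bar>s\<bar>) ^ m\<close> over
  \<open>0 \<le> s \<le> p\<close> gives at most \<open>(1 + \<bar>p\<bar>) ^ Suc m\<close>.\<close>

lemma weighted_tail:
  fixes h :: "real \<Rightarrow> complex"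
  assumes [measurable]: "h \<in> borel_measurable borel" and i: "L1 (\<lambda>p. (1 + \<bar>p\<bar>) ^ Suc m * norm (h p))"
  defines "c \<equiv> \<lambda>p s. h p * complex_of_real (indicator {0..p} s)"
  shows "L1 (\<lambda>s. (1 + \<bar>s\<bar>) ^ m * norm (LINT p|lborel. c p s))"
    and "integrable lborel2 (\<lambda>(p, s). c p s)"
proof -
  have c_eq: "c p s = (if 0 \<le> s \<and> s \<le> p then h p else 0)" for p s unfolding c_def by (auto simp: indicator_def)
  have cm [measurable]: "(\<lambda>(p, s). c p s) \<in> borel_measurable lborel2"
    unfolding c_eq by measurable
  have le: "(LINT s|lborel. (1 + \<bar>s\<bar>) ^ m * norm (c p s)) \<le> (1 + \<bar>p\<bar>) ^ Suc m * norm (h p)"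
    and int: "L1 (\<lambda>s. (1 + \<bar>s\<bar>) ^ m * norm (c p s))" for p
  proof -
    have bi: "L1 (\<lambda>s. (1 + \<bar>p\<bar>) ^ m * norm (h p) * indicator {0..p} s)"
      by (intro integrable_mult_right integrable_real_indicator) (auto simp: emeasure_lborel_Icc_eq)
    have b: "(1 + \<bar>s\<bar>) ^ m * norm (c p s) \<le> (1 + \<bar>p\<bar>) ^ m * norm (h p) * indicator {0..p} s" for s
    proof (cases "s \<in> {0..p}")
      case True
      then have "(1 + \<bar>s\<bar>) ^ m \<le> (1 + \<bar>p\<bar>) ^ m" by (intro power_mono) auto
      then show ?thesis using True by (simp add: c_eq norm_mult mult_right_mono)
    qed (auto simp: c_eq)
    show ii: "L1 (\<lambda>s. (1 + \<bar>s\<bar>) ^ m * norm (c p s))"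
    proof (rule L1_dominated[OF bi])
      show "(\<lambda>s. (1 + \<bar>s\<bar>) ^ m * norm (c p s)) \<in> borel_measurable lborel" unfolding c_eq by measurable
      show "AE s in lborel. norm ((1 + \<bar>s\<bar>) ^ m * norm (c p s)) \<le> norm ((1 + \<bar>p\<bar>) ^ m * norm (h p) * indicator {0..p} s)"
        using b by (auto simp: abs_mult)
    qed
    have "(LINT s|lborel. (1 + \<bar>s\<bar>) ^ m * norm (c p s)) \<le> (LINT s|lborel. (1 + \<bar>p\<bar>) ^ m * norm (h p) * indicator {0..p} s)"
      by (intro integral_mono ii bi b)
    also have "\<dots> = (1 + \<bar>p\<bar>) ^ m * norm (h p) * max 0 p"
      by (simp add: measure_def emeasure_lborel_Icc_eq max_def)
    also have "\<dots> \<le> (1 + \<bar>p\<bar>) ^ m * norm (h p) * (1 + \<bar>p\<bar>)" by (intro mult_left_mono) auto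
    finally show "(LINT s|lborel. (1 + \<bar>s\<bar>) ^ m * norm (c p s)) \<le> (1 + \<bar>p\<bar>) ^ Suc m * norm (h p)"
      by (simp add: mult_ac)
  qed
  show "L1 (\<lambda>s. (1 + \<bar>s\<bar>) ^ m * norm (LINT p|lborel. c p s))"
    by (rule integrable_weighted_superposition[OF cm int i le])
  show "integrable lborel2 (\<lambda>(p, s). c p s)"
  proof (rule pair_integrableI[OF cm _ i])
    show ic: "L1 (c p)" for p
      by (rule integrable_of_weighted[OF _ int[of p]]) (simp add: c_eq[abs_def])
    show "(LINT s|lborel. norm (c p s)) \<le> (1 + \<bar>p\<bar>) ^ Suc m * norm (h p)" for p
    proof (rule order_trans[OF integral_mono le[of p]])
      show "norm (c p s) \<le> (1 + \<bar>s\<bar>) ^ m * norm (c p s)" for s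
        using mult_right_mono[of 1 "(1 + \<bar>s\<bar>) ^ m" "norm (c p s)"] by (simp add: one_le_power)
    qed (use ic int in auto)
  qed
qed

text \<open>The difference quotient at 0 is the transform of \<open>\<i>\<close> times the tail
  integral of \<open>h\<close>, hence the weight \<open>m + 1\<close> in the assumption. The support
  in \<open>p \<ge> 0\<close> leaves only the right tail.\<close>

lemma wquot_ft:
  fixes h :: "real \<Rightarrow> complex"
  assumes [measurable]: "h \<in> borel_measurable borel" and i: "L1 (\<lambda>p. (1 + \<bar>p\<bar>) ^ Suc m * norm (h p))"
    and supp: "\<And>p. p < 0 \<Longrightarrow> h p = 0"
  shows "wquot m 0 (ft h)"
proof -
  define c where "c p s = \<i> * h p * complex_of_real (indicator {0..p} s)" for p s :: real
  have "L1 (\<lambda>p. (1 + \<bar>p\<bar>) ^ Suc m * norm (\<i> * h p))" using i by (simp add: norm_mult)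
  note t = weighted_tail[OF _ this, folded c_def]
  have hi: "L1 h" using integrable_of_weighted[OF _ i] by simp
  have wdF: "wdiff m (ft h)" using wdiff_SucD[OF wdiff_ft[OF _ i]] by simp
  have ci: "integrable lborel2 (\<lambda>(p, s). c p s)" by (rule t(2)) measurable
  define q where "q s = (LINT p|lborel. c p s)" for s
  have [measurable]: "q \<in> borel_measurable borel"
    using borel_measurable_integrable[OF ft_superposition(1)[OF ci]] unfolding q_def[abs_def] by simp
  have "L1 (\<lambda>s. (1 + \<bar>s\<bar>) ^ m * norm (q s))" unfolding q_def by (rule t(1)) measurable
  then have wdQ: "wdiff m (ft q)" by (intro wdiff_ft) auto
  have "ft h k = ft h 0 + complex_of_real k * ft q k" for k
  proof -
    have "complex_of_real k * ft (c p) k = iexp (k * p) * h p - h p" for p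
    proof (cases "p < 0")
      case False
      have "complex_of_real k * ft (c p) k = (\<i> * complex_of_real k * ft (\<lambda>s. complex_of_real (indicator {0..p} s)) k) * h p"
        unfolding c_def ft_cmult by simp
      also have "\<dots> = (iexp (k * p) - 1) * h p"
        using exp_i_minus_1_eq_ft[of p k] False by simp
      finally show ?thesis by (simp add: algebra_simps)
    next
      case True
      then have "c p = (\<lambda>_. 0)" by (auto simp: c_def fun_eq_iff)
      then show ?thesis using True by (simp add: supp ft_def)
    qed
    then have "complex_of_real k * ft q k = (LINT p|lborel. iexp (k * p) * h p - h p)"
      unfolding q_def[abs_def] ft_superposition(2)[OF ci] by (subst integral_mult_right_zero[symmetric]) (simp only:)
    also have "\<dots> = ft h k - ft h 0"
      using Bochner_Integration.integral_diff[OF integrable_exp_i_mult[OF hi, of k] hi] by (simp add: ft_def)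
    finally show ?thesis by simp
  qed
  moreover have "wdiff m (\<lambda>k. ft h k - 0)" using wdF by simp
  ultimately show ?thesis unfolding wquot_def using wdQ by blast
qed

section \<open>Back to the form of the claim\<close>

lemma ext0_eq_of_wquot:
  assumes "wquot m c F" and eq: "\<And>k. k \<noteq> 0 \<Longrightarrow> g k = F k"
  shows "ext0 g = F"
proof -
  have "isCont (\<lambda>k. F k - c) 0"
    using assms(1) wiener_continuous wdiff_wiener unfolding wquot_def by blast
  from continuous_add[OF this continuous_const[of _ c]] have "(F \<longlongrightarrow> F 0) (at 0)" by (simp add: isCont_def)
  then have "(g \<longlongrightarrow> F 0) (at 0)"
    by (rule Lim_transform_eventually) (auto simp: eventually_at_filter eq)
  then have "Lim (at 0) g = F 0" by (intro tendsto_Lim) auto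
  then show ?thesis unfolding ext0_def by (auto simp: eq)
qed

lemma wdiff_derivative_sequence:
  "wdiff m F \<Longrightarrow> \<exists>g. g 0 = F \<and> (\<forall>l<m. \<forall>k. (g l has_vector_derivative g (Suc l) k) (at k)) \<and> (\<forall>l\<le>m. g l \<in> wiener_algebra)"
proof (induction m arbitrary: F)
  case 0
  then show ?case by (intro exI[of _ "\<lambda>_. F"]) auto
next
  case (Suc m)
  then obtain F' where d: "\<And>k. (F has_vector_derivative F' k) (at k)" "wdiff m F'" by auto
  obtain g where g: "g 0 = F'" "\<And>l k. l < m \<Longrightarrow> (g l has_vector_derivative g (Suc l) k) (at k)" "\<And>l. l \<le> m \<Longrightarrow> g l \<in> wiener_algebra"
    using Suc.IH[OF d(2)] by blast
  show ?case
  proof (intro exI[of _ "case_nat F g"] conjI allI impI)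
    show "(case l of 0 \<Rightarrow> F | Suc x \<Rightarrow> g x) \<in> wiener_algebra" if "l \<le> Suc m" for l
      using that g wdiff_wiener[OF Suc.prems] by (cases l) auto
    show "((case l of 0 \<Rightarrow> F | Suc x \<Rightarrow> g x) has_vector_derivative (case Suc l of 0 \<Rightarrow> F | Suc x \<Rightarrow> g x) k) (at k)" if "l < Suc m" for l k
      using that g d by (cases l) auto
  qed simp
qed

lemma diff_quot_of_wquot:
  assumes "wquot (j - 1) c F"
  shows "diff_quot_derivs_in_wiener j F"
proof -
  obtain Q where Q: "wdiff (j - 1) Q" "\<And>k. F k = F 0 + complex_of_real k * Q k"
    using assms unfolding wquot_def by blast
  obtain g where g: "g 0 = Q" "\<And>l k. l < j - 1 \<Longrightarrow> (g l has_vector_derivative g (Suc l) k) (at k)" "\<And>l. l \<le> j - 1 \<Longrightarrow> g l \<in> wiener_algebra"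
    using wdiff_derivative_sequence[OF Q(1)] by blast
  have "Q k = (F k - F 0) / complex_of_real k" if "k \<noteq> 0" for k
    using Q(2)[of k] that by (simp add: field_simps)
  then show ?thesis unfolding diff_quot_derivs_in_wiener_def using g by (intro exI[of _ g]) auto
qed

section \<open>Absolutely continuous functions on the half-line\<close>

text \<open>Absolute continuity is stated through the fundamental theorem with a Lebesgue density:
  the derivative of a Jost solution need not be differentiable everywhere, as \<open>V\<close> is
  only integrable.\<close>

definition abs_cont :: "(real \<Rightarrow> 'a::{real_normed_field, euclidean_space}) \<Rightarrow> (real \<Rightarrow> 'a) \<Rightarrow> bool" where
  "abs_cont F f \<longleftrightarrow> (\<forall>a b. 0 \<le> a \<longrightarrow> a \<le> b \<longrightarrow>
     set_integrable lborel {a..b} f \<and> F b - F a = (LINT t:{a..b}|lborel. f t))"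

lemma acdD:
  assumes "abs_cont F f" "0 \<le> a" "a \<le> b"
  shows "L1 (\<lambda>t. indicator {a..b} t *\<^sub>R f t)"
    and "F b - F a = (LINT t|lborel. indicator {a..b} t *\<^sub>R f t)"
  using assms unfolding abs_cont_def set_integrable_def set_lebesgue_integral_def by auto

lemma abs_cont_add: "abs_cont F f \<Longrightarrow> abs_cont G g \<Longrightarrow> abs_cont (\<lambda>t. F t + G t) (\<lambda>t. f t + g t)"
  unfolding abs_cont_def
proof (intro allI impI conjI)
  fix a b :: real
  assume *: "\<forall>a b. 0 \<le> a \<longrightarrow> a \<le> b \<longrightarrow> set_integrable lborel {a..b} f \<and> F b - F a = (LINT t:{a..b}|lborel. f t)"
    "\<forall>a b. 0 \<le> a \<longrightarrow> a \<le> b \<longrightarrow> set_integrable lborel {a..b} g \<and> G b - G a = (LINT t:{a..b}|lborel. g t)" "0 \<le> a" "a \<le> b"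
  then have i: "set_integrable lborel {a..b} f" "set_integrable lborel {a..b} g" by auto
  then show "set_integrable lborel {a..b} (\<lambda>t. f t + g t)" by (rule set_integral_add)
  have "F b - F a = (LINT t:{a..b}|lborel. f t)" "G b - G a = (LINT t:{a..b}|lborel. g t)" using * by auto
  then show "F b + G b - (F a + G a) = (LINT t:{a..b}|lborel. f t + g t)"
    using set_integral_add(2)[OF i] by (simp add: algebra_simps)
qed

lemma abs_cont_cmult: "abs_cont F f \<Longrightarrow> abs_cont (\<lambda>t. c * F t) (\<lambda>t. c * f t)"
  unfolding abs_cont_def by (auto simp: right_diff_distrib[symmetric] intro!: set_integrable_mult_right)

lemma abs_cont_diff: "abs_cont F f \<Longrightarrow> abs_cont G g \<Longrightarrow> abs_cont (\<lambda>t. F t - G t) (\<lambda>t. f t - g t)"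
  using abs_cont_add[of F f "\<lambda>t. - 1 * G t" "\<lambda>t. - 1 * g t"] abs_cont_cmult[of G g "- 1"] by simp

lemma abs_cont_cong: "abs_cont F f \<Longrightarrow> (\<And>t. t \<ge> 0 \<Longrightarrow> f t = g t) \<Longrightarrow> abs_cont F g"
  unfolding abs_cont_def
proof (intro allI impI)
  fix a b :: real
  assume *: "\<forall>a b. 0 \<le> a \<longrightarrow> a \<le> b \<longrightarrow> set_integrable lborel {a..b} f \<and> F b - F a = (LINT t:{a..b}|lborel. f t)"
    and fg: "\<And>t. t \<ge> 0 \<Longrightarrow> f t = g t" and ab: "0 \<le> a" "a \<le> b"
  have "set_integrable lborel {a..b} f = set_integrable lborel {a..b} g"
    by (rule set_integrable_cong) (use ab fg in auto)
  moreover have "(LINT t:{a..b}|lborel. f t) = (LINT t:{a..b}|lborel. g t)"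
    by (rule set_lebesgue_integral_cong) (use ab fg in auto)
  ultimately show "set_integrable lborel {a..b} g \<and> F b - F a = (LINT t:{a..b}|lborel. g t)"
    using * ab by simp
qed

lemma abs_cont_of_deriv:
  fixes F :: "real \<Rightarrow> 'a::{real_normed_field, euclidean_space}"
  assumes d: "\<And>x. x \<ge> 0 \<Longrightarrow> (F has_vector_derivative f x) (at x)" and c: "\<And>b. continuous_on {0..b} f"
  shows "abs_cont F f"
  unfolding abs_cont_def
proof (intro allI impI conjI)
  fix a b :: real assume ab: "0 \<le> a" "a \<le> b"
  have cab: "continuous_on {a..b} f" by (rule continuous_on_subset[OF c]) (use ab in auto)
  then show s: "set_integrable lborel {a..b} f" by (rule borel_integrable_atLeastAtMost')
  have "(LINT t:{a..b}|lborel. f t) = integral {a..b} f" by (rule set_borel_integral_eq_integral(2)[OF s])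
  also have "\<dots> = F b - F a"
    by (intro integral_unique fundamental_theorem_of_calculus ab) (use ab in \<open>auto intro!: has_vector_derivative_at_within[OF d]\<close>)
  finally show "F b - F a = (LINT t:{a..b}|lborel. f t)" by simp
qed

text \<open>Product rule: the two iterated integrals over the triangles below and above the diagonal add up to the
  integral over the square.\<close>

lemma abs_cont_mult:
  fixes F G :: "real \<Rightarrow> 'a::{real_normed_field, euclidean_space}"
  assumes F: "abs_cont F f" and G: "abs_cont G g"
  shows "abs_cont (\<lambda>t. F t * G t) (\<lambda>t. f t * G t + F t * g t)"
  unfolding abs_cont_def set_integrable_def set_lebesgue_integral_def
proof (intro allI impI)
  fix a b :: real assume ab: "0 \<le> a" "a \<le> b"
  define f' where "f' t = indicator {a..b} t *\<^sub>R f t" for t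
  define g' where "g' t = indicator {a..b} t *\<^sub>R g t" for t
  have fi: "L1 f'" and fI: "F b - F a = integral\<^sup>L lborel f'" using acdD[OF F ab] unfolding f'_def by auto
  have gi: "L1 g'" and gI: "G b - G a = integral\<^sup>L lborel g'" using acdD[OF G ab] unfolding g'_def by auto
  note [measurable] = borel_measurable_integrable[OF fi] borel_measurable_integrable[OF gi]
  have FG: "F t = F a + (LINT s|lborel. (if s \<le> t then f' s else 0))" "G t = G a + (LINT s|lborel. (if s \<le> t then g' s else 0))"
    if "t \<in> {a..b}" for t
  proof -
    have "indicator {a..t} s *\<^sub>R f s = (if s \<le> t then f' s else 0)" "indicator {a..t} s *\<^sub>R g s = (if s \<le> t then g' s else 0)" for s
      using that unfolding f'_def g'_def by (auto simp: indicator_def)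
    then show "F t = F a + (LINT s|lborel. (if s \<le> t then f' s else 0))" "G t = G a + (LINT s|lborel. (if s \<le> t then g' s else 0))"
      using acdD(2)[OF F, of a t] acdD(2)[OF G, of a t] that ab by (auto simp: algebra_simps)
  qed
  have pair: "integrable lborel2 (\<lambda>(t, s). f' t * g' s)"
  proof (rule pair_integrableI)
    show "L1 (\<lambda>t. norm (f' t) * (l1norm g'))" using fi by simp
  qed (use gi in \<open>auto simp: norm_mult\<close>)
  have p1: "integrable lborel2 (\<lambda>(t, s). if s \<le> t then f' t * g' s else 0)"
    by (rule L1_dominated[OF pair]) auto
  have p2: "integrable lborel2 (\<lambda>(t, s). if t \<le> s then f' t * g' s else 0)"
    by (rule L1_dominated[OF pair]) auto
  have e1: "(LINT s|lborel. (if s \<le> t then f' t * g' s else 0)) = f' t * (LINT s|lborel. (if s \<le> t then g' s else 0))" for t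
  proof -
    have "(if s \<le> t then f' t * g' s else 0) = f' t * (if s \<le> t then g' s else 0)" for s by auto
    then show ?thesis by (simp only: integral_mult_right_zero)
  qed
  have e2: "(LINT t|lborel. (if t \<le> s then f' t * g' s else 0)) = (LINT t|lborel. (if t \<le> s then f' t else 0)) * g' s" for s
  proof -
    have "(if t \<le> s then f' t * g' s else 0) = (if t \<le> s then f' t else 0) * g' s" for t by auto
    then show ?thesis by (simp only: integral_mult_left_zero)
  qed
  have i1: "L1 (\<lambda>t. f' t * (LINT s|lborel. (if s \<le> t then g' s else 0)))"
    using lborel_pair.integrable_fst[OF p1] unfolding e1 .
  have i2: "L1 (\<lambda>s. (LINT t|lborel. (if t \<le> s then f' t else 0)) * g' s)"
    using lborel_pair.integrable_snd[OF p2] unfolding e2 .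
  have f'G: "indicator {a..b} t *\<^sub>R (f t * G t) = f' t * G a + f' t * (LINT s|lborel. (if s \<le> t then g' s else 0))" for t
    using FG(2)[of t] by (auto simp: f'_def indicator_def distrib_left)
  have Fg': "indicator {a..b} t *\<^sub>R (F t * g t) = F a * g' t + (LINT s|lborel. (if s \<le> t then f' s else 0)) * g' t" for t
    using FG(1)[of t] by (auto simp: g'_def indicator_def distrib_right)
  have eq: "indicator {a..b} t *\<^sub>R (f t * G t + F t * g t) =
      (f' t * G a + f' t * (LINT s|lborel. (if s \<le> t then g' s else 0))) + (F a * g' t + (LINT s|lborel. (if s \<le> t then f' s else 0)) * g' t)" for t
    using f'G[of t] Fg'[of t] by (simp add: scaleR_add_right)
  have "(LINT t|lborel. f' t * (LINT s|lborel. (if s \<le> t then g' s else 0))) + (LINT s|lborel. (LINT t|lborel. (if t \<le> s then f' t else 0)) * g' s)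
    = (LINT t|lborel. LINT s|lborel. (if s \<le> t then f' t * g' s else 0)) + (LINT t|lborel. LINT s|lborel. (if t \<le> s then f' t * g' s else 0))"
    using lborel_pair.Fubini_integral[OF p2] by (simp only: e1 e2)
  also have "\<dots> = (LINT t|lborel. (LINT s|lborel. (if s \<le> t then f' t * g' s else 0)) + (LINT s|lborel. (if t \<le> s then f' t * g' s else 0)))"
    using lborel_pair.integrable_fst[OF p1] lborel_pair.integrable_fst[OF p2] by simp
  also have "\<dots> = (LINT t|lborel. f' t * integral\<^sup>L lborel g')"
  proof (rule LINT_cong[OF refl])
    fix t :: real
    have ii: "L1 (\<lambda>s. if s \<le> t then f' t * g' s else 0)" "L1 (\<lambda>s. if t \<le> s then f' t * g' s else 0)"
      by (rule L1_dominated[of _ "\<lambda>s. f' t * g' s"]; use gi in \<open>auto\<close>)+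
    have "(LINT s|lborel. (if s \<le> t then f' t * g' s else 0)) + (LINT s|lborel. (if t \<le> s then f' t * g' s else 0))
       = (LINT s|lborel. (if s \<le> t then f' t * g' s else 0) + (if t \<le> s then f' t * g' s else 0))"
      using ii by simp
    also have "\<dots> = (LINT s|lborel. f' t * g' s)"
    proof (rule integral_cong_AE)
      \<comment> \<open>The two triangles overlap only on the diagonal \<open>s = t\<close>, a null
        set.\<close>
      show "AE s in lborel. (if s \<le> t then f' t * g' s else 0) + (if t \<le> s then f' t * g' s else 0) = f' t * g' s"
        using AE_lborel_singleton[of t] by eventually_elim auto
    qed (use ii gi in auto)
    finally show "(LINT s|lborel. (if s \<le> t then f' t * g' s else 0)) + (LINT s|lborel. (if t \<le> s then f' t * g' s else 0))
      = f' t * integral\<^sup>L lborel g'" by simp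
  qed
  also have "\<dots> = (F b - F a) * (G b - G a)" by (simp add: fI gI)
  finally have sum: "(LINT t|lborel. f' t * (LINT s|lborel. (if s \<le> t then g' s else 0))) + (LINT s|lborel. (LINT t|lborel. (if t \<le> s then f' t else 0)) * g' s)
    = (F b - F a) * (G b - G a)" .
  have "L1 (\<lambda>t. indicator {a..b} t *\<^sub>R (f t * G t + F t * g t))"
    unfolding eq using i1 i2 fi gi by simp
  moreover have "(LINT t|lborel. indicator {a..b} t *\<^sub>R (f t * G t + F t * g t)) = F b * G b - F a * G a"
  proof -
    have "(LINT t|lborel. indicator {a..b} t *\<^sub>R (f t * G t + F t * g t))
       = ((F b - F a) * G a + (LINT t|lborel. f' t * (LINT s|lborel. (if s \<le> t then g' s else 0))))
        + (F a * (G b - G a) + (LINT s|lborel. (LINT t|lborel. (if t \<le> s then f' t else 0)) * g' s))"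
      unfolding eq using i1 i2 fi gi by (simp add: fI gI)
    also have "\<dots> = (F b - F a) * G a + F a * (G b - G a) + (F b - F a) * (G b - G a)"
      unfolding sum[symmetric] by (simp only: add_ac)
    finally show ?thesis by (simp add: algebra_simps)
  qed
  ultimately show "L1 (\<lambda>t. indicator {a..b} t *\<^sub>R (f t * G t + F t * g t)) \<and>
    F b * G b - F a * G a = (LINT t|lborel. indicator {a..b} t *\<^sub>R (f t * G t + F t * g t))" by simp
qed

text \<open>Fundamental theorem up to infinity. The Volterra equation and the Wronskian identities
  below are all read off from it, with the boundary term at infinity supplied by the
  asymptotics.\<close>

lemma abs_cont_limit:
  fixes F :: "real \<Rightarrow> 'a::{real_normed_field, euclidean_space}"
  assumes F: "abs_cont F f" and i: "L1 (\<lambda>t. indicator {0..} t *\<^sub>R f t)" and lim: "(F \<longlongrightarrow> L) at_top" and x: "x \<ge> 0"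
  shows "L - F x = (LINT t|lborel. indicator {x..} t *\<^sub>R f t)"
proof (rule tendsto_unique[of at_top "\<lambda>X. F X - F x"])
  show "((\<lambda>X. F X - F x) \<longlongrightarrow> L - F x) at_top" by (intro tendsto_intros lim)
  have ix: "L1 (\<lambda>t. indicator {x..} t *\<^sub>R f t)"
  proof -
    have "L1 (\<lambda>t. indicator {x..} t *\<^sub>R (indicator {0..} t *\<^sub>R f t))"
      by (intro integrable_mult_indicator i) auto
    moreover have "indicator {x..} t *\<^sub>R (indicator {0..} t *\<^sub>R f t) = (indicator {x..} t *\<^sub>R f t)" for t
      using x by (auto simp: indicator_def)
    ultimately show ?thesis by (simp only:)
  qed
  have "((\<lambda>X. LINT t|lborel. indicator {x..X} t *\<^sub>R f t) \<longlongrightarrow> (LINT t|lborel. indicator {x..} t *\<^sub>R f t)) at_top"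
  proof (rule integral_dominated_convergence_at_top)
    show "L1 (\<lambda>t. norm (indicator {x..} t *\<^sub>R f t))" by (rule integrable_norm[OF ix])
    show "(\<lambda>t. indicator {x..} t *\<^sub>R f t) \<in> borel_measurable lborel" using ix by simp
    show "(\<lambda>t. indicator {x..X} t *\<^sub>R f t) \<in> borel_measurable lborel" for X
    proof (cases "x \<le> X")
      case True then show ?thesis using acdD(1)[OF F x] by auto
    qed simp
    show "\<forall>\<^sub>F X in at_top. AE t in lborel. norm (indicator {x..X} t *\<^sub>R f t) \<le> norm (indicator {x..} t *\<^sub>R f t)"
      by (intro always_eventually allI AE_I2) (auto simp: indicator_def)
    show "AE t in lborel. ((\<lambda>X. indicator {x..X} t *\<^sub>R f t) \<longlongrightarrow> indicator {x..} t *\<^sub>R f t) at_top"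
    proof (intro AE_I2 tendsto_eventually)
      fix t
      show "\<forall>\<^sub>F X in at_top. indicator {x..X} t *\<^sub>R f t = indicator {x..} t *\<^sub>R f t"
        using eventually_ge_at_top[of t] by eventually_elim (auto simp: indicator_def)
    qed
  qed
  then show "((\<lambda>X. F X - F x) \<longlongrightarrow> (LINT t|lborel. indicator {x..} t *\<^sub>R f t)) at_top"
  proof (rule Lim_transform_eventually)
    show "\<forall>\<^sub>F X in at_top. (LINT t|lborel. indicator {x..X} t *\<^sub>R f t) = F X - F x"
      using eventually_ge_at_top[of x] by eventually_elim (simp add: acdD(2)[OF F x])
  qed
qed simp

text \<open>For non-integrable \<open>f\<close> the bound rests on the default value 0 of the
  integral; this keeps the kernel estimates free of integrability side conditions.\<close>

lemma norm_integral_le: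
  fixes f :: "'b \<Rightarrow> 'a::{banach, second_countable_topology}"
  assumes w: "integrable M w" and le: "\<And>x. norm (f x) \<le> w x"
  shows "norm (integral\<^sup>L M f) \<le> integral\<^sup>L M w"
proof (cases "integrable M f")
  case True
  have "norm (integral\<^sup>L M f) \<le> (LINT x|M. norm (f x))" by (rule integral_norm_bound)
  also have "\<dots> \<le> integral\<^sup>L M w" using True w le by (intro integral_mono) auto
  finally show ?thesis .
next
  case False
  have "0 \<le> w x" for x using le[of x] norm_ge_zero order_trans by blast
  then show ?thesis using False by (simp add: not_integrable_integral_eq)
qed

section \<open>Tail integrals and their powers\<close>

definition tail :: "(real \<Rightarrow> real) \<Rightarrow> real \<Rightarrow> real" where
  "tail w x = (LINT t|lborel. (if x \<le> t then w t else 0))"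

locale tail_weight =
  fixes w :: "real \<Rightarrow> real"
  assumes w_int: "L1 w" and w_nonneg: "\<And>t. w t \<ge> 0" and w_neg: "\<And>t. t < 0 \<Longrightarrow> w t = 0"
begin

lemma w_meas [measurable]: "w \<in> borel_measurable borel"
  using w_int by auto

lemma int_if: "L1 (\<lambda>t. if x \<le> t then w t else 0)"
  by (rule L1_dominated[OF w_int]) auto

lemma tail_nonneg: "tail w x \<ge> 0"
  unfolding tail_def by (rule integral_nonneg_AE) (auto simp: w_nonneg)

lemma tail_mono: "x \<le> y \<Longrightarrow> tail w y \<le> tail w x"
  unfolding tail_def by (intro integral_mono int_if) (auto simp: w_nonneg)

lemma tail_meas [measurable]: "tail w \<in> borel_measurable borel"
proof -
  have "(\<lambda>x. LINT t|lborel. (if x \<le> t then w t else 0)) \<in> borel_measurable lborel" by measurable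
  then show ?thesis unfolding tail_def[abs_def] by simp
qed

lemma tail_tendsto: "(tail w \<longlongrightarrow> 0) at_top"
proof -
  have "((\<lambda>x. LINT t|lborel. (if x \<le> t then w t else 0)) \<longlongrightarrow> (LINT t|(lborel :: real measure). 0)) at_top"
  proof (rule integral_dominated_convergence_at_top[OF _ _ w_int])
    show "\<forall>\<^sub>F x in at_top. AE t in lborel. norm (if x \<le> t then w t else 0) \<le> w t"
      by (intro always_eventually) (auto simp: w_nonneg)
    show "AE t in lborel. ((\<lambda>x. if x \<le> t then w t else 0) \<longlongrightarrow> 0) at_top"
    proof (intro AE_I2 tendsto_eventually)
      fix t show "\<forall>\<^sub>F x in at_top. (if x \<le> t then w t else 0) = 0"
        using eventually_gt_at_top[of t] by eventually_elim auto
    qed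
  qed measurable
  then show ?thesis unfolding tail_def[abs_def] by simp
qed

lemma abs_cont_tail: "abs_cont (tail w) (\<lambda>t. - w t)"
  unfolding abs_cont_def set_integrable_def set_lebesgue_integral_def
proof (intro allI impI conjI)
  fix a b :: real assume ab: "0 \<le> a" "a \<le> b"
  have i: "L1 (\<lambda>t. indicator {a..b} t *\<^sub>R w t)"
    by (intro integrable_mult_indicator w_int) auto
  then show "L1 (\<lambda>t. indicator {a..b} t *\<^sub>R - w t)" by simp
  have "tail w a = (LINT t|lborel. (if b \<le> t then w t else 0) + indicator {a..b} t *\<^sub>R w t)"
    unfolding tail_def
  proof (rule integral_cong_AE)
    show "AE t in lborel. (if a \<le> t then w t else 0) = (if b \<le> t then w t else 0) + indicator {a..b} t *\<^sub>R w t"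
      using AE_lborel_singleton[of b] by eventually_elim (use ab in \<open>auto simp: indicator_def\<close>)
  qed (auto intro!: borel_measurable_integrable int_if i)
  also have "\<dots> = tail w b + (LINT t|lborel. indicator {a..b} t *\<^sub>R w t)"
    unfolding tail_def using int_if i by (intro LINT_add) auto
  finally show "tail w b - tail w a = (LINT t|lborel. indicator {a..b} t *\<^sub>R - w t)" by simp
qed

lemma abs_cont_tail_power: "abs_cont (\<lambda>x. tail w x ^ Suc n) (\<lambda>t. - (real (Suc n) * (w t * tail w t ^ n)))"
proof (induction n)
  case 0
  then show ?case using abs_cont_tail by simp
next
  case (Suc n)
  show ?case
    using abs_cont_cong[OF abs_cont_mult[OF abs_cont_tail Suc], of "\<lambda>t. - (real (Suc (Suc n)) * (w t * tail w t ^ Suc n))"]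
    by (simp add: algebra_simps)
qed

lemma w_tail_power_integrable: "L1 (\<lambda>t. w t * tail w t ^ n)"
proof (rule L1_dominated)
  show "L1 (\<lambda>t. w t * tail w 0 ^ n)" using w_int by simp
  show "AE t in lborel. norm (w t * tail w t ^ n) \<le> norm (w t * tail w 0 ^ n)"
  proof (intro AE_I2)
    fix t
    show "norm (w t * tail w t ^ n) \<le> norm (w t * tail w 0 ^ n)"
    proof (cases "t < 0")
      case False
      then have "tail w t ^ n \<le> tail w 0 ^ n" by (intro power_mono tail_mono tail_nonneg) auto
      then show ?thesis using w_nonneg[of t] tail_nonneg by (simp add: abs_mult mult_left_mono)
    qed (simp add: w_neg)
  qed
qed measurable

text \<open>\<open>- w * tail w ^ n\<close> is the density of \<open>tail w ^ Suc n / Suc n\<close>.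
  Each Volterra step integrates such a product, and the quotients accumulate to the factorials that
  make the iteration converge.\<close>

lemma tail_power_integral:
  assumes x: "x \<ge> 0"
  shows "(LINT t|lborel. (if x \<le> t then w t * tail w t ^ n else 0)) = tail w x ^ Suc n / real (Suc n)"
proof -
  have "L1 (\<lambda>t. indicator {0..} t *\<^sub>R (w t * tail w t ^ n))"
    by (intro integrable_mult_indicator w_tail_power_integrable) auto
  from integrable_mult_right[OF this, of "- real (Suc n)"]
  have i: "L1 (\<lambda>t. indicator {0..} t *\<^sub>R - (real (Suc n) * (w t * tail w t ^ n)))"
    by (simp add: algebra_simps)
  have "((\<lambda>x. tail w x ^ Suc n) \<longlongrightarrow> 0 ^ Suc n) at_top" by (intro tendsto_power tail_tendsto)
  then have "((\<lambda>x. tail w x ^ Suc n) \<longlongrightarrow> 0) at_top" by simp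
  from abs_cont_limit[OF abs_cont_tail_power i this x]
  have "tail w x ^ Suc n = - (LINT t|lborel. indicator {x..} t *\<^sub>R - (real (Suc n) * (w t * tail w t ^ n)))" by simp
  also have "\<dots> = - (LINT t|lborel. - real (Suc n) * (if x \<le> t then w t * tail w t ^ n else 0))"
    by (intro arg_cong[where f = uminus] LINT_cong) (auto simp: indicator_def simp del: of_nat_Suc)
  also have "\<dots> = real (Suc n) * (LINT t|lborel. (if x \<le> t then w t * tail w t ^ n else 0))"
    by (subst integral_mult_right_zero) (simp only: mult_minus_left minus_minus)
  finally show ?thesis by (simp add: field_simps del: of_nat_Suc power_Suc)
qed

lemma weighted_tail_integrable:
  assumes "L1 (\<lambda>t. (1 + \<bar>t\<bar>) ^ Suc n * w t)"
  shows "L1 (\<lambda>p. if 0 \<le> p then (1 + \<bar>p\<bar>) ^ n * tail w p else 0)"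
proof -
  have "L1 (\<lambda>t. (1 + \<bar>t\<bar>) ^ Suc n * norm (complex_of_real (w t)))"
    using assms by (simp add: w_nonneg)
  note i = weighted_tail(1)[OF _ this]
  have "(LINT t|lborel. complex_of_real (w t) * complex_of_real (indicator {0..t} p)) = complex_of_real (if 0 \<le> p then tail w p else 0)" for p
  proof -
    have "complex_of_real (w t) * complex_of_real (indicator {0..t} p) = complex_of_real (if 0 \<le> p then (if p \<le> t then w t else 0) else 0)" for t
      by (auto simp: indicator_def)
    then show ?thesis unfolding tail_def by (auto simp: integral_complex_of_real)
  qed
  with i have "L1 (\<lambda>p. (1 + \<bar>p\<bar>) ^ n * norm (complex_of_real (if 0 \<le> p then tail w p else 0)))" by simp
  moreover have "(1 + \<bar>p\<bar>) ^ n * norm (complex_of_real (if 0 \<le> p then tail w p else 0)) = (if 0 \<le> p then (1 + \<bar>p\<bar>) ^ n * tail w p else 0)" for p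
    using tail_nonneg[of p] by simp
  ultimately show ?thesis by simp
qed

text \<open>In the Fourier variable the kernels decay like a tail at \<open>p / 2\<close>; the
  rescaling costs only a factor \<open>2 ^ n\<close>.\<close>

lemma weighted_tail_half_integrable:
  assumes "L1 (\<lambda>t. (1 + \<bar>t\<bar>) ^ Suc n * w t)"
  shows "L1 (\<lambda>p. if 0 \<le> p then (1 + \<bar>p\<bar>) ^ n * tail w (p / 2) else 0)"
proof -
  note weighted_tail_integrable[OF assms]
  from lborel_integrable_real_affine[OF this, of "1/2" 0]
  have "L1 (\<lambda>p. if 0 \<le> p then (1 + \<bar>p / 2\<bar>) ^ n * tail w (p / 2) else 0)" by (simp cong: if_cong)
  then have i: "L1 (\<lambda>p. 2 ^ n * (if 0 \<le> p then (1 + \<bar>p / 2\<bar>) ^ n * tail w (p / 2) else 0))"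
    by (intro integrable_mult_right)
  show ?thesis
  proof (rule L1_dominated[OF i])
    show "AE p in lborel. norm (if 0 \<le> p then (1 + \<bar>p\<bar>) ^ n * tail w (p / 2) else 0)
      \<le> norm (2 ^ n * (if 0 \<le> p then (1 + \<bar>p / 2\<bar>) ^ n * tail w (p / 2) else 0))"
    proof (intro AE_I2)
      fix p :: real
      have "(1 + \<bar>p\<bar>) ^ n \<le> 2 ^ n * (1 + \<bar>p / 2\<bar>) ^ n"
        unfolding power_mult_distrib[symmetric] by (intro power_mono) auto
      from mult_right_mono[OF this tail_nonneg[of "p / 2"]]
      have "(1 + \<bar>p\<bar>) ^ n * tail w (p / 2) \<le> 2 ^ n * ((1 + \<bar>p / 2\<bar>) ^ n * tail w (p / 2))"
        by (simp only: mult.assoc)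
      then show "norm (if 0 \<le> p then (1 + \<bar>p\<bar>) ^ n * tail w (p / 2) else 0)
        \<le> norm (2 ^ n * (if 0 \<le> p then (1 + \<bar>p / 2\<bar>) ^ n * tail w (p / 2) else 0))"
        using tail_nonneg[of "p / 2"] by (cases "0 \<le> p") (simp_all add: abs_mult)
    qed
  qed measurable
qed

end

section \<open>The Marchenko kernel\<close>

text \<open>\<open>osc k u\<close> is the integral of \<open>exp (2 i k s)\<close> over \<open>0 \<le> s \<le> u\<close>.\<close>

definition osc :: "real \<Rightarrow> real \<Rightarrow> complex" where
  "osc k u = 1 / 2 * ft (\<lambda>s. complex_of_real (indicator {0..2 * u} s)) k"

lemma integrable_indicator_Icc: "L1 (\<lambda>s::real. complex_of_real (indicator {a..b} s))"
  by (intro integrable_of_real integrable_real_indicator) (auto simp: emeasure_lborel_Icc_eq)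

lemma norm_indicator_Icc: "a \<le> b \<Longrightarrow> (LINT s|lborel. norm (complex_of_real (indicator {a..b} s))) = b - a"
  by (simp add: measure_def)

text \<open>The bound is uniform in \<open>k\<close> and attained at \<open>k = 0\<close>; its price
  is the weight \<open>\<bar>t\<bar>\<close> next to \<open>\<bar>V t\<bar>\<close> in the
  estimates.\<close>

lemma norm_osc_le: "u \<ge> 0 \<Longrightarrow> norm (osc k u) \<le> u"
  using norm_ft_le[OF integrable_indicator_Icc[of 0 "2 * u"], of k] norm_indicator_Icc[of 0 "2 * u"]
  by (simp add: osc_def norm_divide)

lemma measurable_osc [measurable]: "(\<lambda>t. osc k (t - x)) \<in> borel_measurable borel"
proof -
  have e: "complex_of_real (indicator {0..2 * (t - x)} s) = (if 0 \<le> s \<and> s \<le> 2 * (t - x) then 1 else 0)" for t s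
    by (simp add: indicator_def)
  have "(\<lambda>t. LINT s|lborel. iexp (k * s) * (if 0 \<le> s \<and> s \<le> 2 * (t - x) then 1 else 0)) \<in> borel_measurable lborel"
    by measurable
  then show ?thesis unfolding osc_def ft_def e by simp
qed

text \<open>With \<open>m = j - 1\<close> the exponent \<open>m + 2\<close> is \<open>j + 1\<close>.
  The potential is the given one, or its mirror image, set to 0 on the negative half-line.\<close>

locale half_line =
  fixes V :: "real \<Rightarrow> real" and m :: nat
  assumes V_meas [measurable]: "V \<in> borel_measurable borel"
    and V_neg: "\<And>t. t < 0 \<Longrightarrow> V t = 0"
    and V_int: "L1 (\<lambda>t. (1 + \<bar>t\<bar>) ^ (m + 2) * \<bar>V t\<bar>)"
begin

text \<open>\<open>eta\<close> carries the decay of the kernel in its second variable,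
  \<open>Gam\<close> the convergence of the iteration, each step of which contributes a factor
  \<open>\<bar>t\<bar> * \<bar>V t\<bar>\<close>.\<close>

definition eta :: "real \<Rightarrow> real" where "eta = tail (\<lambda>t. \<bar>V t\<bar>)"
definition Gam :: "real \<Rightarrow> real" where "Gam = tail (\<lambda>t. \<bar>t\<bar> * \<bar>V t\<bar>)"

lemma V_int_le:
  assumes "n \<le> m + 2"
  shows "L1 (\<lambda>t. (1 + \<bar>t\<bar>) ^ n * \<bar>V t\<bar>)"
proof (rule L1_dominated[OF V_int])
  show "AE t in lborel. norm ((1 + \<bar>t\<bar>) ^ n * \<bar>V t\<bar>) \<le> norm ((1 + \<bar>t\<bar>) ^ (m + 2) * \<bar>V t\<bar>)"
  proof (intro AE_I2)
    fix t :: real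
    have "(1 + \<bar>t\<bar>) ^ n \<le> (1 + \<bar>t\<bar>) ^ (m + 2)" by (intro power_increasing assms) auto
    from mult_right_mono[OF this, of "\<bar>V t\<bar>"]
    show "norm ((1 + \<bar>t\<bar>) ^ n * \<bar>V t\<bar>) \<le> norm ((1 + \<bar>t\<bar>) ^ (m + 2) * \<bar>V t\<bar>)"
      by (simp add: abs_mult del: power_Suc)
  qed
qed measurable

lemma V_int0: "L1 (\<lambda>t. \<bar>V t\<bar>)"
  using V_int_le[of 0] by simp

lemma weight_tV:
  assumes "n \<le> m + 1"
  shows "L1 (\<lambda>t. (1 + \<bar>t\<bar>) ^ n * (\<bar>t\<bar> * \<bar>V t\<bar>))"
proof (rule L1_dominated[OF V_int_le])
  show "Suc n \<le> m + 2" using assms by simp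
  show "AE t in lborel. norm ((1 + \<bar>t\<bar>) ^ n * (\<bar>t\<bar> * \<bar>V t\<bar>)) \<le> norm ((1 + \<bar>t\<bar>) ^ Suc n * \<bar>V t\<bar>)"
    by (intro AE_I2) (auto simp: abs_mult algebra_simps mult_left_mono)
qed measurable

lemma tV_int: "L1 (\<lambda>t. \<bar>t\<bar> * \<bar>V t\<bar>)"
  using weight_tV[of 0] by simp

sublocale et: tail_weight "\<lambda>t. \<bar>V t\<bar>"
  by unfold_locales (auto simp: V_int0 V_neg)

sublocale ga: tail_weight "\<lambda>t. \<bar>t\<bar> * \<bar>V t\<bar>"
  by unfold_locales (auto simp: tV_int V_neg)

lemma eta_meas [measurable]: "eta \<in> borel_measurable borel"
  unfolding eta_def by (rule et.tail_meas)

lemma Gam_meas [measurable]: "Gam \<in> borel_measurable borel"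
  unfolding Gam_def by (rule ga.tail_meas)

lemma eta_half_int: "n \<le> m + 1 \<Longrightarrow> L1 (\<lambda>p. if 0 \<le> p then (1 + \<bar>p\<bar>) ^ n * eta (p / 2) else 0)"
  unfolding eta_def by (intro et.weighted_tail_half_integrable V_int_le) auto

lemma eta_nonneg: "eta x \<ge> 0" and Gam_nonneg: "Gam x \<ge> 0"
  unfolding eta_def Gam_def by (rule et.tail_nonneg ga.tail_nonneg)+

lemma eta_mono: "x \<le> y \<Longrightarrow> eta y \<le> eta x" and Gam_mono: "x \<le> y \<Longrightarrow> Gam y \<le> Gam x"
  unfolding eta_def Gam_def by (rule et.tail_mono ga.tail_mono; assumption)+

lemma Gam_power_integral:
  "x \<ge> 0 \<Longrightarrow> (LINT t|lborel. (if x \<le> t then \<bar>t\<bar> * \<bar>V t\<bar> * Gam t ^ n else 0)) = Gam x ^ Suc n / real (Suc n)"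
  unfolding Gam_def by (rule ga.tail_power_integral)

lemma Gam_power_int: "L1 (\<lambda>t. if x \<le> t then \<bar>t\<bar> * \<bar>V t\<bar> * Gam t ^ n else 0)"
  by (rule L1_dominated[OF ga.w_tail_power_integrable[of n, folded Gam_def]]) auto

text \<open>The Marchenko kernel \<open>B x y = \<Sum>n. Bn n x y\<close> represents \<open>exp (- i k x) f\<^sub>+ x k - 1\<close> as the Fourier transform of
  \<open>B x\<close>; \<open>Bn n\<close> is the \<open>n\<close>-th successive approximation.\<close>

primrec Bn :: "nat \<Rightarrow> real \<Rightarrow> real \<Rightarrow> real" where
  "Bn 0 x y = (if 0 \<le> y then 1 / 2 * (LINT t|lborel. (if x + y / 2 \<le> t then V t else 0)) else 0)"
| "Bn (Suc n) x y = 1 / 2 * (LINT t|lborel. (if x \<le> t then V t * (LINT s|lborel. (if 0 \<le> s \<and> s \<le> 2 * (t - x) then Bn n t (y - s) else 0)) else 0))"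

section \<open>Estimates of the kernel\<close>

lemma Bn_meas': "(\<lambda>z. Bn n (fst z) (snd z)) \<in> borel_measurable (borel \<Otimes>\<^sub>M borel)"
proof (induction n)
  case 0
  have "(\<lambda>z. if 0 \<le> snd z then 1 / 2 * (LINT t|lborel. (if fst z + snd z / 2 \<le> t then V t else 0)) else 0)
     \<in> borel_measurable (borel \<Otimes>\<^sub>M (borel :: real measure))" by measurable
  then show ?case by simp
next
  case (Suc n)
  have [measurable (raw)]: "f \<in> borel_measurable N \<Longrightarrow> g \<in> borel_measurable N \<Longrightarrow> (\<lambda>z. Bn n (f z) (g z)) \<in> borel_measurable N" for f g N
    using measurable_compose[OF measurable_Pair Suc, of f N g] by simp
  have "(\<lambda>z. 1 / 2 * (LINT t|lborel. (if fst z \<le> t then V t * (LINT s|lborel. (if 0 \<le> s \<and> s \<le> 2 * (t - fst z) then Bn n t (snd z - s) else 0)) else 0)))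
    \<in> borel_measurable (borel \<Otimes>\<^sub>M (borel :: real measure))" by measurable
  then show ?case by simp
qed

lemma Bn_meas [measurable (raw)]:
  "f \<in> borel_measurable N \<Longrightarrow> g \<in> borel_measurable N \<Longrightarrow> (\<lambda>z. Bn n (f z) (g z)) \<in> borel_measurable N"
  using measurable_compose[OF measurable_Pair Bn_meas', of f N g] by simp

lemma Bn_neg: "y < 0 \<Longrightarrow> Bn n x y = 0"
proof (induction n arbitrary: x y)
  case (Suc n)
  have "(if 0 \<le> s \<and> s \<le> 2 * (t - x) then Bn n t (y - s) else 0) = 0" for s t
    using Suc by auto
  then show ?case by (simp cong: if_cong)
qed simp

text \<open>The decay in \<open>y\<close> survives every iteration:
  \<open>0 \<le> s \<le> 2 * (t - x)\<close> implies \<open>t + (y - s) / 2 \<ge> x + y / 2\<close>,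
  so monotonicity pulls \<open>eta (x + y / 2)\<close> out of both integrals. What remains is an
  iterated integral of \<open>\<bar>t\<bar> * \<bar>V t\<bar>\<close>, giving
  \<open>Gam x ^ n / fact n\<close>.\<close>

lemma Bn_bound: "x \<ge> 0 \<Longrightarrow> \<bar>Bn n x y\<bar> \<le> (if 0 \<le> y then 1 / 2 * eta (x + y / 2) * (Gam x ^ n / fact n) else 0)"
proof (induction n arbitrary: x y)
  case 0
  have "norm (LINT t|lborel. (if x + y / 2 \<le> t then V t else 0)) \<le> eta (x + y / 2)"
    unfolding eta_def tail_def by (rule norm_integral_le[OF et.int_if]) auto
  then show ?case by simp
next
  case (Suc n)
  show ?case
  proof (cases "0 \<le> y")
    case True
    define c where "c = 1 / 2 * eta (x + y / 2) / fact n"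
    have c0: "c \<ge> 0" unfolding c_def using eta_nonneg by simp
    have inner: "\<bar>LINT s|lborel. (if 0 \<le> s \<and> s \<le> 2 * (t - x) then Bn n t (y - s) else 0)\<bar> \<le> 2 * \<bar>t\<bar> * (c * Gam t ^ n)" if t: "x \<le> t" for t
    proof -
      have "norm (LINT s|lborel. (if 0 \<le> s \<and> s \<le> 2 * (t - x) then Bn n t (y - s) else 0))
          \<le> (LINT s|lborel. (c * Gam t ^ n) * indicator {0..2 * (t - x)} s)"
      proof (rule norm_integral_le)
        show "L1 (\<lambda>s. (c * Gam t ^ n) * indicator {0..2 * (t - x)} s)"
          by (intro integrable_mult_right integrable_real_indicator) (auto simp: emeasure_lborel_Icc_eq)
        show "norm (if 0 \<le> s \<and> s \<le> 2 * (t - x) then Bn n t (y - s) else 0) \<le> c * Gam t ^ n * indicator {0..2 * (t - x)} s" for s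
        proof (cases "0 \<le> s \<and> s \<le> 2 * (t - x)")
          case s: True
          have "\<bar>Bn n t (y - s)\<bar> \<le> (if 0 \<le> y - s then 1 / 2 * eta (t + (y - s) / 2) * (Gam t ^ n / fact n) else 0)"
            using Suc.IH[of t "y - s"] Suc.prems t by simp
          also have "\<dots> \<le> 1 / 2 * eta (t + (y - s) / 2) * (Gam t ^ n / fact n)" using eta_nonneg Gam_nonneg by simp
          also have "\<dots> \<le> 1 / 2 * eta (x + y / 2) * (Gam t ^ n / fact n)"
            using s Gam_nonneg by (intro mult_right_mono mult_left_mono eta_mono) (auto simp: field_simps)
          finally show ?thesis using s unfolding c_def by simp
        qed (use c0 Gam_nonneg in auto)
      qed
      also have "\<dots> = (c * Gam t ^ n) * (2 * (t - x))" using t by (simp add: measure_def)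
      also have "\<dots> \<le> (c * Gam t ^ n) * (2 * \<bar>t\<bar>)"
        using Suc.prems c0 Gam_nonneg by (intro mult_left_mono) auto
      finally show ?thesis by (simp add: mult_ac)
    qed
    have "norm (LINT t|lborel. (if x \<le> t then V t * (LINT s|lborel. (if 0 \<le> s \<and> s \<le> 2 * (t - x) then Bn n t (y - s) else 0)) else 0))
       \<le> (LINT t|lborel. 2 * c * (if x \<le> t then \<bar>t\<bar> * \<bar>V t\<bar> * Gam t ^ n else 0))"
    proof (rule norm_integral_le)
      show "L1 (\<lambda>t. 2 * c * (if x \<le> t then \<bar>t\<bar> * \<bar>V t\<bar> * Gam t ^ n else 0))"
        by (intro integrable_mult_right Gam_power_int)
      show "norm (if x \<le> t then V t * (LINT s|lborel. (if 0 \<le> s \<and> s \<le> 2 * (t - x) then Bn n t (y - s) else 0)) else 0)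
         \<le> 2 * c * (if x \<le> t then \<bar>t\<bar> * \<bar>V t\<bar> * Gam t ^ n else 0)" for t
        using mult_left_mono[OF inner[of t], of "\<bar>V t\<bar>"] by (simp add: abs_mult mult_ac)
    qed
    also have "\<dots> = 2 * c * (Gam x ^ Suc n / real (Suc n))"
      using Gam_power_integral[OF Suc.prems] by simp
    finally have "\<bar>Bn (Suc n) x y\<bar> \<le> c * (Gam x ^ Suc n / real (Suc n))"
      unfolding Bn.simps real_norm_def by (simp add: abs_mult mult_ac del: power_Suc of_nat_Suc)
    also have "\<dots> = 1 / 2 * eta (x + y / 2) * (Gam x ^ Suc n / fact (Suc n))" unfolding c_def by simp
    finally show ?thesis using True by (simp only: if_True)
  qed (use Bn_neg[of y "Suc n" x] in simp)
qed

lemma eta_shift_int: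
  assumes "x \<ge> 0"
  shows "L1 (\<lambda>y. if 0 \<le> y then eta (x + y / 2) else 0)"
proof (rule L1_dominated[OF eta_half_int[of 0]])
  show "AE y in lborel. norm (if 0 \<le> y then eta (x + y / 2) else 0) \<le> norm (if 0 \<le> y then (1 + \<bar>y\<bar>) ^ 0 * eta (y / 2) else 0)"
    using assms eta_nonneg by (intro AE_I2) (auto intro!: eta_mono)
qed auto

lemma Bn_bound': "x \<ge> 0 \<Longrightarrow> \<bar>Bn n x y\<bar> \<le> 1 / 2 * (Gam x ^ n / fact n) * (if 0 \<le> y then eta (x + y / 2) else 0)"
  using Bn_bound[of x n y] by (simp split: if_splits add: mult_ac)

lemma Bn_integrable:
  assumes x: "x \<ge> 0"
  shows "L1 (Bn n x)"
proof (rule L1_dominated)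
  show "L1 (\<lambda>y. 1 / 2 * (Gam x ^ n / fact n) * (if 0 \<le> y then eta (x + y / 2) else 0))"
    by (intro integrable_mult_right eta_shift_int x)
  show "AE y in lborel. norm (Bn n x y) \<le> norm (1 / 2 * (Gam x ^ n / fact n) * (if 0 \<le> y then eta (x + y / 2) else 0))"
    by (intro AE_I2) (metis Bn_bound'[OF x] abs_ge_self order_trans real_norm_def)
qed measurable

definition Bs :: "real \<Rightarrow> real \<Rightarrow> real" where "Bs x y = (\<Sum>n. Bn n x y)"

lemma summable_Bn: "x \<ge> 0 \<Longrightarrow> summable (\<lambda>n. \<bar>Bn n x y\<bar>)"
  and Bs_bound: "x \<ge> 0 \<Longrightarrow> \<bar>Bs x y\<bar> \<le> exp (Gam x) * (if 0 \<le> y then eta (x + y / 2) else 0)"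
  and Bs_partial: "x \<ge> 0 \<Longrightarrow> \<bar>\<Sum>i<n. Bn i x y\<bar> \<le> exp (Gam x) * (if 0 \<le> y then eta (x + y / 2) else 0)"
proof -
  assume x: "x \<ge> 0"
  define e where "e = (if 0 \<le> y then eta (x + y / 2) else 0)"
  have e0: "e \<ge> 0" unfolding e_def using eta_nonneg by simp
  have s: "(\<lambda>n. 1 / 2 * (Gam x ^ n / fact n) * e) sums (1 / 2 * exp (Gam x) * e)"
    using exp_converges[of "Gam x"] by (intro sums_mult2 sums_mult) (simp add: divide_inverse mult.commute)
  have le: "\<bar>Bn n x y\<bar> \<le> 1 / 2 * (Gam x ^ n / fact n) * e" for n using Bn_bound'[OF x, of n y] unfolding e_def .
  show sm: "summable (\<lambda>n. \<bar>Bn n x y\<bar>)"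
    by (rule summable_comparison_test'[OF sums_summable[OF s], of 0]) (use le in auto)
  have "(\<Sum>n. \<bar>Bn n x y\<bar>) \<le> 1 / 2 * exp (Gam x) * e"
    using suminf_le[OF le sm sums_summable[OF s]] sums_unique[OF s] by simp
  moreover have "1 / 2 * exp (Gam x) * e \<le> exp (Gam x) * e" using e0 by simp
  ultimately have tot: "(\<Sum>n. \<bar>Bn n x y\<bar>) \<le> exp (Gam x) * e" by (rule order_trans)
  show "\<bar>Bs x y\<bar> \<le> exp (Gam x) * (if 0 \<le> y then eta (x + y / 2) else 0)"
    using summable_rabs[OF sm] tot unfolding Bs_def e_def by simp
  have "\<bar>\<Sum>i<n. Bn i x y\<bar> \<le> (\<Sum>i<n. \<bar>Bn i x y\<bar>)" by (rule sum_abs)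
  also have "\<dots> \<le> (\<Sum>n. \<bar>Bn n x y\<bar>)" by (rule sum_le_suminf[OF sm]) auto
  finally show "\<bar>\<Sum>i<n. Bn i x y\<bar> \<le> exp (Gam x) * (if 0 \<le> y then eta (x + y / 2) else 0)"
    using tot unfolding e_def by simp
qed

lemma Bs_meas [measurable (raw)]:
  "f \<in> borel_measurable N \<Longrightarrow> g \<in> borel_measurable N \<Longrightarrow> (\<lambda>z. Bs (f z) (g z)) \<in> borel_measurable N"
  unfolding Bs_def by measurable

lemma Bs_neg: "y < 0 \<Longrightarrow> Bs x y = 0"
  unfolding Bs_def by (simp add: Bn_neg)

lemma Bs_bound0: "x \<ge> 0 \<Longrightarrow> \<bar>Bs x y\<bar> \<le> exp (Gam 0) * (if 0 \<le> y then eta (x + y / 2) else 0)"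
proof -
  assume x: "x \<ge> 0"
  have "exp (Gam x) * (if 0 \<le> y then eta (x + y / 2) else 0) \<le> exp (Gam 0) * (if 0 \<le> y then eta (x + y / 2) else 0)"
    using Gam_mono[OF x] eta_nonneg by (intro mult_right_mono) auto
  with Bs_bound[OF x, of y] show ?thesis by simp
qed

section \<open>Identification through the Volterra equation\<close>

definition neumann :: "nat \<Rightarrow> real \<Rightarrow> real \<Rightarrow> complex" where
  "neumann n x k = ft (\<lambda>y. complex_of_real (Bn n x y)) k"

text \<open>For \<open>k \<noteq> 0\<close> the factor \<open>osc k (t - x)\<close> is
  \<open>(iexp (2 * k * (t - x)) - 1) / (2 * \<i> * k)\<close>, so
  \<open>M x = 1 + volterra k M x\<close> is the integral equation of
  \<open>M x = exp (- i k x) f x\<close>.\<close>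

definition volterra :: "real \<Rightarrow> (real \<Rightarrow> complex) \<Rightarrow> real \<Rightarrow> complex" where
  "volterra k g x = (LINT t|lborel. (if x \<le> t then complex_of_real (V t) * osc k (t - x) * g t else 0))"

text \<open>\<open>Bn 0 x\<close> is a superposition over \<open>t\<close> of indicators of
  \<open>{0..2 * (t - x)}\<close> with weights \<open>V t / 2\<close>, and half the transform of
  such an indicator is \<open>osc k (t - x)\<close>.\<close>

lemma neumann_0:
  assumes x: "x \<ge> 0"
  shows "neumann 0 x k = volterra k (\<lambda>_. 1) x"
    and "L1 (\<lambda>t. if x \<le> t then complex_of_real (V t) * osc k (t - x) else 0)"
proof -
  define c where "c t y = (if x \<le> t then complex_of_real (V t) / 2 * complex_of_real (indicator {0..2 * (t - x)} y) else 0)" for t y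
  have c_eq: "c t y = (if x \<le> t \<and> 0 \<le> y \<and> y \<le> 2 * (t - x) then complex_of_real (V t) / 2 else 0)" for t y
    by (auto simp: c_def indicator_def)
  have ci: "integrable lborel2 (\<lambda>(t, y). c t y)"
  proof (rule pair_integrableI[OF _ _ tV_int])
    show "(\<lambda>(t, y). c t y) \<in> borel_measurable lborel2" unfolding c_eq by measurable
    show "L1 (c t)" for t
      unfolding c_def using integrable_indicator_Icc by (cases "x \<le> t") simp_all
    show "(LINT y|lborel. norm (c t y)) \<le> \<bar>t\<bar> * \<bar>V t\<bar>" for t
    proof (cases "x \<le> t")
      case True
      then have "(LINT y|lborel. norm (c t y)) = \<bar>V t\<bar> / 2 * (2 * (t - x))"
        unfolding c_def using norm_indicator_Icc[of 0 "2 * (t - x)"] by (simp add: norm_mult norm_divide)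
      also have "\<dots> \<le> \<bar>V t\<bar> / 2 * (2 * \<bar>t\<bar>)" using x by (intro mult_left_mono) auto
      finally show ?thesis by (simp add: mult_ac)
    qed (simp add: c_def)
  qed
  have "complex_of_real (Bn 0 x y) = (LINT t|lborel. c t y)" for y
  proof (cases "0 \<le> y")
    case True
    have "complex_of_real (Bn 0 x y) = (LINT t|lborel. complex_of_real (1 / 2 * (if x + y / 2 \<le> t then V t else 0)))"
      using True by (simp add: integral_complex_of_real del: of_real_mult)
    also have "\<dots> = (LINT t|lborel. c t y)"
      using True by (intro LINT_cong) (auto simp: c_eq)
    finally show ?thesis .
  next
    case False
    then show ?thesis by (simp add: c_eq)
  qed
  moreover have e: "ft (c t) k = (if x \<le> t then complex_of_real (V t) * osc k (t - x) else 0)" for t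
  proof (cases "x \<le> t")
    case True
    then show ?thesis unfolding c_def osc_def by (simp only: if_True ft_cmult) simp
  qed (simp add: c_def ft_def)
  ultimately show "neumann 0 x k = volterra k (\<lambda>_. 1) x"
    unfolding neumann_def volterra_def using ft_superposition(2)[OF ci, of k] by (simp only: mult_1_right)
  show "L1 (\<lambda>t. if x \<le> t then complex_of_real (V t) * osc k (t - x) else 0)"
    using ft_superposition(3)[OF ci, of k] unfolding e .
qed

text \<open>The inner integral of \<open>Bn (Suc n)\<close> is a convolution with the indicator of
  \<open>{0..2 * (t - x)}\<close>, so the transform turns one step of the kernel recursion into one
  Volterra step.\<close>

lemma neumann_Suc:
  assumes x: "x \<ge> 0"
  shows "neumann (Suc n) x k = volterra k (\<lambda>t. neumann n t k) x"
    and "L1 (\<lambda>t. if x \<le> t then complex_of_real (V t) * osc k (t - x) * neumann n t k else 0)"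
proof -
  define J where "J t s = complex_of_real (indicator {0..2 * (t - x)} s)" for t s
  have J_eq: "J t s = (if 0 \<le> s \<and> s \<le> 2 * (t - x) then 1 else 0)" for t s by (auto simp: J_def indicator_def)
  have Ji: "L1 (J t)" for t unfolding J_def by (rule integrable_indicator_Icc)
  define c where "c t y = (if x \<le> t then complex_of_real (V t) / 2 * (LINT s|lborel. J t s * complex_of_real (Bn n t (y - s))) else 0)" for t y
  \<comment> \<open>A bound for the L1 norms of \<open>Bn n t\<close> that is uniform in
    \<open>t \<ge> x\<close>, obtained by monotonicity of \<open>eta\<close> and
    \<open>Gam\<close>.\<close>
  define C where "C = 1 / 2 * (Gam 0 ^ n / fact n) * (LINT y|lborel. (if 0 \<le> y then (1 + \<bar>y\<bar>) ^ 0 * eta (y / 2) else 0))"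
  have Bi: "L1 (\<lambda>y. complex_of_real (Bn n t y))" if "x \<le> t" for t
    using Bn_integrable[of t n] that x by (intro integrable_of_real) auto
  have BC: "(LINT y|lborel. norm (complex_of_real (Bn n t y))) \<le> C" if t: "x \<le> t" for t
  proof -
    have "(LINT y|lborel. norm (complex_of_real (Bn n t y))) \<le> (LINT y|lborel. 1 / 2 * (Gam 0 ^ n / fact n) * (if 0 \<le> y then (1 + \<bar>y\<bar>) ^ 0 * eta (y / 2) else 0))"
    proof (rule integral_mono)
      show "L1 (\<lambda>y. 1 / 2 * (Gam 0 ^ n / fact n) * (if 0 \<le> y then (1 + \<bar>y\<bar>) ^ 0 * eta (y / 2) else 0))"
        by (intro integrable_mult_right eta_half_int) simp
      fix y
      have "\<bar>Bn n t y\<bar> \<le> 1 / 2 * (Gam t ^ n / fact n) * (if 0 \<le> y then eta (t + y / 2) else 0)"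
        using Bn_bound'[of t n y] t x by simp
      also have "\<dots> \<le> 1 / 2 * (Gam 0 ^ n / fact n) * (if 0 \<le> y then eta (y / 2) else 0)"
        using t x eta_nonneg Gam_nonneg
        by (intro mult_mono divide_right_mono power_mono Gam_mono) (auto intro!: eta_mono)
      finally show "norm (complex_of_real (Bn n t y)) \<le> 1 / 2 * (Gam 0 ^ n / fact n) * (if 0 \<le> y then (1 + \<bar>y\<bar>) ^ 0 * eta (y / 2) else 0)"
        by (simp only: norm_of_real power_0 mult_1_left)
    qed (rule integrable_norm[OF Bi[OF t]])
    then show ?thesis unfolding C_def by simp
  qed
  have "0 \<le> (LINT y|lborel. norm (complex_of_real (Bn n x y)))" by (rule integral_nonneg_AE) simp
  also have "\<dots> \<le> C" by (rule BC) simp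
  finally have C0: "C \<ge> 0" .
  have ci: "integrable lborel2 (\<lambda>(t, y). c t y)"
  proof (rule pair_integrableI)
    show "(\<lambda>(t, y). c t y) \<in> borel_measurable lborel2" unfolding c_def J_eq by measurable
    show "L1 (c t)" for t
      unfolding c_def using ft_convolution(1)[OF Ji Bi, of t t] by (cases "x \<le> t") simp_all
    show "L1 (\<lambda>t. C * (\<bar>t\<bar> * \<bar>V t\<bar>))" using tV_int by simp
    show "(LINT y|lborel. norm (c t y)) \<le> C * (\<bar>t\<bar> * \<bar>V t\<bar>)" for t
    proof (cases "x \<le> t")
      case True
      have "(LINT y|lborel. norm (c t y)) = \<bar>V t\<bar> / 2 * (LINT y|lborel. norm (LINT s|lborel. J t s * complex_of_real (Bn n t (y - s))))"
        unfolding c_def using True by (simp add: norm_mult norm_divide)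
      also have "\<dots> \<le> \<bar>V t\<bar> / 2 * (2 * (t - x) * C)"
      proof (intro mult_left_mono order_trans[OF ft_convolution(3)[OF Ji Bi[OF True]]] mult_mono BC)
        show "(LINT p|lborel. norm (J t p)) \<le> 2 * (t - x)"
          unfolding J_def using norm_indicator_Icc[of 0 "2 * (t - x)"] True by simp
      qed (use True in \<open>auto intro!: integral_nonneg_AE\<close>)
      also have "\<dots> = (t - x) * (\<bar>V t\<bar> * C)" by simp
      also have "\<dots> \<le> \<bar>t\<bar> * (\<bar>V t\<bar> * C)" using x C0 by (intro mult_right_mono) auto
      finally show ?thesis by (simp add: mult_ac)
    qed (simp add: c_def C0)
  qed
  have "complex_of_real (Bn (Suc n) x y) = (LINT t|lborel. c t y)" for y
  proof -
    have "(if 0 \<le> s \<and> s \<le> 2 * (t - x) then Bn n t (y - s) else 0) = indicator {0..2 * (t - x)} s * Bn n t (y - s)" for s t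
      by (auto simp: indicator_def)
    then have "Bn (Suc n) x y = (LINT t|lborel. 1 / 2 * (if x \<le> t then V t * (LINT s|lborel. indicator {0..2 * (t - x)} s * Bn n t (y - s)) else 0))"
      by (simp only: Bn.simps integral_mult_right_zero)
    then have "complex_of_real (Bn (Suc n) x y)
       = (LINT t|lborel. complex_of_real (1 / 2 * (if x \<le> t then V t * (LINT s|lborel. indicator {0..2 * (t - x)} s * Bn n t (y - s)) else 0)))"
      by (simp only: integral_complex_of_real)
    also have "\<dots> = (LINT t|lborel. c t y)"
      unfolding c_def J_def
      by (intro LINT_cong) (auto simp: integral_complex_of_real simp flip: of_real_mult)
    finally show ?thesis .
  qed
  moreover have e: "ft (c t) k = (if x \<le> t then complex_of_real (V t) * osc k (t - x) * neumann n t k else 0)" for t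
  proof (cases "x \<le> t")
    case True
    then have "ft (c t) k = complex_of_real (V t) / 2 * ft (\<lambda>y. LINT s|lborel. J t s * complex_of_real (Bn n t (y - s))) k"
      unfolding c_def by (simp only: if_True ft_cmult)
    also have "\<dots> = complex_of_real (V t) / 2 * (ft (J t) k * neumann n t k)"
      unfolding neumann_def by (simp only: ft_convolution(2)[OF Ji Bi[OF True]])
    finally show ?thesis using True unfolding osc_def J_def by simp
  qed (simp add: c_def ft_def)
  ultimately show "neumann (Suc n) x k = volterra k (\<lambda>t. neumann n t k) x"
    unfolding neumann_def[of "Suc n"] volterra_def using ft_superposition(2)[OF ci, of k] by (simp only:)
  show "L1 (\<lambda>t. if x \<le> t then complex_of_real (V t) * osc k (t - x) * neumann n t k else 0)"
    using ft_superposition(3)[OF ci, of k] unfolding e .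
qed

lemma neumann_sums:
  assumes x: "x \<ge> 0"
  shows "(\<lambda>n. \<Sum>i<n. neumann i x k) \<longlonglongrightarrow> ft (\<lambda>y. complex_of_real (Bs x y)) k"
proof -
  have "(\<lambda>n. ft (\<lambda>y. complex_of_real (\<Sum>i<n. Bn i x y)) k) \<longlonglongrightarrow> ft (\<lambda>y. complex_of_real (Bs x y)) k"
    unfolding ft_def
  proof (rule integral_dominated_convergence)
    show "L1 (\<lambda>y. exp (Gam x) * (if 0 \<le> y then eta (x + y / 2) else 0))"
      by (intro integrable_mult_right eta_shift_int x)
    show "AE y in lborel. (\<lambda>n. iexp (k * y) * complex_of_real (\<Sum>i<n. Bn i x y)) \<longlonglongrightarrow> iexp (k * y) * complex_of_real (Bs x y)"
      unfolding Bs_def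
      by (intro AE_I2 tendsto_intros summable_LIMSEQ) (rule summable_rabs_cancel[OF summable_Bn[OF x]])
    show "AE y in lborel. norm (iexp (k * y) * complex_of_real (\<Sum>i<n. Bn i x y)) \<le> exp (Gam x) * (if 0 \<le> y then eta (x + y / 2) else 0)" for n
      by (intro AE_I2) (use Bs_partial[OF x] in \<open>simp only: norm_mult norm_exp_i_real norm_of_real mult_1_left\<close>)
  qed measurable
  moreover have "ft (\<lambda>y. complex_of_real (\<Sum>i<n. Bn i x y)) k = (\<Sum>i<n. neumann i x k)" for n
  proof (induction n)
    case (Suc n)
    have "L1 (\<lambda>y. complex_of_real (\<Sum>i<n. Bn i x y))" "L1 (\<lambda>y. complex_of_real (Bn n x y))"
      using Bn_integrable[OF x] by (auto intro!: integrable_of_real)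
    from ft_add[OF this] Suc show ?case by (simp add: neumann_def)
  qed (simp add: ft_def)
  ultimately show ?thesis by simp
qed

text \<open>The remainders satisfy \<open>R (Suc n) x = volterra k (R n) x\<close>. Starting from a
  bounded \<open>M\<close>, they are at most \<open>C * Gam x ^ Suc n / fact (Suc n)\<close> and
  vanish in the limit; the case \<open>n = 0\<close> is the second claim.\<close>

lemma volterra_unique:
  assumes M: "\<And>x. x \<ge> 0 \<Longrightarrow> M x = 1 + volterra k M x" and bd: "\<And>x. x \<ge> 0 \<Longrightarrow> norm (M x) \<le> C"
    and [measurable]: "M \<in> borel_measurable borel" and x: "x \<ge> 0"
  shows "M x = 1 + ft (\<lambda>y. complex_of_real (Bs x y)) k" "norm (M x - 1) \<le> C * Gam x"
proof -
  have C0: "C \<ge> 0" using bd[of 0] norm_ge_zero order_trans by blast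
  have volterra_bound: "norm (volterra k g x) \<le> D * (Gam x ^ Suc n / real (Suc n))"
    if g: "\<And>t. t \<ge> 0 \<Longrightarrow> norm (g t) \<le> D * Gam t ^ n" and x: "x \<ge> 0" for g x D n
  proof -
    have "norm (volterra k g x) \<le> (LINT t|lborel. D * (if x \<le> t then \<bar>t\<bar> * \<bar>V t\<bar> * Gam t ^ n else 0))"
      unfolding volterra_def
    proof (rule norm_integral_le)
      show "L1 (\<lambda>t. D * (if x \<le> t then \<bar>t\<bar> * \<bar>V t\<bar> * Gam t ^ n else 0))"
        by (intro integrable_mult_right Gam_power_int)
      show "norm (if x \<le> t then complex_of_real (V t) * osc k (t - x) * g t else 0) \<le> D * (if x \<le> t then \<bar>t\<bar> * \<bar>V t\<bar> * Gam t ^ n else 0)" for t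
      proof (cases "x \<le> t")
        case True
        have o: "norm (osc k (t - x)) \<le> \<bar>t\<bar>" using norm_osc_le[of "t - x" k] True x by simp
        have "\<bar>V t\<bar> * norm (osc k (t - x)) * norm (g t) \<le> \<bar>V t\<bar> * \<bar>t\<bar> * (D * Gam t ^ n)"
          using True x by (intro mult_mono g o) auto
        then show ?thesis using True by (simp add: norm_mult mult_ac)
      qed simp
    qed
    then show ?thesis using Gam_power_integral[OF x, of n] by simp
  qed
  have Mi: "L1 (\<lambda>t. if x \<le> t then complex_of_real (V t) * osc k (t - x) * M t else 0)" if x: "x \<ge> 0" for x
  proof (rule L1_dominated)
    show "L1 (\<lambda>t. C * (\<bar>t\<bar> * \<bar>V t\<bar>))" using tV_int by simp
    show "AE t in lborel. norm (if x \<le> t then complex_of_real (V t) * osc k (t - x) * M t else 0) \<le> norm (C * (\<bar>t\<bar> * \<bar>V t\<bar>))"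
    proof (intro AE_I2)
      fix t
      show "norm (if x \<le> t then complex_of_real (V t) * osc k (t - x) * M t else 0) \<le> norm (C * (\<bar>t\<bar> * \<bar>V t\<bar>))"
      proof (cases "x \<le> t")
        case True
        have o: "norm (osc k (t - x)) \<le> \<bar>t\<bar>" using norm_osc_le[of "t - x" k] True x by simp
        have "\<bar>V t\<bar> * norm (osc k (t - x)) * norm (M t) \<le> \<bar>V t\<bar> * \<bar>t\<bar> * C"
          using True x by (intro mult_mono bd o) auto
        then show ?thesis using True C0 by (simp add: norm_mult abs_mult mult_ac)
      qed simp
    qed
  qed measurable
  define R where "R n x = M x - 1 - (\<Sum>i<n. neumann i x k)" for n x
  have R: "norm (R n x) \<le> C * Gam x ^ Suc n / fact (Suc n)" if "x \<ge> 0" for n x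
    using that
  proof (induction n arbitrary: x)
    case 0
    have "R 0 x = volterra k M x" unfolding R_def using M[OF 0] by simp
    then show ?case using volterra_bound[of M C 0 x] bd 0 by simp
  next
    case (Suc n)
    have ui: "L1 (\<lambda>t. if x \<le> t then complex_of_real (V t) * osc k (t - x) * neumann i t k else 0)" for i
      by (rule neumann_Suc(2)[OF Suc.prems])
    have "volterra k (R n) x = (LINT t|lborel. (if x \<le> t then complex_of_real (V t) * osc k (t - x) * M t else 0)
        - (if x \<le> t then complex_of_real (V t) * osc k (t - x) else 0)
        - (\<Sum>i<n. (if x \<le> t then complex_of_real (V t) * osc k (t - x) * neumann i t k else 0)))"
      unfolding volterra_def R_def
      by (intro LINT_cong) (auto simp: right_diff_distrib sum_distrib_left)
    also have "\<dots> = volterra k M x - volterra k (\<lambda>_. 1) x - (\<Sum>i<n. volterra k (\<lambda>t. neumann i t k) x)"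
      unfolding volterra_def using Mi[OF Suc.prems] neumann_0(2)[OF Suc.prems] ui by simp
    also have "\<dots> = (M x - 1) - neumann 0 x k - (\<Sum>i<n. neumann (Suc i) x k)"
      using M[OF Suc.prems] neumann_0(1)[OF Suc.prems] neumann_Suc(1)[OF Suc.prems] by simp
    also have "\<dots> = R (Suc n) x" unfolding R_def sum.lessThan_Suc_shift by simp
    finally have eq: "R (Suc n) x = volterra k (R n) x" by simp
    have "norm (volterra k (R n) x) \<le> C / fact (Suc n) * (Gam x ^ Suc (Suc n) / real (Suc (Suc n)))"
      by (rule volterra_bound) (use Suc in \<open>auto simp del: fact_Suc power_Suc\<close>)
    then show ?case unfolding eq by (simp add: mult_ac)
  qed
  have "(\<lambda>n. R n x) \<longlonglongrightarrow> 0"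
  proof (rule Lim_null_comparison)
    show "\<forall>\<^sub>F n in sequentially. norm (R n x) \<le> C * Gam x ^ Suc n / fact (Suc n)" using R[OF x] by simp
    have "(\<lambda>n. Gam x ^ n / fact n) \<longlonglongrightarrow> 0"
      using summable_LIMSEQ_zero[OF summable_exp[of "Gam x"]] by (simp add: divide_inverse mult.commute)
    from tendsto_mult_right_zero[OF LIMSEQ_Suc[OF this], of C]
    show "(\<lambda>n. C * Gam x ^ Suc n / fact (Suc n)) \<longlonglongrightarrow> 0" by simp
  qed
  moreover have "(\<lambda>n. R n x) \<longlonglongrightarrow> M x - 1 - ft (\<lambda>y. complex_of_real (Bs x y)) k"
    unfolding R_def by (intro tendsto_intros neumann_sums x)
  ultimately have "M x - 1 - ft (\<lambda>y. complex_of_real (Bs x y)) k = 0" using LIMSEQ_unique by blast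
  then show "M x = 1 + ft (\<lambda>y. complex_of_real (Bs x y)) k" by (simp add: algebra_simps)
  show "norm (M x - 1) \<le> C * Gam x" using R[OF x, of 0] unfolding R_def by simp
qed

end

section \<open>Jost solutions on the half-line\<close>

lemma mult_mono_swap: "a \<le> c \<Longrightarrow> 0 \<le> v \<Longrightarrow> v * a \<le> c * (v :: real)"
  by (metis mult.commute mult_left_mono)

lemma weighted_integrableI:
  fixes r :: "real \<Rightarrow> real"
  assumes [measurable]: "r \<in> borel_measurable borel" and w: "L1 w"
    and le: "\<And>p. (1 + \<bar>p\<bar>) ^ n * \<bar>r p\<bar> \<le> w p"
  shows "L1 (\<lambda>p. (1 + \<bar>p\<bar>) ^ n * norm (complex_of_real (r p)))"
proof (rule L1_dominated[OF w])
  show "AE p in lborel. norm ((1 + \<bar>p\<bar>) ^ n * norm (complex_of_real (r p))) \<le> norm (w p)"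
    using le by (intro AE_I2) (simp add: abs_mult order_trans[OF _ abs_ge_self])
qed measurable

lemma tendsto_zero_mult_bounded:
  fixes h b :: "real \<Rightarrow> complex"
  assumes "(h \<longlongrightarrow> 0) F" "\<And>x. norm (b x) \<le> K"
  shows "((\<lambda>x. h x * b x) \<longlongrightarrow> 0) F"
proof (rule Lim_null_comparison)
  show "\<forall>\<^sub>F x in F. norm (h x * b x) \<le> norm (h x) * K"
    using assms(2) by (auto simp: norm_mult intro!: always_eventually mult_left_mono)
  show "((\<lambda>x. norm (h x) * K) \<longlongrightarrow> 0) F" using tendsto_mult_left_zero[OF tendsto_norm_zero[OF assms(1)], of K] .
qed

lemma abs_cont_cnj: "abs_cont F f \<Longrightarrow> abs_cont (\<lambda>t. cnj (F t)) (\<lambda>t. cnj (f t))"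
  unfolding abs_cont_def set_integrable_def set_lebesgue_integral_def
proof (intro allI impI)
  fix a b :: real
  assume *: "\<forall>a b. 0 \<le> a \<longrightarrow> a \<le> b \<longrightarrow> L1 (\<lambda>x. indicator {a..b} x *\<^sub>R f x) \<and>
      F b - F a = (LINT x|lborel. indicator {a..b} x *\<^sub>R f x)" and ab: "0 \<le> a" "a \<le> b"
  have e: "indicator {a..b} x *\<^sub>R cnj (f x) = cnj (indicator {a..b} x *\<^sub>R f x)" for x by (simp add: indicator_def)
  have "L1 (\<lambda>x. cnj (indicator {a..b} x *\<^sub>R f x))" using * ab by (intro integrable_cnj) auto
  moreover have "cnj (F b) - cnj (F a) = (LINT x|lborel. cnj (indicator {a..b} x *\<^sub>R f x))"
    using * ab by (simp only: Bochner_Integration.integral_cnj complex_cnj_diff[symmetric])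
  ultimately show "L1 (\<lambda>x. indicator {a..b} x *\<^sub>R cnj (f x)) \<and>
      cnj (F b) - cnj (F a) = (LINT x|lborel. indicator {a..b} x *\<^sub>R cnj (f x))" unfolding e by simp
qed

lemma has_vector_derivative_exp_ik:
  "((\<lambda>t. iexp (k * t)) has_vector_derivative \<i> * k * iexp (k * t)) (at t)"
  using has_vector_derivative_exp_i[of k t] by (simp only: mult.commute[of _ k])

lemma abs_cont_exp: "abs_cont (\<lambda>t. iexp (k * t)) (\<lambda>t. \<i> * k * iexp (k * t))"
  by (rule abs_cont_of_deriv[OF has_vector_derivative_exp_ik]) (intro continuous_intros)

lemma osc_eq:
  assumes "x \<le> t"
  shows "(LINT r|lborel. (if x \<le> r \<and> r \<le> t then iexp (2 * k * (t - r)) else 0)) = osc k (t - x)"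
proof -
  have "(LINT r|lborel. (if x \<le> r \<and> r \<le> t then iexp (2 * k * (t - r)) else 0))
     = \<bar>- 1 / 2\<bar> *\<^sub>R (LINT s|lborel. (if x \<le> t + (- 1 / 2) * s \<and> t + (- 1 / 2) * s \<le> t then iexp (2 * k * (t - (t + (- 1 / 2) * s))) else 0))"
    by (intro lborel_integral_real_affine) auto
  also have "(LINT s|lborel. (if x \<le> t + (- 1 / 2) * s \<and> t + (- 1 / 2) * s \<le> t then iexp (2 * k * (t - (t + (- 1 / 2) * s))) else 0))
     = (LINT s|lborel. iexp (k * s) * complex_of_real (indicator {0..2 * (t - x)} s))"
    by (intro LINT_cong) (auto simp: indicator_def)
  finally show ?thesis by (simp add: osc_def ft_def scaleR_conv_of_real)
qed

section \<open>Solutions normalised at infinity\<close>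

context half_line
begin

text \<open>Differentiability on the whole line, but the equation only on \<open>{0..}\<close>: this
  is what a Jost solution of the full potential still satisfies once \<open>V\<close> has been cut
  off at 0.\<close>

definition jost :: "real \<Rightarrow> (real \<Rightarrow> complex) \<Rightarrow> (real \<Rightarrow> complex) \<Rightarrow> bool" where
  "jost k f df \<longleftrightarrow> (\<forall>x. (f has_vector_derivative df x) (at x)) \<and>
     (\<forall>a b. 0 \<le> a \<longrightarrow> a \<le> b \<longrightarrow> ((\<lambda>t. complex_of_real (V t - k\<^sup>2) * f t) has_integral (df b - df a)) {a..b}) \<and>
     ((\<lambda>x. f x - iexp (k * x)) \<longlongrightarrow> 0) at_top"

lemma jost_bounded:
  assumes "jost k f df"
  obtains C where "C \<ge> 0" "\<And>x. x \<ge> 0 \<Longrightarrow> norm (f x) \<le> C"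
proof -
  have lim: "((\<lambda>x. f x - iexp (k * x)) \<longlongrightarrow> 0) at_top" using assms unfolding jost_def by blast
  obtain N where N: "\<And>x. x \<ge> N \<Longrightarrow> norm (f x - iexp (k * x)) < 1"
    using tendstoD[OF lim, of 1] unfolding eventually_at_top_linorder by auto
  have "continuous_on {0..N} f"
    using assms unfolding jost_def by (intro continuous_at_imp_continuous_on ballI) (auto intro: has_vector_derivative_continuous)
  then have "bounded (f ` {0..N})" by (intro compact_imp_bounded compact_continuous_image) auto
  then obtain B where B: "\<And>x. x \<in> {0..N} \<Longrightarrow> norm (f x) \<le> B" unfolding bounded_iff by blast
  show thesis
  proof (rule that[of "max B 2"])
    fix x :: real assume x: "x \<ge> 0"
    show "norm (f x) \<le> max B 2"
    proof (cases "x \<le> N")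
      case False
      then have "norm (f x - iexp (k * x)) < 1" using N by simp
      then have "norm (f x) < 1 + norm (iexp (k * x))"
        using norm_triangle_ineq2[of "f x" "iexp (k * x)"] by linarith
      then show ?thesis by simp
    qed (use B x in \<open>auto simp: le_max_iff_disj\<close>)
  qed simp
qed

lemma jost_meas: "jost k f df \<Longrightarrow> f \<in> borel_measurable borel"
  unfolding jost_def
  by (intro borel_measurable_continuous_onI continuous_at_imp_continuous_on) (auto intro: has_vector_derivative_continuous)

text \<open>The equation is given by gauge integrals. Boundedness of \<open>f\<close> and
  integrability of \<open>V\<close> make the integrand Lebesgue integrable, so that both integrals
  agree.\<close>

lemma jost_abs_cont:
  assumes j: "jost k f df"
  shows "abs_cont df (\<lambda>t. complex_of_real (V t - k\<^sup>2) * f t)"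
  unfolding abs_cont_def
proof (intro allI impI conjI)
  fix a b :: real assume ab: "0 \<le> a" "a \<le> b"
  obtain C where C: "C \<ge> 0" "\<And>x. x \<ge> 0 \<Longrightarrow> norm (f x) \<le> C" using jost_bounded[OF j] by blast
  note [measurable] = jost_meas[OF j]
  show s: "set_integrable lborel {a..b} (\<lambda>t. complex_of_real (V t - k\<^sup>2) * f t)"
    unfolding set_integrable_def
  proof (rule L1_dominated)
    show "L1 (\<lambda>t. C * \<bar>V t\<bar> + C * k\<^sup>2 * indicator {a..b} t)"
      using V_int0 by (intro L1_add integrable_mult_right integrable_real_indicator) (auto simp: emeasure_lborel_Icc_eq)
    show "AE t in lborel. norm (indicator {a..b} t *\<^sub>R (complex_of_real (V t - k\<^sup>2) * f t)) \<le> norm (C * \<bar>V t\<bar> + C * k\<^sup>2 * indicator {a..b} t)"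
    proof (intro AE_I2)
      fix t
      have "norm (complex_of_real (V t - k\<^sup>2) * f t) \<le> (\<bar>V t\<bar> + k\<^sup>2) * C" if "t \<in> {a..b}"
        unfolding norm_mult norm_of_real using that ab C
        by (intro mult_mono order_trans[OF abs_triangle_ineq4]) auto
      then show "norm (indicator {a..b} t *\<^sub>R (complex_of_real (V t - k\<^sup>2) * f t)) \<le> norm (C * \<bar>V t\<bar> + C * k\<^sup>2 * indicator {a..b} t)"
        using C(1) by (auto simp: indicator_def algebra_simps)
    qed
  qed measurable
  have "(LINT t:{a..b}|lborel. complex_of_real (V t - k\<^sup>2) * f t) = integral {a..b} (\<lambda>t. complex_of_real (V t - k\<^sup>2) * f t)"
    by (rule set_borel_integral_eq_integral(2)[OF s])
  also have "\<dots> = df b - df a" using j ab unfolding jost_def by (intro integral_unique) auto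
  finally show "df b - df a = (LINT t:{a..b}|lborel. complex_of_real (V t - k\<^sup>2) * f t)" by simp
qed

lemma jost_df_continuous:
  assumes j: "jost k f df"
  shows "continuous_on {0..b} df"
proof -
  let ?g = "\<lambda>t. complex_of_real (V t - k\<^sup>2) * f t"
  have hi: "(?g has_integral (df x - df 0)) {0..x}" if "x \<ge> 0" for x using j that unfolding jost_def by auto
  have "continuous_on {0..b} (\<lambda>x. df 0 + integral {0..x} ?g)"
  proof (cases "b \<ge> 0")
    case True
    then show ?thesis using hi[OF True] by (intro continuous_intros indefinite_integral_continuous_1) auto
  qed simp
  then show ?thesis
  proof (rule continuous_on_eq)
    fix x assume "x \<in> {0..b}"
    then show "df 0 + integral {0..x} ?g = df x" using integral_unique[OF hi[of x]] by simp
  qed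
qed

lemma jost_abs_cont_f: "jost k f df \<Longrightarrow> abs_cont f df"
  by (rule abs_cont_of_deriv[OF _ jost_df_continuous]) (auto simp: jost_def)

text \<open>With \<open>g = f - exp (i k x)\<close>: \<open>g'\<close> oscillates little on \<open>[x, x + 1]\<close> for large \<open>x\<close>, so it is close to the
  difference quotient \<open>g (x + 1) - g x\<close>.\<close>

lemma jost_df_asymp:
  assumes j: "jost k f df"
  shows "((\<lambda>x. df x - \<i> * k * iexp (k * x)) \<longlongrightarrow> 0) at_top"
proof (rule tendstoI)
  fix e :: real assume e: "e > 0"
  let ?e = "\<lambda>x. iexp (k * x)"
  define g where "g x = f x - ?e x" for x
  define dg where "dg x = df x - \<i> * k * ?e x" for x
  obtain C where C: "C \<ge> 0" "\<And>x. x \<ge> 0 \<Longrightarrow> norm (f x) \<le> C" using jost_bounded[OF j] by blast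
  have "abs_cont dg (\<lambda>t. complex_of_real (V t - k\<^sup>2) * f t - \<i> * k * (\<i> * k * ?e t))"
    unfolding dg_def by (intro abs_cont_diff jost_abs_cont[OF j] abs_cont_cmult abs_cont_exp)
  then have abs_cont: "abs_cont dg (\<lambda>t. complex_of_real (V t) * f t - complex_of_real (k\<^sup>2) * g t)"
    by (rule abs_cont_cong) (simp add: g_def algebra_simps power2_eq_square)
  have gd: "(g has_vector_derivative dg x) (at x)" for x
    using j has_vector_derivative_exp_ik unfolding g_def dg_def jost_def by (intro has_vector_derivative_diff) auto
  \<comment> \<open>The errors below add up to
    \<open>\<delta> + \<delta> + (\<delta> + k^2 * \<delta>)\<close>, which is
    \<open>e / 2\<close>.\<close>
  define \<delta> where "\<delta> = e / (2 * (3 + k\<^sup>2))"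
  have k2: "3 + k\<^sup>2 > 0" by (simp add: add_pos_nonneg)
  have d: "\<delta> > 0" unfolding \<delta>_def using e k2 by simp
  have "((\<lambda>x. C * eta x) \<longlongrightarrow> C * 0) at_top" unfolding eta_def by (intro tendsto_intros et.tail_tendsto)
  then have ev: "\<forall>\<^sub>F x in at_top. dist (C * eta x) 0 < \<delta>" using d by (intro tendstoD) auto
  have "(g \<longlongrightarrow> 0) at_top" using j unfolding g_def[abs_def] jost_def by blast
  then have "\<forall>\<^sub>F x in at_top. dist (g x) 0 < \<delta>" by (rule tendstoD[OF _ d])
  then obtain N where N: "\<And>x. x \<ge> N \<Longrightarrow> norm (g x) < \<delta>" unfolding eventually_at_top_linorder by auto
  have "\<forall>\<^sub>F x in at_top. C * eta x < \<delta> \<and> x \<ge> N \<and> x \<ge> 0"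
    using ev eventually_ge_at_top[of N] eventually_ge_at_top[of 0] by eventually_elim auto
  then show "\<forall>\<^sub>F x in at_top. dist (df x - \<i> * k * ?e x) 0 < e"
  proof eventually_elim
    case (elim x)
    \<comment> \<open>A bound for the variation of \<open>dg\<close> on \<open>{x..x + 1}\<close>,
      whose density is \<open>V * f - k^2 * g\<close>.\<close>
    define B where "B = C * eta x + k\<^sup>2 * \<delta>"
    have *: "norm (dg y - dg x) \<le> B" if y: "y \<in> {x..x + 1}" for y
    proof -
      have "dg y - dg x = (LINT t|lborel. indicator {x..y} t *\<^sub>R (complex_of_real (V t) * f t - complex_of_real (k\<^sup>2) * g t))"
        by (rule acdD(2)[OF abs_cont]) (use elim y in auto)
      also have "norm \<dots> \<le> (LINT t|lborel. C * (if x \<le> t then \<bar>V t\<bar> else 0) + k\<^sup>2 * \<delta> * indicator {x..x + 1} t)"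
      proof (rule norm_integral_le)
        show "L1 (\<lambda>t. C * (if x \<le> t then \<bar>V t\<bar> else 0) + k\<^sup>2 * \<delta> * indicator {x..x + 1} t)"
          by (intro L1_add integrable_mult_right integrable_real_indicator et.int_if)
             (auto simp: emeasure_lborel_Icc_eq)
        fix t
        show "norm (indicator {x..y} t *\<^sub>R (complex_of_real (V t) * f t - complex_of_real (k\<^sup>2) * g t))
           \<le> C * (if x \<le> t then \<bar>V t\<bar> else 0) + k\<^sup>2 * \<delta> * indicator {x..x + 1} t"
        proof (cases "t \<in> {x..y}")
          case True
          have "norm (complex_of_real (V t) * f t - complex_of_real (k\<^sup>2) * g t) \<le> norm (complex_of_real (V t) * f t) + norm (complex_of_real (k\<^sup>2) * g t)"
            by (rule norm_triangle_ineq4)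
          also have "\<dots> = \<bar>V t\<bar> * norm (f t) + k\<^sup>2 * norm (g t)" by (simp add: norm_mult norm_power)
          also have "\<dots> \<le> \<bar>V t\<bar> * C + k\<^sup>2 * \<delta>"
            using True elim C N[of t] by (intro add_mono mult_left_mono) auto
          finally show ?thesis using True y by (simp add: mult.commute)
        qed (use C d in simp)
      qed
      also have "\<dots> = B"
        unfolding B_def eta_def tail_def
        by (subst LINT_add)
           (auto intro!: integrable_mult_right integrable_real_indicator et.int_if simp: emeasure_lborel_Icc_eq measure_def)
      finally show ?thesis .
    qed
    have "norm (g (x + 1) - g x - (x + 1 - x) *\<^sub>R dg x) \<le> norm (x + 1 - x) * B"
      by (rule vector_differentiable_bound_linearization[where S = "{x..x + 1}"])
         (auto intro: has_vector_derivative_at_within gd * simp: closed_segment_eq_real_ivl)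
    then have "norm (g (x + 1) - g x - dg x) \<le> B" by simp
    then have "norm (dg x) \<le> norm (g (x + 1)) + norm (g x) + B"
      using norm_triangle_ineq4[of "g (x + 1) - g x" "g (x + 1) - g x - dg x"] norm_triangle_ineq4[of "g (x + 1)" "g x"] by simp
    also have "\<dots> < \<delta> + \<delta> + (\<delta> + k\<^sup>2 * \<delta>)"
      using N[of "x + 1"] N[of x] elim unfolding B_def by simp
    also have "\<dots> = (3 + k\<^sup>2) * \<delta>" by (simp add: algebra_simps)
    also have "\<dots> = e / 2" unfolding \<delta>_def using k2 by (simp add: field_simps)
    finally show ?case unfolding dg_def using e by simp
  qed
qed

text \<open>In the combination \<open>exp (i k x) * (f' - i k f)\<close> the terms with
  \<open>k^2\<close> cancel: its density is \<open>exp (i k x) * V * f\<close>, which is integrable,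
  and it vanishes at infinity.\<close>

lemma jost_momentum:
  assumes j: "jost k f df" and x: "x \<ge> 0"
  shows "iexp (k * x) * (df x - \<i> * k * f x)
       = - (LINT t|lborel. (if x \<le> t then iexp (k * t) * complex_of_real (V t) * f t else 0))"
proof -
  let ?e = "\<lambda>x. iexp (k * x)"
  obtain C where C: "C \<ge> 0" "\<And>x. x \<ge> 0 \<Longrightarrow> norm (f x) \<le> C" using jost_bounded[OF j] by blast
  note [measurable] = jost_meas[OF j]
  have "abs_cont (\<lambda>t. ?e t * (df t - \<i> * k * f t))
     (\<lambda>t. \<i> * k * ?e t * (df t - \<i> * k * f t) + ?e t * (complex_of_real (V t - k\<^sup>2) * f t - \<i> * k * df t))"
    by (intro abs_cont_mult abs_cont_diff abs_cont_cmult abs_cont_exp jost_abs_cont[OF j] jost_abs_cont_f[OF j])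
  then have a: "abs_cont (\<lambda>t. ?e t * (df t - \<i> * k * f t)) (\<lambda>t. ?e t * complex_of_real (V t) * f t)"
    by (rule abs_cont_cong) (simp add: algebra_simps power2_eq_square)
  have i: "L1 (\<lambda>t. indicator {0..} t *\<^sub>R (?e t * complex_of_real (V t) * f t))"
  proof (rule L1_dominated)
    show "L1 (\<lambda>t. C * \<bar>V t\<bar>)" using V_int0 by simp
    show "AE t in lborel. norm (indicator {0..} t *\<^sub>R (?e t * complex_of_real (V t) * f t)) \<le> norm (C * \<bar>V t\<bar>)"
      using C by (intro AE_I2) (auto simp: indicator_def norm_mult abs_mult intro!: mult_mono_swap)
  qed measurable
  have "((\<lambda>x. ((df x - \<i> * k * ?e x) - \<i> * k * (f x - ?e x)) * ?e x) \<longlongrightarrow> 0) at_top"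
  proof (rule tendsto_zero_mult_bounded[where K = 1])
    have "((\<lambda>x. (df x - \<i> * k * ?e x) - \<i> * k * (f x - ?e x)) \<longlongrightarrow> 0 - \<i> * k * 0) at_top"
      using j by (intro tendsto_diff jost_df_asymp[OF j] tendsto_mult_left) (simp add: jost_def)
    then show "((\<lambda>x. (df x - \<i> * k * ?e x) - \<i> * k * (f x - ?e x)) \<longlongrightarrow> 0) at_top" by simp
  qed simp
  then have l: "((\<lambda>t. ?e t * (df t - \<i> * k * f t)) \<longlongrightarrow> 0) at_top"
    by (rule Lim_transform_eventually) (auto simp: algebra_simps intro!: always_eventually)
  from abs_cont_limit[OF a i l x] have "?e x * (df x - \<i> * k * f x) = - (LINT t|lborel. indicator {x..} t *\<^sub>R (?e t * complex_of_real (V t) * f t))"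
    by (metis diff_0 minus_minus)
  also have "(LINT t|lborel. indicator {x..} t *\<^sub>R (?e t * complex_of_real (V t) * f t)) = (LINT t|lborel. (if x \<le> t then ?e t * complex_of_real (V t) * f t else 0))"
    by (intro LINT_cong) (auto simp: indicator_def)
  finally show ?thesis .
qed

lemma eta_int: "L1 (\<lambda>r. if 0 \<le> r then eta r else 0)"
  using et.weighted_tail_integrable[of 0, OF V_int_le] unfolding eta_def by (simp only: power_0 mult_1_left)

text \<open>\<open>M' = exp (- 2 i k x) * (exp (i k x) * (f' - i k f))\<close>, whose last factor is
  given by \<open>jost_momentum\<close>. Integrating once more from \<open>x\<close> to infinity and
  exchanging the integrals leaves an inner integral equal to \<open>osc k (t - x)\<close>.\<close>

lemma jost_volterra:
  assumes j: "jost k f df" and x: "x \<ge> 0"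
  defines "M \<equiv> \<lambda>x. exp (- \<i> * complex_of_real (k * x)) * f x"
  shows "M x = 1 + volterra k M x"
proof -
  let ?e = "\<lambda>x. iexp (k * x)"
  let ?n = "\<lambda>x. exp (- \<i> * complex_of_real (k * x))"
  have ne: "?n x * ?e x = 1" for x by (simp add: exp_minus)
  obtain C where C: "C \<ge> 0" "\<And>x. x \<ge> 0 \<Longrightarrow> norm (f x) \<le> C" using jost_bounded[OF j] by blast
  note [measurable] = jost_meas[OF j]
  define q where "q r = (LINT t|lborel. (if r \<le> t then ?e t * complex_of_real (V t) * f t else 0))" for r
  have q_meas [measurable]: "q \<in> borel_measurable borel"
  proof -
    have "(\<lambda>r. LINT t|lborel. (if r \<le> t then ?e t * complex_of_real (V t) * f t else 0)) \<in> borel_measurable lborel" by measurable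
    then show ?thesis unfolding q_def[abs_def] by simp
  qed
  have q_le: "norm (q r) \<le> C * eta r" if "r \<ge> 0" for r
  proof -
    have "norm (q r) \<le> (LINT t|lborel. C * (if r \<le> t then \<bar>V t\<bar> else 0))" unfolding q_def
    proof (rule norm_integral_le)
      show "L1 (\<lambda>t. C * (if r \<le> t then \<bar>V t\<bar> else 0))" by (intro integrable_mult_right et.int_if)
      show "norm (if r \<le> t then ?e t * complex_of_real (V t) * f t else 0) \<le> C * (if r \<le> t then \<bar>V t\<bar> else 0)" for t
        using C that by (auto simp: norm_mult intro!: mult_mono_swap)
    qed
    then show ?thesis unfolding eta_def tail_def by simp
  qed
  have "abs_cont (\<lambda>t. iexp (- k * t) * f t) (\<lambda>t. \<i> * complex_of_real (- k) * iexp (- k * t) * f t + iexp (- k * t) * df t)"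
    by (intro abs_cont_mult abs_cont_exp jost_abs_cont_f[OF j])
  then have "abs_cont M (\<lambda>t. \<i> * complex_of_real (- k) * ?n t * f t + ?n t * df t)"
    unfolding M_def by simp
  then have aM: "abs_cont M (\<lambda>r. - (?n r * ?n r * q r))"
  proof (rule abs_cont_cong)
    fix r :: real assume r: "r \<ge> 0"
    have "- (?n r * ?n r * q r) = ?n r * ?n r * (?e r * (df r - \<i> * k * f r))"
      unfolding q_def jost_momentum[OF j r] by simp
    also have "\<dots> = (?n r * ?e r) * ?n r * (df r - \<i> * k * f r)" by (simp only: mult_ac)
    finally show "\<i> * complex_of_real (- k) * ?n r * f r + ?n r * df r = - (?n r * ?n r * q r)"
      unfolding ne by (simp add: algebra_simps)
  qed
  have iM: "L1 (\<lambda>r. indicator {0..} r *\<^sub>R (- (?n r * ?n r * q r)))"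
  proof (rule L1_dominated)
    show "L1 (\<lambda>r. C * (if 0 \<le> r then eta r else 0))" by (intro integrable_mult_right eta_int)
    show "AE r in lborel. norm (indicator {0..} r *\<^sub>R (- (?n r * ?n r * q r))) \<le> norm (C * (if 0 \<le> r then eta r else 0))"
      using q_le C(1) eta_nonneg by (intro AE_I2) (auto simp: indicator_def norm_mult abs_mult)
  qed measurable
  have lM: "(M \<longlongrightarrow> 1) at_top"
  proof -
    have "((\<lambda>x. (f x - ?e x) * ?n x) \<longlongrightarrow> 0) at_top"
      using j by (intro tendsto_zero_mult_bounded[where K = 1]) (auto simp: jost_def)
    then have "((\<lambda>x. M x - 1) \<longlongrightarrow> 0) at_top"
    proof (rule Lim_transform_eventually)
      have "(f x - ?e x) * ?n x = M x - 1" for x using ne[of x] unfolding M_def by (simp add: algebra_simps)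
      then show "\<forall>\<^sub>F x in at_top. (f x - ?e x) * ?n x = M x - 1" by simp
    qed
    then show ?thesis by (simp add: LIM_zero_iff)
  qed
  \<comment> \<open>The double integral runs over \<open>x \<le> r \<le> t\<close>; the length
    \<open>t - x \<le> \<bar>t\<bar>\<close> of the inner range is paid by the first moment of
    \<open>V\<close>.\<close>
  define c where "c t r = (if x \<le> r \<and> r \<le> t then ?n r * ?n r * (?e t * complex_of_real (V t) * f t) else 0)" for t r
  have ci: "integrable lborel2 (\<lambda>(t, r). c t r)"
  proof (rule pair_integrableI)
    show "(\<lambda>(t, r). c t r) \<in> borel_measurable lborel2" unfolding c_def by measurable
    show "L1 (\<lambda>t. C * (\<bar>t\<bar> * \<bar>V t\<bar>))" using tV_int by simp
    have b: "norm (c t r) \<le> C * \<bar>V t\<bar> * indicator {x..t} r" for t r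
      using C x by (auto simp: c_def norm_mult indicator_def intro!: mult_mono_swap)
    have bi: "L1 (\<lambda>r. C * \<bar>V t\<bar> * indicator {x..t} r)" for t
      by (intro integrable_mult_right integrable_real_indicator) (auto simp: emeasure_lborel_Icc_eq)
    show ii: "L1 (c t)" for t
    proof (rule L1_dominated[OF bi[of t]])
      show "c t \<in> borel_measurable lborel" unfolding c_def by measurable
      show "AE r in lborel. norm (c t r) \<le> norm (C * \<bar>V t\<bar> * indicator {x..t} r)"
        using b C(1) by (intro AE_I2) (metis abs_ge_self order_trans real_norm_def)
    qed
    show "(LINT r|lborel. norm (c t r)) \<le> C * (\<bar>t\<bar> * \<bar>V t\<bar>)" for t
    proof -
      have "(LINT r|lborel. norm (c t r)) \<le> (LINT r|lborel. C * \<bar>V t\<bar> * indicator {x..t} r)"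
        by (intro integral_mono b bi integrable_norm ii)
      also have "\<dots> = C * \<bar>V t\<bar> * max 0 (t - x)"
        by (simp add: measure_def emeasure_lborel_Icc_eq max_def)
      also have "\<dots> \<le> C * \<bar>V t\<bar> * \<bar>t\<bar>" using C x by (intro mult_left_mono) auto
      finally show ?thesis by (simp add: mult_ac)
    qed
  qed
  have "1 - M x = (LINT r|lborel. indicator {x..} r *\<^sub>R (- (?n r * ?n r * q r)))"
    by (rule abs_cont_limit[OF aM iM lM x])
  also have "\<dots> = (LINT r|lborel. - (LINT t|lborel. c t r))"
  proof (rule LINT_cong[OF refl])
    fix r
    show "indicator {x..} r *\<^sub>R (- (?n r * ?n r * q r)) = - (LINT t|lborel. c t r)"
    proof (cases "x \<le> r")
      case True
      have "(LINT t|lborel. c t r) = (LINT t|lborel. ?n r * ?n r * (if r \<le> t then ?e t * complex_of_real (V t) * f t else 0))"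
        unfolding c_def using True by (intro LINT_cong) auto
      then show ?thesis using True unfolding q_def by simp
    qed (simp add: c_def)
  qed
  also have "\<dots> = - (LINT t|lborel. LINT r|lborel. c t r)"
    by (simp add: lborel_pair.Fubini_integral[OF ci])
  also have "(LINT t|lborel. LINT r|lborel. c t r) = volterra k M x"
    unfolding volterra_def
  proof (rule LINT_cong[OF refl])
    fix t
    show "(LINT r|lborel. c t r) = (if x \<le> t then complex_of_real (V t) * osc k (t - x) * M t else 0)"
    proof (cases "x \<le> t")
      case True
      have "?n r * ?n r * ?e t * ?e t = iexp (2 * k * (t - r))" for r
        by (simp add: exp_add[symmetric] algebra_simps)
      moreover have "u = X * n" if "u * d = X" "n * d = 1" for u d X n :: complex
        using that by (auto simp: mult.assoc mult.commute)
      ultimately have E: "?n r * ?n r * ?e t = iexp (2 * k * (t - r)) * ?n t" for r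
        using ne[of t] by blast
      have "c t r = (if x \<le> r \<and> r \<le> t then (?n r * ?n r * ?e t) * (complex_of_real (V t) * f t) else 0)" for r
        unfolding c_def by (simp only: mult.assoc)
      then have "c t r = complex_of_real (V t) * M t * (if x \<le> r \<and> r \<le> t then iexp (2 * k * (t - r)) else 0)" for r
        unfolding E M_def by (auto simp: mult_ac)
      then have "(LINT r|lborel. c t r) = complex_of_real (V t) * M t * osc k (t - x)"
        using osc_eq[OF True, of k] by simp
      then show ?thesis using True by (simp add: mult_ac)
    next
      case False
      then have "c t = (\<lambda>_. 0)" by (auto simp: c_def fun_eq_iff)
      then show ?thesis using False by simp
    qed
  qed
  finally show ?thesis by (simp add: algebra_simps)
qed

text \<open>The second claim is for zero energy, where the decay by \<open>Gam\<close> makes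
  \<open>f - 1\<close> integrable on the half-line.\<close>

lemma jost_representation:
  assumes j: "jost k f df" and x: "x \<ge> 0"
  shows "f x = iexp (k * x) * (1 + ft (\<lambda>y. complex_of_real (Bs x y)) k)"
    and "\<exists>C\<ge>0. \<forall>x\<ge>0. norm (exp (- \<i> * complex_of_real (k * x)) * f x - 1) \<le> C * Gam x \<and> norm (f x) \<le> C"
proof -
  define M where "M = (\<lambda>x. exp (- \<i> * complex_of_real (k * x)) * f x)"
  obtain C where C: "C \<ge> 0" "\<And>x. x \<ge> 0 \<Longrightarrow> norm (f x) \<le> C" using jost_bounded[OF j] by blast
  have [measurable]: "f \<in> borel_measurable borel" using jost_meas[OF j] .
  have V: "M x = 1 + volterra k M x" if "x \<ge> 0" for x unfolding M_def by (rule jost_volterra[OF j that])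
  have b: "norm (M x) \<le> C" if "x \<ge> 0" for x unfolding M_def using C(2)[OF that] by (simp add: norm_mult)
  have m: "M \<in> borel_measurable borel" unfolding M_def by measurable
  have "iexp (k * x) * M x = f x" unfolding M_def by (simp add: exp_minus field_simps)
  with volterra_unique(1)[OF V b m x] show "f x = iexp (k * x) * (1 + ft (\<lambda>y. complex_of_real (Bs x y)) k)"
    by simp
  show "\<exists>C\<ge>0. \<forall>x\<ge>0. norm (exp (- \<i> * complex_of_real (k * x)) * f x - 1) \<le> C * Gam x \<and> norm (f x) \<le> C"
    using volterra_unique(2)[OF V b m] C unfolding M_def by blast
qed

text \<open>The shift by \<open>2 * t\<close> comes from absorbing \<open>exp (2 i k t)\<close> into
  the kernel. Since \<open>t + (p - 2 * t) / 2 = p / 2\<close>, the bound does not depend on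
  \<open>t\<close> and can be integrated against \<open>V\<close>.\<close>

lemma Bs_half_bound:
  assumes "t \<ge> 0"
  shows "\<bar>Bs t (p - 2 * t)\<bar> \<le> exp (Gam 0) * (if 0 \<le> p then eta (p / 2) else 0)"
proof -
  have "\<bar>Bs t (p - 2 * t)\<bar> \<le> exp (Gam 0) * (if 0 \<le> p - 2 * t then eta (t + (p - 2 * t) / 2) else 0)"
    by (rule Bs_bound0[OF assms])
  also have "\<dots> \<le> exp (Gam 0) * (if 0 \<le> p then eta (p / 2) else 0)"
    using assms eta_nonneg by (intro mult_left_mono) (auto simp: field_simps)
  finally show ?thesis .
qed

lemma ft_of_real_at_0: "ft (\<lambda>y. complex_of_real (r y)) 0 \<in> \<real>"
  by (simp add: ft_def integral_complex_of_real)

lemma kernel_weight: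
  assumes "K \<ge> 0"
  shows "L1 (\<lambda>p. (1 + \<bar>p\<bar>) ^ Suc m * (K * (if 0 \<le> p then eta (p / 2) else 0)))"
proof -
  have "L1 (\<lambda>p. K * (if 0 \<le> p then (1 + \<bar>p\<bar>) ^ Suc m * eta (p / 2) else 0))"
    by (intro integrable_mult_right eta_half_int) simp
  moreover have "K * (if 0 \<le> p then (1 + \<bar>p\<bar>) ^ Suc m * eta (p / 2) else 0) = (1 + \<bar>p\<bar>) ^ Suc m * (K * (if 0 \<le> p then eta (p / 2) else 0))" for p
    by simp
  ultimately show ?thesis by (simp only:)
qed

lemma wquot_Bs_0: "wquot m 0 (ft (\<lambda>y. complex_of_real (Bs 0 y)))"
proof (rule wquot_ft)
  show "L1 (\<lambda>p. (1 + \<bar>p\<bar>) ^ Suc m * norm (complex_of_real (Bs 0 p)))"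
  proof (rule weighted_integrableI[OF _ kernel_weight[of "exp (Gam 0)"]])
    show "(1 + \<bar>p\<bar>) ^ Suc m * \<bar>Bs 0 p\<bar> \<le> (1 + \<bar>p\<bar>) ^ Suc m * (exp (Gam 0) * (if 0 \<le> p then eta (p / 2) else 0))" for p
      using Bs_half_bound[of 0 p] by (intro mult_left_mono) auto
  qed simp_all
qed (auto simp: Bs_neg)

text \<open>The kernel of \<open>f' - i k f\<close> at 0: in \<open>jost_momentum\<close> at
  \<open>x = 0\<close>, insert \<open>f t = exp (i k t) * (1 + ft (Bs t) k)\<close>. Then
  \<open>exp (2 i k t)\<close> turns \<open>V t\<close> into \<open>V (p / 2) / 2\<close> and shifts
  \<open>Bs t\<close> by \<open>2 * t\<close>.\<close>

definition Bd :: "real \<Rightarrow> real" where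
  "Bd p = - (V (p / 2) / 2 + (LINT t|lborel. V t * Bs t (p - 2 * t)))"

lemma Bd_meas [measurable]: "Bd \<in> borel_measurable borel"
proof -
  have "(\<lambda>p. - (V (p / 2) / 2 + (LINT t|lborel. V t * Bs t (p - 2 * t)))) \<in> borel_measurable lborel" by measurable
  then show ?thesis unfolding Bd_def[abs_def] by simp
qed

lemma VBs_bound: "\<bar>V t * Bs t (p - 2 * t)\<bar> \<le> \<bar>V t\<bar> * (exp (Gam 0) * (if 0 \<le> p then eta (p / 2) else 0))"
proof (cases "t \<ge> 0")
  case True
  then show ?thesis using Bs_half_bound[OF True, of p] unfolding abs_mult by (intro mult_left_mono) auto
qed (simp add: V_neg)

lemma Bd_bound: "\<bar>Bd p\<bar> \<le> \<bar>V (p / 2)\<bar> + (LINT t|lborel. \<bar>V t\<bar>) * exp (Gam 0) * (if 0 \<le> p then eta (p / 2) else 0)"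
proof -
  have "norm (LINT t|lborel. V t * Bs t (p - 2 * t)) \<le> (LINT t|lborel. \<bar>V t\<bar> * (exp (Gam 0) * (if 0 \<le> p then eta (p / 2) else 0)))"
    using V_int0 VBs_bound by (intro norm_integral_le) auto
  then have "\<bar>LINT t|lborel. V t * Bs t (p - 2 * t)\<bar> \<le> (LINT t|lborel. \<bar>V t\<bar>) * exp (Gam 0) * (if 0 \<le> p then eta (p / 2) else 0)"
    by (simp add: mult.assoc)
  then show ?thesis unfolding Bd_def by linarith
qed

lemma wquot_Bd: "wquot m 0 (ft (\<lambda>y. complex_of_real (Bd y)))"
proof (rule wquot_ft)
  define K where "K = (LINT t|lborel. \<bar>V t\<bar>) * exp (Gam 0)"
  have K: "K \<ge> 0" unfolding K_def by (auto intro!: mult_nonneg_nonneg integral_nonneg_AE)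
  have "L1 (\<lambda>t. (1 + \<bar>t\<bar>) ^ Suc m * \<bar>V t\<bar>)" by (rule V_int_le) simp
  from lborel_integrable_real_affine[OF this, of "1/2" 0]
  have i1: "L1 (\<lambda>p. 2 ^ Suc m * ((1 + \<bar>p / 2\<bar>) ^ Suc m * \<bar>V (p / 2)\<bar>))" by (intro integrable_mult_right) simp
  show "L1 (\<lambda>p. (1 + \<bar>p\<bar>) ^ Suc m * norm (complex_of_real (Bd p)))"
  proof (rule weighted_integrableI[OF _ L1_add[OF i1 kernel_weight[OF K]]])
    show "(1 + \<bar>p\<bar>) ^ Suc m * \<bar>Bd p\<bar> \<le> 2 ^ Suc m * ((1 + \<bar>p / 2\<bar>) ^ Suc m * \<bar>V (p / 2)\<bar>) + (1 + \<bar>p\<bar>) ^ Suc m * (K * (if 0 \<le> p then eta (p / 2) else 0))" for p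
    proof -
      have "(1 + \<bar>p\<bar>) ^ Suc m * \<bar>Bd p\<bar> \<le> (1 + \<bar>p\<bar>) ^ Suc m * (\<bar>V (p / 2)\<bar> + K * (if 0 \<le> p then eta (p / 2) else 0))"
        using Bd_bound[of p] unfolding K_def by (intro mult_left_mono) auto
      also have "\<dots> = (1 + \<bar>p\<bar>) ^ Suc m * \<bar>V (p / 2)\<bar> + (1 + \<bar>p\<bar>) ^ Suc m * (K * (if 0 \<le> p then eta (p / 2) else 0))"
        by (rule distrib_left)
      also have "(1 + \<bar>p\<bar>) ^ Suc m * \<bar>V (p / 2)\<bar> \<le> 2 ^ Suc m * ((1 + \<bar>p / 2\<bar>) ^ Suc m * \<bar>V (p / 2)\<bar>)"
        unfolding mult.assoc[symmetric] power_mult_distrib[symmetric] by (intro mult_right_mono power_mono) auto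
      finally show ?thesis by simp
    qed
  qed measurable
  fix p :: real assume p: "p < 0"
  have "V t * Bs t (p - 2 * t) = 0" for t
    using p V_neg[of t] Bs_neg[of "p - 2 * t" t] by (cases "t < 0") auto
  then have "(LINT t|lborel. V t * Bs t (p - 2 * t)) = 0" by (simp only: integral_zero)
  then show "complex_of_real (Bd p) = 0" using V_neg[of "p / 2"] p unfolding Bd_def by simp
qed simp

lemma jost_momentum_0:
  assumes j: "jost k f df"
  shows "df 0 - \<i> * k * f 0 = ft (\<lambda>y. complex_of_real (Bd y)) k"
proof -
  let ?e = "\<lambda>x. iexp (k * x)"
  define c where "c t p = complex_of_real (V t) * complex_of_real (Bs t (p - 2 * t))" for t p
  have cm [measurable]: "(\<lambda>(t, p). c t p) \<in> borel_measurable lborel2" unfolding c_def by measurable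
  define K where "K = exp (Gam 0) * (LINT p|lborel. (if 0 \<le> p then (1 + \<bar>p\<bar>) ^ 0 * eta (p / 2) else 0))"
  have ci': "L1 (c t)" and cb: "(LINT p|lborel. norm (c t p)) \<le> \<bar>V t\<bar> * K" for t
  proof -
    have bi: "L1 (\<lambda>p. \<bar>V t\<bar> * (exp (Gam 0) * (if 0 \<le> p then (1 + \<bar>p\<bar>) ^ 0 * eta (p / 2) else 0)))"
      by (intro integrable_mult_right eta_half_int) simp
    have b: "norm (c t p) \<le> \<bar>V t\<bar> * (exp (Gam 0) * (if 0 \<le> p then (1 + \<bar>p\<bar>) ^ 0 * eta (p / 2) else 0))" for p
      using VBs_bound[of t p] unfolding c_def norm_mult norm_of_real by (simp only: abs_mult power_0 mult_1_left)
    show "L1 (c t)"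
    proof (rule L1_dominated[OF bi])
      show "c t \<in> borel_measurable lborel" unfolding c_def by measurable
      show "AE p in lborel. norm (c t p) \<le> norm (\<bar>V t\<bar> * (exp (Gam 0) * (if 0 \<le> p then (1 + \<bar>p\<bar>) ^ 0 * eta (p / 2) else 0)))"
        by (intro AE_I2 order_trans[OF b]) (simp only: real_norm_def abs_ge_self)
    qed
    then have "(LINT p|lborel. norm (c t p)) \<le> (LINT p|lborel. \<bar>V t\<bar> * (exp (Gam 0) * (if 0 \<le> p then (1 + \<bar>p\<bar>) ^ 0 * eta (p / 2) else 0)))"
      by (intro integral_mono b bi integrable_norm)
    then show "(LINT p|lborel. norm (c t p)) \<le> \<bar>V t\<bar> * K" unfolding K_def by (simp only: integral_mult_right_zero)
  qed
  have ci: "integrable lborel2 (\<lambda>(t, p). c t p)"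
    by (rule pair_integrableI[OF cm ci' _ cb]) (use V_int0 in simp)
  have ftc: "ft (c t) k = complex_of_real (V t) * (?e (2 * t) * ft (\<lambda>y. complex_of_real (Bs t y)) k)" for t
    unfolding c_def ft_cmult ft_translate[of "\<lambda>y. complex_of_real (Bs t y)"] by simp
  have Vi: "L1 (\<lambda>t. complex_of_real (V t))"
    by (rule L1_dominated[OF V_int0]) auto
  have "L1 (\<lambda>p. complex_of_real (V (p / 2)))"
    using lborel_integrable_real_affine[OF Vi, of "1/2" 0] by simp
  then have Vi2: "L1 (\<lambda>p. complex_of_real (V (p / 2)) / 2)" by simp
  have V2: "ft (\<lambda>p. complex_of_real (V (p / 2)) / 2) k = (LINT t|lborel. ?e (2 * t) * complex_of_real (V t))"
    unfolding ft_def by (subst lborel_integral_real_affine[where c = 2 and t = 0]) (simp_all add: scaleR_conv_of_real)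
  have iV2: "L1 (\<lambda>t. ?e (2 * t) * complex_of_real (V t))"
    by (rule L1_dominated[OF Vi]) (auto simp: norm_mult)
  have "ft (\<lambda>y. complex_of_real (Bd y)) k = ft (\<lambda>p. - 1 * (complex_of_real (V (p / 2)) / 2 + (LINT t|lborel. c t p))) k"
    unfolding Bd_def c_def by (simp add: integral_complex_of_real flip: of_real_mult)
  also have "\<dots> = - (ft (\<lambda>p. complex_of_real (V (p / 2)) / 2) k + ft (\<lambda>p. LINT t|lborel. c t p) k)"
    unfolding ft_cmult ft_add[OF Vi2 ft_superposition(1)[OF ci]] by simp
  also have "\<dots> = - ((LINT t|lborel. ?e (2 * t) * complex_of_real (V t)) + (LINT t|lborel. ft (c t) k))"
    unfolding V2 ft_superposition(2)[OF ci] by simp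
  also have "\<dots> = - (LINT t|lborel. ?e (2 * t) * complex_of_real (V t) + ft (c t) k)"
    by (subst LINT_add[OF iV2 ft_superposition(3)[OF ci]]) simp
  also have "\<dots> = - (LINT t|lborel. (if 0 \<le> t then ?e t * complex_of_real (V t) * f t else 0))"
  proof (intro arg_cong[where f = uminus] LINT_cong refl)
    fix t
    show "?e (2 * t) * complex_of_real (V t) + ft (c t) k = (if 0 \<le> t then ?e t * complex_of_real (V t) * f t else 0)"
    proof (cases "0 \<le> t")
      case True
      have "\<i> * complex_of_real (k * (2 * t)) = \<i> * complex_of_real (k * t) + \<i> * complex_of_real (k * t)" by simp
      then have "?e (2 * t) = ?e t * ?e t" by (simp only: exp_add)
      then show ?thesis using True unfolding ftc jost_representation(1)[OF j True] by (simp add: algebra_simps)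
    qed (simp add: ftc V_neg)
  qed
  also have "\<dots> = df 0 - \<i> * k * f 0" using jost_momentum[OF j, of 0] by simp
  finally show ?thesis by simp
qed

lemma jost_0_eq: "jost k f df \<Longrightarrow> f 0 = 1 + ft (\<lambda>y. complex_of_real (Bs 0 y)) k"
  using jost_representation(1)[of k f df 0] by simp

text \<open>For real \<open>V\<close> and \<open>k\<close> the conjugate of \<open>f\<close> solves
  the same equation, so the Wronskian of \<open>cnj f\<close> and \<open>f\<close> is constant; at
  infinity it is that of the two plane waves.\<close>

lemma jost_wronskian_cnj:
  assumes j: "jost k f df"
  shows "cnj (f 0) * df 0 - f 0 * cnj (df 0) = 2 * \<i> * k"
proof -
  let ?e = "\<lambda>x. iexp (k * x)"
  have "abs_cont (\<lambda>t. cnj (f t) * df t - f t * cnj (df t))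
    (\<lambda>t. (cnj (df t) * df t + cnj (f t) * (complex_of_real (V t - k\<^sup>2) * f t)) - (df t * cnj (df t) + f t * cnj (complex_of_real (V t - k\<^sup>2) * f t)))"
    by (intro abs_cont_diff abs_cont_mult abs_cont_cnj jost_abs_cont[OF j] jost_abs_cont_f[OF j])
  then have a: "abs_cont (\<lambda>t. cnj (f t) * df t - f t * cnj (df t)) (\<lambda>t. 0)"
    by (rule abs_cont_cong) (simp add: algebra_simps)
  define g where "g x = f x - ?e x" for x
  define h where "h x = df x - \<i> * k * ?e x" for x
  have g: "(g \<longlongrightarrow> 0) at_top" using j unfolding g_def[abs_def] jost_def by blast
  have h: "(h \<longlongrightarrow> 0) at_top" unfolding h_def[abs_def] by (rule jost_df_asymp[OF j])
  have gc: "((\<lambda>x. cnj (g x)) \<longlongrightarrow> 0) at_top" and hc: "((\<lambda>x. cnj (h x)) \<longlongrightarrow> 0) at_top"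
    using tendsto_cnj[OF g] tendsto_cnj[OF h] by simp_all
  \<comment> \<open>The Wronskian is expanded in the errors \<open>g\<close> and \<open>h\<close>:
    every term but \<open>2 * \<i> * k\<close> contains an error that tends to 0 next to a bounded
    factor or another error.\<close>
  have "((\<lambda>x. (h x * cnj (?e x) + cnj (g x) * (\<i> * k * ?e x) + cnj (g x) * h x) - (cnj (h x) * ?e x + g x * cnj (\<i> * k * ?e x) + g x * cnj (h x)) + 2 * \<i> * k)
      \<longlongrightarrow> (0 + 0 + 0 * 0) - (0 + 0 + 0 * 0) + 2 * \<i> * k) at_top"
    by (intro tendsto_add tendsto_diff tendsto_const tendsto_mult[OF gc h] tendsto_mult[OF g hc]
        tendsto_zero_mult_bounded[OF h, where K = 1] tendsto_zero_mult_bounded[OF gc, where K = "\<bar>k\<bar>"]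
        tendsto_zero_mult_bounded[OF hc, where K = 1] tendsto_zero_mult_bounded[OF g, where K = "\<bar>k\<bar>"])
       (simp_all add: norm_mult)
  moreover have "(h x * cnj (?e x) + cnj (g x) * (\<i> * k * ?e x) + cnj (g x) * h x) - (cnj (h x) * ?e x + g x * cnj (\<i> * k * ?e x) + g x * cnj (h x)) + 2 * \<i> * k
      = cnj (f x) * df x - f x * cnj (df x)" for x
  proof -
    have "cnj (?e x) * ?e x = 1" using complex_norm_square[of "?e x"] by (simp add: mult.commute)
    moreover have "f x = g x + ?e x" "df x = h x + \<i> * k * ?e x" unfolding g_def h_def by simp_all
    ultimately show ?thesis by (simp add: algebra_simps)
  qed
  ultimately have l: "((\<lambda>t. cnj (f t) * df t - f t * cnj (df t)) \<longlongrightarrow> 2 * \<i> * k) at_top" by simp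
  from abs_cont_limit[OF a _ l, of 0] show ?thesis by simp
qed

text \<open>Low-energy expansion against the zero-energy solution: the derivative of \<open>f0 f' - f0' f - i k exp (i k x)\<close> is
  \<open>- k\<^sup>2 (f0 f - exp (i k x))\<close>, and \<open>f0 f - exp (i k x)\<close> is integrable in \<open>x\<close>.\<close>

lemma jost_low_energy_kernel:
  assumes j0: "jost 0 f0 df0"
  obtains G where "wdiff m (ft G)"
    "\<And>k f df. jost k f df \<Longrightarrow> L1 (\<lambda>x. indicator {0..} x *\<^sub>R (f0 x * f x - iexp (k * x))) \<and>
       (LINT x|lborel. indicator {0..} x *\<^sub>R (f0 x * f x - iexp (k * x))) = ft G k"
proof -
  obtain C where C: "C \<ge> 0" "\<And>x. x \<ge> 0 \<Longrightarrow> norm (f0 x - 1) \<le> C * Gam x" "\<And>x. x \<ge> 0 \<Longrightarrow> norm (f0 x) \<le> C"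
    using jost_representation(2)[OF j0, of 0] by auto
  have f0m [measurable]: "f0 \<in> borel_measurable borel" by (rule jost_meas[OF j0])
  define E where "E = exp (Gam 0)"
  have E: "E > 0" unfolding E_def by simp
  define a where "a p = (if 0 \<le> p then f0 p - 1 else 0)" for p
  have am [measurable]: "a \<in> borel_measurable borel" unfolding a_def by measurable
  have a_le: "norm (a p) \<le> C * (if 0 \<le> p then Gam p else 0)" for p using C(2) by (simp add: a_def)
  \<comment> \<open>By the kernel representation, \<open>f0 * f - exp (i k x)\<close> is
    \<open>exp (i k x) * (f0 - 1)\<close> plus \<open>exp (i k x) * f0 * ft (Bs x) k\<close>.
    Integrated over \<open>x\<close>, the first is the transform of \<open>a\<close> with
    \<open>x\<close> itself as Fourier variable; the second is a superposition of copies of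
    \<open>Bs x\<close> shifted by \<open>x\<close>.\<close>
  define c where "c x p = (if 0 \<le> x then f0 x * complex_of_real (Bs x (p - x)) else 0)" for x p
  have cm [measurable]: "(\<lambda>(p, x). c x p) \<in> borel_measurable lborel2" unfolding c_def by measurable
  have cm': "(\<lambda>x. c x p) \<in> borel_measurable borel" for p unfolding c_def by measurable
  \<comment> \<open>\<open>Bs x (p - x)\<close> vanishes unless \<open>x \<le> p\<close>, and then
    its \<open>eta\<close> factor has the argument \<open>(x + p) / 2\<close>, which is at least
    \<open>p / 2\<close>.\<close>
  have c_le: "norm (c x p) \<le> C * E * (if 0 \<le> p then eta (p / 2) else 0) * indicator {0..p} x" for x p
  proof (cases "0 \<le> x")
    case x: True
    have Bx: "\<bar>Bs x (p - x)\<bar> \<le> E * (if 0 \<le> p then eta (p / 2) else 0) * indicator {0..p} x"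
    proof (cases "x \<le> p")
      case True
      have "\<bar>Bs x (p - x)\<bar> \<le> E * eta (x + (p - x) / 2)" using Bs_bound0[OF x, of "p - x"] True unfolding E_def by simp
      also have "\<dots> \<le> E * eta (p / 2)" using E x True by (intro mult_left_mono eta_mono) (auto simp: field_simps)
      finally show ?thesis using x True by simp
    qed (simp add: Bs_neg)
    have "norm (c x p) = norm (f0 x) * \<bar>Bs x (p - x)\<bar>" using x by (simp add: c_def norm_mult)
    also have "\<dots> \<le> C * (E * (if 0 \<le> p then eta (p / 2) else 0) * indicator {0..p} x)"
      using C x by (intro mult_mono Bx) auto
    finally show ?thesis by (simp only: mult.assoc)
  qed (simp add: c_def C(1) less_imp_le[OF E] eta_nonneg)
  have b_int: "L1 (\<lambda>x. C * E * (if 0 \<le> p then eta (p / 2) else 0) * indicator {0..p} x)" for p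
    by (intro integrable_mult_right integrable_real_indicator) (auto simp: emeasure_lborel_Icc_eq)
  have b_eq: "(LINT x|lborel. C * E * (if 0 \<le> p then eta (p / 2) else 0) * indicator {0..p} x) = C * E * (if 0 \<le> p then p * eta (p / 2) else 0)" for p
    by (simp add: measure_def)
  have c_int: "L1 (\<lambda>x. c x p)" for p
  proof (rule L1_dominated[OF b_int[of p]])
    show "AE x in lborel. norm (c x p) \<le> norm (C * E * (if 0 \<le> p then eta (p / 2) else 0) * indicator {0..p} x)"
      by (intro AE_I2 order_trans[OF c_le]) (simp only: real_norm_def abs_ge_self)
  qed (use cm' in simp)
  have c_norm: "(LINT x|lborel. norm (c x p)) \<le> C * E * (if 0 \<le> p then p * eta (p / 2) else 0)" for p
    unfolding b_eq[symmetric] by (intro integral_mono integrable_norm c_int b_int c_le)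
  \<comment> \<open>The integration over \<open>0 \<le> x \<le> p\<close> produced a factor
    \<open>p\<close>. The tail \<open>eta\<close> has one power of weight more than
    \<open>m\<close>, which pays for it.\<close>
  have w1: "L1 (\<lambda>p. C * E * (if 0 \<le> p then (1 + \<bar>p\<bar>) ^ Suc n * eta (p / 2) else 0))" if "n \<le> m" for n
    using that by (intro integrable_mult_right eta_half_int) simp
  have le1: "(1 + \<bar>p\<bar>) ^ n * (C * E * (if 0 \<le> p then p * eta (p / 2) else 0)) \<le> C * E * (if 0 \<le> p then (1 + \<bar>p\<bar>) ^ Suc n * eta (p / 2) else 0)" for n p
  proof (cases "0 \<le> p")
    case True
    have "C * E * ((1 + \<bar>p\<bar>) ^ n * eta (p / 2)) * p \<le> C * E * ((1 + \<bar>p\<bar>) ^ n * eta (p / 2)) * (1 + \<bar>p\<bar>)"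
      using True C(1) E eta_nonneg by (intro mult_left_mono) auto
    then show ?thesis using True by (simp add: mult_ac)
  qed simp
  have ci: "integrable lborel2 (\<lambda>(p, x). c x p)"
  proof (rule pair_integrableI[OF cm c_int w1[of 0]])
    show "(LINT x|lborel. norm (c x p)) \<le> C * E * (if 0 \<le> p then (1 + \<bar>p\<bar>) ^ Suc 0 * eta (p / 2) else 0)" for p
      using c_norm[of p] le1[of p 0] by simp
  qed simp
  have ci': "integrable lborel2 (\<lambda>(x, p). c x p)"
    using lborel_pair.integrable_product_swap[OF ci] by (simp add: split_beta')
  define G where "G p = a p + (LINT x|lborel. c x p)" for p
  have G2m [measurable]: "(\<lambda>p. LINT x|lborel. c x p) \<in> borel_measurable borel"
    using borel_measurable_integrable[OF ft_superposition(1)[OF ci']] by simp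
  have Gm: "G \<in> borel_measurable borel" unfolding G_def by measurable
  have Gam_w: "L1 (\<lambda>p. C * (if 0 \<le> p then (1 + \<bar>p\<bar>) ^ n * Gam p else 0))" if "n \<le> m" for n
    unfolding Gam_def using that by (intro integrable_mult_right ga.weighted_tail_integrable weight_tV) simp
  have ai: "L1 a"
  proof (rule L1_dominated[OF Gam_w[of 0]])
    show "AE p in lborel. norm (a p) \<le> norm (C * (if 0 \<le> p then (1 + \<bar>p\<bar>) ^ 0 * Gam p else 0))"
      by (intro AE_I2 order_trans[OF a_le]) (simp only: real_norm_def power_0 mult_1_left abs_ge_self)
  qed simp_all
  have "wdiff m (ft G)"
  proof (rule wdiff_ft[OF Gm])
    show "L1 (\<lambda>p. (1 + \<bar>p\<bar>) ^ m * norm (G p))"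
    proof (rule L1_dominated[OF L1_add[OF Gam_w[of m] w1[of m]]])
      show "AE p in lborel. norm ((1 + \<bar>p\<bar>) ^ m * norm (G p))
         \<le> norm (C * (if 0 \<le> p then (1 + \<bar>p\<bar>) ^ m * Gam p else 0) + C * E * (if 0 \<le> p then (1 + \<bar>p\<bar>) ^ Suc m * eta (p / 2) else 0))"
      proof (intro AE_I2)
        fix p :: real
        have "norm (LINT x|lborel. c x p) \<le> C * E * (if 0 \<le> p then p * eta (p / 2) else 0)"
          using integral_norm_bound[of lborel "\<lambda>x. c x p"] c_norm[of p] by linarith
        then have "norm (G p) \<le> C * (if 0 \<le> p then Gam p else 0) + C * E * (if 0 \<le> p then p * eta (p / 2) else 0)"
          unfolding G_def using a_le[of p] norm_triangle_ineq[of "a p" "LINT x|lborel. c x p"] by linarith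
        then have "(1 + \<bar>p\<bar>) ^ m * norm (G p) \<le> (1 + \<bar>p\<bar>) ^ m * (C * (if 0 \<le> p then Gam p else 0) + C * E * (if 0 \<le> p then p * eta (p / 2) else 0))"
          by (intro mult_left_mono) auto
        also have "\<dots> = C * (if 0 \<le> p then (1 + \<bar>p\<bar>) ^ m * Gam p else 0) + (1 + \<bar>p\<bar>) ^ m * (C * E * (if 0 \<le> p then p * eta (p / 2) else 0))"
          by (simp add: distrib_left)
        finally have "(1 + \<bar>p\<bar>) ^ m * norm (G p) \<le> C * (if 0 \<le> p then (1 + \<bar>p\<bar>) ^ m * Gam p else 0) + C * E * (if 0 \<le> p then (1 + \<bar>p\<bar>) ^ Suc m * eta (p / 2) else 0)"
          using le1[of p m] by linarith
        then show "norm ((1 + \<bar>p\<bar>) ^ m * norm (G p))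
         \<le> norm (C * (if 0 \<le> p then (1 + \<bar>p\<bar>) ^ m * Gam p else 0) + C * E * (if 0 \<le> p then (1 + \<bar>p\<bar>) ^ Suc m * eta (p / 2) else 0))"
          by (simp add: abs_mult order_trans[OF _ abs_ge_self] del: power_Suc)
      qed
    qed (use Gm in \<open>simp_all\<close>)
  qed
  moreover have "L1 (\<lambda>x. indicator {0..} x *\<^sub>R (f0 x * f x - iexp (k * x))) \<and>
       (LINT x|lborel. indicator {0..} x *\<^sub>R (f0 x * f x - iexp (k * x))) = ft G k"
    if j: "jost k f df" for k f df
  proof -
    let ?e = "\<lambda>x. iexp (k * x)"
    have ftc: "ft (c x) k = (if 0 \<le> x then f0 x * (?e x * ft (\<lambda>y. complex_of_real (Bs x y)) k) else 0)" for x
    proof (cases "0 \<le> x")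
      case True
      then show ?thesis unfolding c_def by (simp only: if_True ft_cmult ft_translate[of "\<lambda>y. complex_of_real (Bs x y)"])
    qed (simp add: c_def ft_def)
    have eq: "indicator {0..} x *\<^sub>R (f0 x * f x - ?e x) = ?e x * a x + ft (c x) k" for x
    proof (cases "0 \<le> x")
      case True
      then show ?thesis unfolding ftc a_def jost_representation(1)[OF j True] by (simp add: algebra_simps)
    qed (simp add: ftc a_def)
    have "L1 (\<lambda>x. ?e x * a x + ft (c x) k)"
      by (intro L1_add integrable_exp_i_mult ai ft_superposition(3)[OF ci'])
    moreover have "(LINT x|lborel. ?e x * a x + ft (c x) k) = ft a k + ft (\<lambda>p. LINT x|lborel. c x p) k"
      by (subst LINT_add[OF integrable_exp_i_mult[OF ai] ft_superposition(3)[OF ci']])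
         (simp only: ft_superposition(2)[OF ci'] ft_def[of a])
    moreover have "\<dots> = ft G k" unfolding G_def by (rule ft_add[OF ai ft_superposition(1)[OF ci'], symmetric])
    ultimately show ?thesis unfolding eq by simp
  qed
  ultimately show thesis by (rule that)
qed

lemma jost_low_energy:
  assumes j0: "jost 0 f0 df0"
  obtains G where "wdiff m G"
    "\<And>k f df. jost k f df \<Longrightarrow> f0 0 * df 0 - df0 0 * f 0 = \<i> * k + complex_of_real k * complex_of_real k * G k"
proof -
  obtain G where G: "wdiff m (ft G)"
    "\<And>k f df. jost k f df \<Longrightarrow> L1 (\<lambda>x. indicator {0..} x *\<^sub>R (f0 x * f x - iexp (k * x))) \<and>
       (LINT x|lborel. indicator {0..} x *\<^sub>R (f0 x * f x - iexp (k * x))) = ft G k"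
    using jost_low_energy_kernel[OF j0] by blast
  have "f0 0 * df 0 - df0 0 * f 0 = \<i> * k + complex_of_real k * complex_of_real k * ft G k" if j: "jost k f df" for k f df
  proof -
    let ?e = "\<lambda>x. iexp (k * x)"
    let ?q = "\<lambda>x. f0 x * f x - ?e x"
    define K where "K = - (complex_of_real k * complex_of_real k)"
    have "abs_cont (\<lambda>t. f0 t * df t - df0 t * f t - \<i> * k * ?e t)
       (\<lambda>t. (df0 t * df t + f0 t * (complex_of_real (V t - k\<^sup>2) * f t)) - (complex_of_real (V t - 0\<^sup>2) * f0 t * f t + df0 t * df t) - \<i> * k * (\<i> * k * ?e t))"
      by (intro abs_cont_diff abs_cont_mult abs_cont_cmult abs_cont_exp jost_abs_cont[OF j] jost_abs_cont_f[OF j] jost_abs_cont[OF j0] jost_abs_cont_f[OF j0])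
    then have a: "abs_cont (\<lambda>t. f0 t * df t - df0 t * f t - \<i> * k * ?e t) (\<lambda>t. K * ?q t)"
      by (rule abs_cont_cong) (simp add: K_def algebra_simps power2_eq_square)
    have "L1 (\<lambda>x. K * (indicator {0..} x *\<^sub>R ?q x))" using G(2)[OF j] by (intro integrable_mult_right) auto
    then have i: "L1 (\<lambda>x. indicator {0..} x *\<^sub>R (K * ?q x))" by simp
    define h where "h x = df x - \<i> * k * ?e x" for x
    have h: "(h \<longlongrightarrow> 0) at_top" unfolding h_def[abs_def] by (rule jost_df_asymp[OF j])
    have h0: "(df0 \<longlongrightarrow> 0) at_top" using jost_df_asymp[OF j0] by simp
    have g: "((\<lambda>x. f x - ?e x) \<longlongrightarrow> 0) at_top" using j unfolding jost_def by blast
    have g0: "((\<lambda>x. f0 x - 1) \<longlongrightarrow> 0) at_top" using j0 unfolding jost_def by simp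
    \<comment> \<open>The boundary term at infinity, expanded so that every summand contains a
      factor tending to 0.\<close>
    have "((\<lambda>x. (f0 x - 1) * h x + (f0 x - 1) * (\<i> * k * ?e x) + h x - df0 x * (f x - ?e x) - df0 x * ?e x) \<longlongrightarrow> 0 * 0 + 0 + 0 - 0 * 0 - 0) at_top"
      by (intro tendsto_add tendsto_diff tendsto_mult[OF g0 h] tendsto_mult[OF h0 g] h
           tendsto_zero_mult_bounded[OF g0, where K = "\<bar>k\<bar>"] tendsto_zero_mult_bounded[OF h0, where K = 1])
         (simp_all add: norm_mult)
    moreover have "(f0 x - 1) * h x + (f0 x - 1) * (\<i> * k * ?e x) + h x - df0 x * (f x - ?e x) - df0 x * ?e x
       = f0 x * df x - df0 x * f x - \<i> * k * ?e x" for x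
      unfolding h_def by (simp add: algebra_simps)
    ultimately have l: "((\<lambda>t. f0 t * df t - df0 t * f t - \<i> * k * ?e t) \<longlongrightarrow> 0) at_top" by simp
    have "0 - (f0 0 * df 0 - df0 0 * f 0 - \<i> * k * ?e 0) = (LINT x|lborel. indicator {0..} x *\<^sub>R (K * ?q x))"
      by (rule abs_cont_limit[OF a i l]) simp
    also have "\<dots> = (LINT x|lborel. K * (indicator {0..} x *\<^sub>R ?q x))" by simp
    also have "\<dots> = K * ft G k" using G(2)[OF j] by (simp only: integral_mult_right_zero)
    finally show ?thesis unfolding K_def by (simp add: algebra_simps)
  qed
  with G(1) show thesis by (rule that)
qed

theorem jost_half_line:
  assumes j: "\<And>k. jost k (f k) (df k)"
  shows "wquot m 1 (\<lambda>k. f k 0)"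
    and "wquot m 0 (\<lambda>k. df k 0 - \<i> * k * f k 0)"
    and "\<exists>G. wdiff m G \<and> (\<forall>k. f 0 0 * df k 0 - df 0 0 * f k 0 = \<i> * k + complex_of_real k * complex_of_real k * G k)"
    and "cnj (f k 0) * df k 0 - f k 0 * cnj (df k 0) = 2 * \<i> * k"
    and "f 0 0 \<in> \<real>" "df 0 0 \<in> \<real>"
proof -
  have "f k 0 = 1 + ft (\<lambda>y. complex_of_real (Bs 0 y)) k" for k by (rule jost_0_eq[OF j])
  then show "wquot m 1 (\<lambda>k. f k 0)" using wquot_add[OF wquot_const wquot_Bs_0, of 1] by simp
  have b: "df k 0 - \<i> * k * f k 0 = ft (\<lambda>y. complex_of_real (Bd y)) k" for k by (rule jost_momentum_0[OF j])
  then show "wquot m 0 (\<lambda>k. df k 0 - \<i> * k * f k 0)" using wquot_Bd by simp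
  show "\<exists>G. wdiff m G \<and> (\<forall>k. f 0 0 * df k 0 - df 0 0 * f k 0 = \<i> * k + complex_of_real k * complex_of_real k * G k)"
    using jost_low_energy[OF j] j by metis
  show "cnj (f k 0) * df k 0 - f k 0 * cnj (df k 0) = 2 * \<i> * k" by (rule jost_wronskian_cnj[OF j])
  show "f 0 0 \<in> \<real>" unfolding jost_0_eq[OF j] by (intro Reals_add ft_of_real_at_0) simp
  show "df 0 0 \<in> \<real>" using b[of 0] ft_of_real_at_0[of Bd] by simp
qed

end

section \<open>Scattering coefficients\<close>

text \<open>\<open>\<alpha> k\<close> and \<open>\<delta> k\<close> are the value at 0 of a Jost solution and its derivative in the outgoing direction, so that the
  minus side is the mirror image of the plus side.\<close>

definition jost_data :: "nat \<Rightarrow> (real \<Rightarrow> complex) \<Rightarrow> (real \<Rightarrow> complex) \<Rightarrow> bool" where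
  "jost_data m \<alpha> \<delta> \<longleftrightarrow> wquot m 1 \<alpha> \<and> wquot m 0 (\<lambda>k. \<delta> k - \<i> * k * \<alpha> k) \<and>
     (\<exists>G. wdiff m G \<and> (\<forall>k. \<alpha> 0 * \<delta> k - \<delta> 0 * \<alpha> k = \<i> * k + complex_of_real k * complex_of_real k * G k)) \<and>
     (\<forall>k. cnj (\<alpha> k) * \<delta> k - \<alpha> k * cnj (\<delta> k) = 2 * \<i> * k) \<and> \<alpha> 0 \<in> \<real> \<and> \<delta> 0 \<in> \<real>"

lemma isCont_eq_at:
  fixes f g :: "real \<Rightarrow> complex"
  assumes "isCont f a" "isCont g a" "\<And>k. k \<noteq> a \<Longrightarrow> f k = g k"
  shows "f a = g a"
proof -
  have "(f \<longlongrightarrow> f a) (at a)" "(g \<longlongrightarrow> g a) (at a)" using assms unfolding isCont_def by auto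
  moreover from this(2) have "(f \<longlongrightarrow> g a) (at a)"
    by (rule Lim_transform_eventually) (auto simp: eventually_at_filter assms(3))
  ultimately show ?thesis using LIM_unique by blast
qed

lemma wquot_isCont: "wquot m c F \<Longrightarrow> isCont F k"
proof -
  assume "wquot m c F"
  then have "isCont (\<lambda>k. F k - c) k" unfolding wquot_def using wdiff_wiener wiener_continuous by blast
  from continuous_add[OF this continuous_const[of _ c]] show ?thesis by simp
qed

text \<open>\<open>\<phi>\<close> has two descriptions with complementary virtues:
  \<open>\<i> + k * G k\<close> exhibits the difference quotient \<open>G\<close>, while
  \<open>\<psi>\<close>, built from the quotients of \<open>\<alpha>\<close> and
  \<open>\<delta> - i k \<alpha>\<close>, shows that \<open>\<phi>\<close> minus its limit lies in
  the algebra. Off 0 they agree after cancelling \<open>k\<close>, at 0 by continuity.\<close>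

lemma jost_data_phi:
  assumes "jost_data m \<alpha> \<delta>"
  obtains \<phi> where "wquot m (\<i> * \<alpha> 0) \<phi>" "\<phi> 0 = \<i>" "\<And>k. \<alpha> 0 * \<delta> k - \<delta> 0 * \<alpha> k = complex_of_real k * \<phi> k"
proof -
  obtain G where a: "wquot m 1 \<alpha>" and b: "wquot m 0 (\<lambda>k. \<delta> k - \<i> * k * \<alpha> k)" and G: "wdiff m G"
    "\<And>k. \<alpha> 0 * \<delta> k - \<delta> 0 * \<alpha> k = \<i> * k + complex_of_real k * complex_of_real k * G k"
    using assms unfolding jost_data_def by blast
  obtain A where A: "wdiff m (\<lambda>k. \<alpha> k - 1)" "wdiff m A" "\<And>k. \<alpha> k = \<alpha> 0 + complex_of_real k * A k"
    using a unfolding wquot_def by blast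
  obtain B where B: "wdiff m B" "\<And>k. \<delta> k - \<i> * k * \<alpha> k = \<delta> 0 + complex_of_real k * B k"
    using b unfolding wquot_def by auto
  define \<phi> where "\<phi> k = \<i> + complex_of_real k * G k" for k
  define \<psi> where "\<psi> k = \<i> * \<alpha> 0 * \<alpha> k + (\<alpha> 0 * B k - \<delta> 0 * A k)" for k
  have eq: "\<phi> k = \<psi> k" if "k \<noteq> 0" for k
  proof -
    have "complex_of_real k * \<phi> k = \<alpha> 0 * \<delta> k - \<delta> 0 * \<alpha> k" unfolding \<phi>_def G(2) by (simp add: algebra_simps)
    also have "\<dots> = \<alpha> 0 * (\<i> * k * \<alpha> k + (\<delta> 0 + complex_of_real k * B k)) - \<delta> 0 * (\<alpha> 0 + complex_of_real k * A k)"
      using B(2)[of k] A(3)[of k] by (metis add.commute diff_add_cancel)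
    also have "\<dots> = complex_of_real k * \<psi> k" unfolding \<psi>_def by (simp add: algebra_simps)
    finally show ?thesis using that by simp
  qed
  have "isCont \<phi> 0" unfolding \<phi>_def by (intro continuous_intros wiener_continuous[OF wdiff_wiener[OF G(1)]])
  moreover have "isCont \<psi> 0" unfolding \<psi>_def
    by (intro continuous_intros wquot_isCont[OF a] wiener_continuous[OF wdiff_wiener[OF A(2)]] wiener_continuous[OF wdiff_wiener[OF B(1)]])
  ultimately have "\<phi> k = \<psi> k" for k using eq isCont_eq_at[where f = \<phi> and g = \<psi> and a = 0] by (cases "k = 0") auto
  then have "\<phi> k - \<i> * \<alpha> 0 = \<i> * \<alpha> 0 * (\<alpha> k - 1) + (\<alpha> 0 * B k - \<delta> 0 * A k)" for k
    unfolding \<psi>_def by (simp add: algebra_simps)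
  then have "wdiff m (\<lambda>k. \<phi> k - \<i> * \<alpha> 0)" using wdiff_add[OF wdiff_cmult[OF A(1)] wdiff_diff[OF wdiff_cmult[OF B(1)] wdiff_cmult[OF A(2)]]] by simp
  moreover have "\<phi> k = \<phi> 0 + complex_of_real k * G k" for k unfolding \<phi>_def by simp
  ultimately have "wquot m (\<i> * \<alpha> 0) \<phi>" unfolding wquot_def using G(1) by blast
  moreover have "\<phi> 0 = \<i>" unfolding \<phi>_def by simp
  moreover have "\<alpha> 0 * \<delta> k - \<delta> 0 * \<alpha> k = complex_of_real k * \<phi> k" for k
    unfolding G(2) \<phi>_def by (simp add: algebra_simps)
  ultimately show thesis by (rule that)
qed

text \<open>If both data vanished at zero energy, \<open>\<phi>\<close> would be 0 off
  \<open>k = 0\<close> and hence at 0, against \<open>\<phi> 0 = \<i>\<close>.\<close>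

lemma jost_data_nonzero:
  assumes "jost_data m \<alpha> \<delta>" "\<alpha> 0 = 0"
  shows "\<delta> 0 \<noteq> 0"
proof
  assume d: "\<delta> 0 = 0"
  obtain \<phi> where p: "wquot m (\<i> * \<alpha> 0) \<phi>" "\<phi> 0 = \<i>" "\<And>k. \<alpha> 0 * \<delta> k - \<delta> 0 * \<alpha> k = complex_of_real k * \<phi> k"
    using jost_data_phi[OF assms(1)] by blast
  have "\<phi> k = 0" if "k \<noteq> 0" for k using p(3)[of k] that assms(2) d by simp
  then have "\<phi> 0 = 0" using isCont_eq_at[where f = \<phi> and g = "\<lambda>_. 0" and a = 0] wquot_isCont[OF p(1)] by simp
  with p(2) show False by simp
qed

text \<open>The identity \<open>cnj \<alpha> \<delta> - \<alpha> cnj \<delta> = 2 i k\<close> fixes the sign of \<open>Im (\<delta> / \<alpha>)\<close> on both sides, so the logarithmic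
  derivatives at 0 cannot match.\<close>

lemma jost_wronskian_nonzero:
  assumes p: "jost_data m \<alpha>p \<delta>p" and q: "jost_data m \<alpha>m \<delta>m" and k: "k \<noteq> 0"
  shows "\<alpha>m k * \<delta>p k + \<delta>m k * \<alpha>p k \<noteq> 0"
proof
  assume eq: "\<alpha>m k * \<delta>p k + \<delta>m k * \<alpha>p k = 0"
  have Jp: "cnj (\<alpha>p k) * \<delta>p k - \<alpha>p k * cnj (\<delta>p k) = 2 * \<i> * k" using p unfolding jost_data_def by blast
  have Jm: "cnj (\<alpha>m k) * \<delta>m k - \<alpha>m k * cnj (\<delta>m k) = 2 * \<i> * k" using q unfolding jost_data_def by blast
  have nz: "\<alpha>p k \<noteq> 0" using Jp k by auto
  define r where "r = \<delta>p k / \<alpha>p k"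
  have dp: "\<delta>p k = \<alpha>p k * r" unfolding r_def using nz by simp
  have dm: "\<delta>m k = - \<alpha>m k * r"
  proof -
    have "(\<delta>m k + \<alpha>m k * r) * \<alpha>p k = 0" using eq unfolding dp by (simp add: algebra_simps)
    then show ?thesis using nz by (simp add: add_eq_0_iff)
  qed
  \<comment> \<open>With \<open>w\<close> the logarithmic derivative, the Wronskian identity reads
    \<open>(norm z)^2 * Im w = k\<close>.\<close>
  have key: "cnj z * (z * w) - z * cnj (z * w) = 2 * \<i> * complex_of_real ((norm z)\<^sup>2 * Im w)" for z w :: complex
    by (simp add: complex_eq_iff cmod_power2) (simp add: power2_eq_square algebra_simps)
  have "(norm (\<alpha>p k))\<^sup>2 * Im r = k"
  proof -
    have "2 * \<i> * complex_of_real ((norm (\<alpha>p k))\<^sup>2 * Im r) = 2 * \<i> * complex_of_real k"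
      using Jp unfolding dp key .
    then show ?thesis by (metis mult_cancel_left complex_i_not_zero of_real_eq_iff mult_eq_0_iff zero_neq_numeral)
  qed
  moreover have "(norm (\<alpha>m k))\<^sup>2 * Im (- r) = k"
  proof -
    have "\<delta>m k = \<alpha>m k * (- r)" using dm by simp
    then have "2 * \<i> * complex_of_real ((norm (\<alpha>m k))\<^sup>2 * Im (- r)) = 2 * \<i> * complex_of_real k"
      using Jm key[of "\<alpha>m k" "- r"] by simp
    then show ?thesis by (metis mult_cancel_left complex_i_not_zero of_real_eq_iff mult_eq_0_iff zero_neq_numeral)
  qed
  \<comment> \<open>The two sides give \<open>k\<close> as a nonnegative multiple of
    \<open>Im r\<close> and of \<open>- Im r\<close>; multiplying the equations makes
    \<open>k * k\<close> nonpositive.\<close>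
  ultimately have "k * k = - ((norm (\<alpha>p k))\<^sup>2 * (norm (\<alpha>m k))\<^sup>2 * (Im r * Im r))"
    by (metis (no_types, opaque_lifting) mult.assoc mult.left_commute mult_minus_right uminus_complex.sel(2))
  moreover have "0 \<le> (norm (\<alpha>p k))\<^sup>2 * (norm (\<alpha>m k))\<^sup>2 * (Im r * Im r)" by simp
  ultimately have "k * k \<le> 0" by linarith
  then show False using k by (auto simp: mult_le_0_iff)
qed

text \<open>Otherwise \<open>x^2 + y^2 = 0\<close>. This is where the reality of the zero-energy
  data enters: it keeps \<open>W k / k\<close> away from 0 at a resonance.\<close>

lemma real_quotient_sum_nonzero:
  fixes x y :: complex
  assumes "x \<in> \<real>" "y \<in> \<real>" "x \<noteq> 0" "y \<noteq> 0"
  shows "x / y + y / x \<noteq> 0"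
proof
  assume *: "x / y + y / x = 0"
  obtain a b where ab: "x = complex_of_real a" "y = complex_of_real b" using assms by (auto elim!: Reals_cases)
  have "x * x + y * y = 0" using * assms by (simp add: field_simps)
  then have "complex_of_real (a * a + b * b) = 0" unfolding ab by simp
  then have "a * a + b * b = 0" by (simp only: of_real_eq_0_iff)
  then show False using assms unfolding ab by (simp add: sum_squares_eq_zero_iff)
qed

text \<open>Inversion in the algebra needs a denominator without zeros, including at
  \<open>k = 0\<close>, and this forces the case distinction on \<open>W 0\<close>. Stated for
  abstract data, the lemma yields the second reflection coefficient by exchanging the two
  sides.\<close>

lemma scattering_wquot:
  assumes p: "jost_data m \<alpha>p \<delta>p" and q: "jost_data m \<alpha>m \<delta>m"
  defines "W \<equiv> \<lambda>k. \<alpha>m k * \<delta>p k + \<delta>m k * \<alpha>p k"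
    and "S \<equiv> \<lambda>k. \<alpha>m k * \<delta>p (- k) + \<delta>m k * \<alpha>p (- k)"
  obtains c d T R where "wquot m c T" "wquot m d R" "\<And>k. k \<noteq> 0 \<Longrightarrow> 2 * \<i> * complex_of_real k / W k = T k"
    "\<And>k. k \<noteq> 0 \<Longrightarrow> - (S k / W k) = R k"
proof -
  define bp where "bp k = \<delta>p k - \<i> * k * \<alpha>p k" for k
  define bm where "bm k = \<delta>m k - \<i> * k * \<alpha>m k" for k
  have ap: "wquot m 1 \<alpha>p" and am: "wquot m 1 \<alpha>m" and bp: "wquot m 0 bp" and bm: "wquot m 0 bm"
    and re: "\<alpha>p 0 \<in> \<real>" "\<delta>p 0 \<in> \<real>" "\<alpha>m 0 \<in> \<real>" "\<delta>m 0 \<in> \<real>"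
    using p q unfolding jost_data_def bp_def[abs_def] bm_def[abs_def] by auto
  have dp: "\<delta>p k = \<i> * k * \<alpha>p k + bp k" and dm: "\<delta>m k = \<i> * k * \<alpha>m k + bm k" for k unfolding bp_def bm_def by simp_all
  have Wnz: "W k \<noteq> 0" if "k \<noteq> 0" for k unfolding W_def using jost_wronskian_nonzero[OF p q that] .
  have W: "W k = 2 * \<i> * complex_of_real k * (\<alpha>m k * \<alpha>p k) + (\<alpha>m k * bp k + bm k * \<alpha>p k)" for k
    unfolding W_def dp dm by (simp add: algebra_simps)
  \<comment> \<open>The terms linear in \<open>k\<close> cancel because \<open>\<delta>p\<close> is
    taken at \<open>- k\<close>; so \<open>S\<close>, unlike \<open>W\<close>, does not
    grow.\<close>
  have S: "S k = \<alpha>m k * bp (- k) + bm k * \<alpha>p (- k)" for k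
    unfolding S_def dp dm by (simp add: algebra_simps)
  note witness = that
  show thesis
  proof (cases "W 0 = 0")
    case False
    define r where "r k = inverse (complex_of_real k + \<i>)" for k
    have r: "wquot m 0 r" unfolding r_def[abs_def] by (rule wquot_inverse_add_ii)
    have nz: "complex_of_real k + \<i> \<noteq> 0" for k by (auto simp: complex_eq_iff)
    have kr: "complex_of_real k * r k = 1 - \<i> * r k" for k
    proof -
      have "(complex_of_real k + \<i>) * r k = 1" unfolding r_def using nz[of k] by simp
      then show ?thesis by (simp add: algebra_simps)
    qed
    define w where "w k = 2 * \<i> * ((1 - \<i> * r k) * (\<alpha>m k * \<alpha>p k)) + (\<alpha>m k * bp k + bm k * \<alpha>p k) * r k" for k
    have w: "w k = W k * r k" for k unfolding w_def W kr[symmetric] by (simp add: algebra_simps)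
    have wnz: "w k \<noteq> 0" for k using Wnz[of k] False nz[of k] unfolding w r_def by (cases "k = 0") auto
    \<comment> \<open>The limits at infinity are left unevaluated, in the form in which the closure
      rules produce them; this one is \<open>2 * \<i>\<close>.\<close>
    have wQ: "wquot m (2 * \<i> * ((1 - \<i> * 0) * (1 * 1)) + (1 * 0 + 0 * 1) * 0) w"
      unfolding w_def[abs_def] by (intro wquot_add wquot_mult wquot_cmult wquot_diff wquot_const r ap am bp bm)
    have TQ: "wquot m (2 * \<i> * (1 - \<i> * 0) / (2 * \<i> * ((1 - \<i> * 0) * (1 * 1)) + (1 * 0 + 0 * 1) * 0)) (\<lambda>k. 2 * \<i> * (1 - \<i> * r k) / w k)"
      by (intro wquot_divide wQ wquot_cmult wquot_diff wquot_const r wnz) simp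
    have RQ: "wquot m (- ((1 * 0 + 0 * 1) * 0) / (2 * \<i> * ((1 - \<i> * 0) * (1 * 1)) + (1 * 0 + 0 * 1) * 0))
        (\<lambda>k. - ((\<alpha>m k * bp (- k) + bm k * \<alpha>p (- k)) * r k) / w k)"
      by (intro wquot_divide wquot_uminus wQ wquot_add wquot_mult am bm r wquot_reflect[OF ap] wquot_reflect[OF bp] wnz) simp
    have rnz: "r k \<noteq> 0" for k unfolding r_def using nz[of k] by simp
    show thesis
    proof (rule witness[OF TQ RQ])
      show "2 * \<i> * complex_of_real k / W k = 2 * \<i> * (1 - \<i> * r k) / w k" if "k \<noteq> 0" for k
        unfolding kr[symmetric] w using rnz[of k] by simp
      show "- (S k / W k) = - ((\<alpha>m k * bp (- k) + bm k * \<alpha>p (- k)) * r k) / w k" if "k \<noteq> 0" for k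
        unfolding S[symmetric] w using rnz[of k] by simp
    qed
  next
    case res: True
    obtain \<phi>p where Pp: "wquot m (\<i> * \<alpha>p 0) \<phi>p" "\<phi>p 0 = \<i>" "\<And>k. \<alpha>p 0 * \<delta>p k - \<delta>p 0 * \<alpha>p k = complex_of_real k * \<phi>p k"
      using jost_data_phi[OF p] by blast
    obtain \<phi>m where Pm: "wquot m (\<i> * \<alpha>m 0) \<phi>m" "\<phi>m 0 = \<i>" "\<And>k. \<alpha>m 0 * \<delta>m k - \<delta>m 0 * \<alpha>m k = complex_of_real k * \<phi>m k"
      using jost_data_phi[OF q] by blast
    \<comment> \<open>At a resonance it suffices to split a factor \<open>k\<close> off
      \<open>W\<close> and \<open>S\<close> with cofactors in the algebra and the cofactor of
      \<open>W\<close> nonzero at 0.\<close>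
    have fin: thesis if w: "wquot m (2 * \<i>) w" and v: "wquot m d v" and Ww: "\<And>k. W k = complex_of_real k * w k"
      and Sv: "\<And>k. S k = complex_of_real k * v k" and w0: "w 0 \<noteq> 0" for w v d
    proof -
      have wnz: "w k \<noteq> 0" for k using w0 Wnz[of k] Ww[of k] by (cases "k = 0") auto
      have TQ: "wquot m (2 * \<i> / (2 * \<i>)) (\<lambda>k. 2 * \<i> / w k)" by (intro wquot_divide wquot_const w wnz) simp
      have RQ: "wquot m (- d / (2 * \<i>)) (\<lambda>k. - v k / w k)" by (intro wquot_divide wquot_uminus v w wnz) simp
      show thesis
      proof (rule witness[OF TQ RQ])
        show "2 * \<i> * complex_of_real k / W k = 2 * \<i> / w k" if "k \<noteq> 0" for k unfolding Ww using that by simp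
        show "- (S k / W k) = - v k / w k" if "k \<noteq> 0" for k unfolding Ww Sv using that by simp
      qed
    qed
    show thesis
    proof (cases "\<alpha>p 0 = 0")
      case False
      have am0: "\<alpha>m 0 \<noteq> 0"
      proof
        assume "\<alpha>m 0 = 0"
        moreover from this have "\<delta>m 0 \<noteq> 0" by (rule jost_data_nonzero[OF q])
        ultimately show False using res False unfolding W_def by simp
      qed
      define w where "w k = inverse (\<alpha>p 0) * (\<alpha>m k * \<phi>p k) + inverse (\<alpha>m 0) * (\<alpha>p k * \<phi>m k)" for k
      define v where "v k = inverse (\<alpha>m 0) * (\<alpha>p (- k) * \<phi>m k) - inverse (\<alpha>p 0) * (\<alpha>m k * \<phi>p (- k))" for k
      \<comment> \<open>The low-energy identity solved for the derivative: a term with a factor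
        \<open>k\<close>, plus a multiple of \<open>\<alpha>p k\<close>.\<close>
      have Dp: "\<delta>p k = inverse (\<alpha>p 0) * (complex_of_real k * \<phi>p k + \<delta>p 0 * \<alpha>p k)" for k
        unfolding Pp(3)[symmetric] using False by simp
      have Dm: "\<delta>m k = inverse (\<alpha>m 0) * (complex_of_real k * \<phi>m k + \<delta>m 0 * \<alpha>m k)" for k
        unfolding Pm(3)[symmetric] using am0 by simp
      \<comment> \<open>This is \<open>W 0 = 0\<close>: the logarithmic derivatives at 0 cancel, and
        with them all terms of \<open>W\<close> and \<open>S\<close> that carry no factor
        \<open>k\<close>.\<close>
      have z: "inverse (\<alpha>p 0) * \<delta>p 0 = - (inverse (\<alpha>m 0) * \<delta>m 0)"
      proof -
        have "inverse (\<alpha>p 0) * inverse (\<alpha>m 0) * (\<alpha>m 0 * \<delta>p 0 + \<delta>m 0 * \<alpha>p 0) = 0" using res unfolding W_def by simp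
        then have "inverse (\<alpha>p 0) * \<delta>p 0 + inverse (\<alpha>m 0) * \<delta>m 0 = 0" using False am0 by (simp add: field_simps)
        then show ?thesis by (simp add: add_eq_0_iff)
      qed
      have cross: "inverse (\<alpha>p 0) * \<delta>p 0 * (x * y) + inverse (\<alpha>m 0) * \<delta>m 0 * (x * y) = 0" for x y
        unfolding z by simp
      show thesis
      proof (rule fin)
        have "wquot m (inverse (\<alpha>p 0) * (1 * (\<i> * \<alpha>p 0)) + inverse (\<alpha>m 0) * (1 * (\<i> * \<alpha>m 0))) w"
          unfolding w_def[abs_def] by (intro wquot_add wquot_cmult wquot_mult ap am Pp Pm)
        moreover have "inverse (\<alpha>p 0) * (1 * (\<i> * \<alpha>p 0)) + inverse (\<alpha>m 0) * (1 * (\<i> * \<alpha>m 0)) = 2 * \<i>"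
          using False am0 by (simp add: field_simps)
        ultimately show "wquot m (2 * \<i>) w" by (simp only:)
        show "wquot m (inverse (\<alpha>m 0) * (1 * (\<i> * \<alpha>m 0)) - inverse (\<alpha>p 0) * (1 * (\<i> * \<alpha>p 0))) v"
          unfolding v_def[abs_def] by (intro wquot_diff wquot_cmult wquot_mult am Pm wquot_reflect[OF ap] wquot_reflect[OF Pp(1)])
        show "W k = complex_of_real k * w k" for k
        proof -
          have "W k = complex_of_real k * w k + (inverse (\<alpha>p 0) * \<delta>p 0 * (\<alpha>m k * \<alpha>p k) + inverse (\<alpha>m 0) * \<delta>m 0 * (\<alpha>m k * \<alpha>p k))"
            unfolding W_def w_def Dp[of k] Dm[of k] by (simp add: algebra_simps)
          then show ?thesis unfolding cross by simp
        qed
        show "S k = complex_of_real k * v k" for k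
        proof -
          have "S k = complex_of_real k * v k + (inverse (\<alpha>p 0) * \<delta>p 0 * (\<alpha>m k * \<alpha>p (- k)) + inverse (\<alpha>m 0) * \<delta>m 0 * (\<alpha>m k * \<alpha>p (- k)))"
            unfolding S_def v_def Dp[of "- k"] Dm[of k] by (simp add: algebra_simps)
          then show ?thesis unfolding cross by simp
        qed
        have "w 0 = \<i> * (\<alpha>m 0 / \<alpha>p 0 + \<alpha>p 0 / \<alpha>m 0)"
          unfolding w_def Pp(2) Pm(2) by (simp add: divide_inverse algebra_simps)
        then show "w 0 \<noteq> 0" using real_quotient_sum_nonzero[OF re(3,1) am0 False] by simp
      qed
    next
      \<comment> \<open>Both zero-energy solutions turn out to vanish at 0. The low-energy identity
        no longer determines \<open>\<delta>\<close>, but it exhibits a factor \<open>k\<close> in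
        both \<open>\<alpha>p\<close> and \<open>\<alpha>m\<close>.\<close>
      case ap0: True
      have dp0: "\<delta>p 0 \<noteq> 0" by (rule jost_data_nonzero[OF p ap0])
      have am0: "\<alpha>m 0 = 0" using res dp0 ap0 unfolding W_def by simp
      have dm0: "\<delta>m 0 \<noteq> 0" by (rule jost_data_nonzero[OF q am0])
      have Ap: "\<alpha>p k = - inverse (\<delta>p 0) * (complex_of_real k * \<phi>p k)" for k
        unfolding Pp(3)[symmetric] using dp0 ap0 by simp
      have Am: "\<alpha>m k = - inverse (\<delta>m 0) * (complex_of_real k * \<phi>m k)" for k
        unfolding Pm(3)[symmetric] using dm0 am0 by simp
      \<comment> \<open>The first term of \<open>W\<close> has a factor \<open>k\<close> already; in
        the others it is taken from the single \<open>\<alpha>\<close> they contain. The limit at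
        infinity thus remains \<open>2 * \<i>\<close>.\<close>
      define w where "w k = 2 * \<i> * (\<alpha>m k * \<alpha>p k) - (inverse (\<delta>m 0) * (\<phi>m k * bp k) + inverse (\<delta>p 0) * (\<phi>p k * bm k))" for k
      define v where "v k = inverse (\<delta>p 0) * (bm k * \<phi>p (- k)) - inverse (\<delta>m 0) * (\<phi>m k * bp (- k))" for k
      show thesis
      proof (rule fin)
        have "wquot m (2 * \<i> * (1 * 1) - (inverse (\<delta>m 0) * (\<i> * \<alpha>m 0 * 0) + inverse (\<delta>p 0) * (\<i> * \<alpha>p 0 * 0))) w"
          unfolding w_def[abs_def] by (intro wquot_add wquot_diff wquot_cmult wquot_mult ap am Pp Pm bp bm)
        then show "wquot m (2 * \<i>) w" by simp
        show "wquot m (inverse (\<delta>p 0) * (0 * (\<i> * \<alpha>p 0)) - inverse (\<delta>m 0) * (\<i> * \<alpha>m 0 * 0)) v"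
          unfolding v_def[abs_def] by (intro wquot_diff wquot_cmult wquot_mult Pm bm wquot_reflect[OF bp] wquot_reflect[OF Pp(1)])
        show "W k = complex_of_real k * w k" for k
        proof -
          have E: "\<alpha>m k * bp k + bm k * \<alpha>p k = complex_of_real k * - (inverse (\<delta>m 0) * (\<phi>m k * bp k) + inverse (\<delta>p 0) * (\<phi>p k * bm k))"
            unfolding Ap[of k] Am[of k] by (simp add: algebra_simps)
          show ?thesis unfolding W E w_def by (simp add: algebra_simps)
        qed
        show "S k = complex_of_real k * v k" for k
          unfolding S v_def Ap[of "- k"] Am[of k] by (simp add: algebra_simps)
        have "bp 0 = \<delta>p 0" "bm 0 = \<delta>m 0" unfolding bp_def bm_def by simp_all
        then have "w 0 = - \<i> * (\<delta>p 0 / \<delta>m 0 + \<delta>m 0 / \<delta>p 0)"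
          unfolding w_def Pp(2) Pm(2) ap0 am0 by (simp add: divide_inverse algebra_simps)
        then show "w 0 \<noteq> 0" using real_quotient_sum_nonzero[OF re(2,4) dp0 dm0] by simp
      qed
    qed
  qed
qed

section \<open>Reduction of the whole line to two half-lines\<close>

lemma (in half_line) jost_data:
  assumes "\<And>k. jost k (f k) (df k)"
  shows "jost_data m (\<lambda>k. f k 0) (\<lambda>k. df k 0)"
  using jost_half_line[OF assms] unfolding jost_data_def by blast

lemma half_line_of_L1_weighted:
  assumes j: "j \<ge> 1" and V: "L1_weighted (j + 1) V"
  shows "half_line (\<lambda>t. if 0 \<le> t then V t else 0) (j - 1)"
    and "half_line (\<lambda>t. if 0 \<le> t then V (- t) else 0) (j - 1)"
proof -
  have [measurable]: "V \<in> borel_measurable borel" using V unfolding L1_weighted_def by simp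
  have i: "L1 (\<lambda>x. (1 + \<bar>x\<bar>) ^ (j + 1) * \<bar>V x\<bar>)" using V unfolding L1_weighted_def by simp
  have i': "L1 (\<lambda>x. (1 + \<bar>x\<bar>) ^ (j + 1) * \<bar>V (- x)\<bar>)"
    using lborel_integrable_real_affine[OF i, of "- 1" 0] by simp
  have e: "j - 1 + 2 = j + 1" using j by simp
  show "half_line (\<lambda>t. if 0 \<le> t then V t else 0) (j - 1)"
  proof
    show "L1 (\<lambda>t. (1 + \<bar>t\<bar>) ^ (j - 1 + 2) * \<bar>if 0 \<le> t then V t else 0\<bar>)"
      unfolding e by (rule L1_dominated[OF i]) auto
  qed auto
  show "half_line (\<lambda>t. if 0 \<le> t then V (- t) else 0) (j - 1)"
  proof
    show "L1 (\<lambda>t. (1 + \<bar>t\<bar>) ^ (j - 1 + 2) * \<bar>if 0 \<le> t then V (- t) else 0\<bar>)"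
      unfolding e by (rule L1_dominated[OF i']) auto
  qed auto
qed

lemma jost_plus_data:
  assumes j: "j \<ge> 1" and V: "L1_weighted (j + 1) V" and J: "jost_plus V fp"
  shows "jost_data (j - 1) (\<lambda>k. fp k 0) (\<lambda>k. vector_derivative (fp k) (at 0))"
proof -
  interpret half_line "\<lambda>t. if 0 \<le> t then V t else 0" "j - 1" by (rule half_line_of_L1_weighted(1)[OF j V])
  have "\<exists>df. jost k (fp k) df" for k
  proof -
    obtain df where df: "\<And>x. (fp k has_vector_derivative df x) (at x)"
      "\<And>a b. a \<le> b \<Longrightarrow> ((\<lambda>t. complex_of_real (V t - k\<^sup>2) * fp k t) has_integral (df b - df a)) {a..b}"
      using J unfolding jost_plus_def schrod_sol_def by blast
    have "((\<lambda>t. complex_of_real ((if 0 \<le> t then V t else 0) - k\<^sup>2) * fp k t) has_integral (df b - df a)) {a..b}" if "0 \<le> a" "a \<le> b" for a b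
      by (rule has_integral_eq[OF _ df(2)[OF that(2)]]) (use that in auto)
    then have "jost k (fp k) df" unfolding jost_def using df J unfolding jost_plus_def by blast
    then show ?thesis by blast
  qed
  then obtain df where df: "\<And>k. jost k (fp k) (df k)" by metis
  have "vector_derivative (fp k) (at 0) = df k 0" for k
    using df[of k] unfolding jost_def by (intro vector_derivative_at) blast
  then show ?thesis using jost_data[OF df] by simp
qed

text \<open>The reflection of \<open>x\<close> to \<open>- x\<close> turns the left Jost solution
  into a right one for the mirrored potential; it reverses the sign of the derivative, which is
  thereby taken in the outgoing direction.\<close>

lemma jost_minus_data:
  assumes j: "j \<ge> 1" and V: "L1_weighted (j + 1) V" and J: "jost_minus V fm"
  shows "jost_data (j - 1) (\<lambda>k. fm k 0) (\<lambda>k. - vector_derivative (fm k) (at 0))"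
proof -
  interpret half_line "\<lambda>t. if 0 \<le> t then V (- t) else 0" "j - 1" by (rule half_line_of_L1_weighted(2)[OF j V])
  have "\<exists>df. jost k (\<lambda>x. fm k (- x)) (\<lambda>x. - df (- x)) \<and> (fm k has_vector_derivative df 0) (at 0)" for k
  proof -
    obtain df where df: "\<And>x. (fm k has_vector_derivative df x) (at x)"
      "\<And>a b. a \<le> b \<Longrightarrow> ((\<lambda>t. complex_of_real (V t - k\<^sup>2) * fm k t) has_integral (df b - df a)) {a..b}"
      using J unfolding jost_minus_def schrod_sol_def by blast
    have "((\<lambda>x. fm k (- x)) has_vector_derivative - df (- x)) (at x)" for x
    proof -
      have "(uminus has_vector_derivative (- 1 :: real)) (at x)"
        using has_vector_derivative_minus[OF has_vector_derivative_id[of "at x"]] by simp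
      from vector_diff_chain_at[OF this df(1)[of "- x"]] show ?thesis by (simp add: o_def)
    qed
    moreover have "((\<lambda>t. complex_of_real ((if 0 \<le> t then V (- t) else 0) - k\<^sup>2) * fm k (- t)) has_integral (- df (- b) - - df (- a))) {a..b}"
      if "0 \<le> a" "a \<le> b" for a b
    proof (rule has_integral_eq)
      have "((\<lambda>t. complex_of_real (V t - k\<^sup>2) * fm k t) has_integral (df (- a) - df (- b))) {- b..- a}"
        using df(2)[of "- b" "- a"] that by simp
      then show "((\<lambda>t. complex_of_real (V (- t) - k\<^sup>2) * fm k (- t)) has_integral (- df (- b) - - df (- a))) {a..b}"
        using has_integral_reflect_real[of "\<lambda>t. complex_of_real (V t - k\<^sup>2) * fm k t" "df (- a) - df (- b)" "- a" "- b"] by simp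
    qed (use that in auto)
    moreover have "((\<lambda>x. fm k (- x) - iexp (k * x)) \<longlongrightarrow> 0) at_top"
    proof -
      have "((\<lambda>x. fm k x - exp (- \<i> * complex_of_real (k * x))) \<longlongrightarrow> 0) at_bot" using J unfolding jost_minus_def by blast
      then show ?thesis unfolding filterlim_at_bot_mirror by simp
    qed
    ultimately show ?thesis unfolding jost_def using df(1) by (intro exI[of _ df]) blast
  qed
  then obtain df where df: "\<And>k. jost k (\<lambda>x. fm k (- x)) (\<lambda>x. - df k (- x))" "\<And>k. (fm k has_vector_derivative df k 0) (at 0)" by metis
  have "vector_derivative (fm k) (at 0) = df k 0" for k using df(2) by (rule vector_derivative_at)
  then show ?thesis using jost_data[OF df(1)] by simp
qed

theorem theorem2p6:
  fixes j :: nat and V :: "real \<Rightarrow> real" and fp fm :: "real \<Rightarrow> real \<Rightarrow> complex"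
  assumes "j \<ge> 1"
    and "L1_weighted (j + 1) V"
    and "jost_plus V fp" and "jost_minus V fm"
  shows "diff_quot_derivs_in_wiener j (transmission fp fm)
       \<and> diff_quot_derivs_in_wiener j (reflection_plus fp fm)
       \<and> diff_quot_derivs_in_wiener j (reflection_minus fp fm)"
proof -
  define \<delta>p where "\<delta>p k = vector_derivative (fp k) (at 0)" for k
  define \<delta>m where "\<delta>m k = - vector_derivative (fm k) (at 0)" for k
  have p: "jost_data (j - 1) (\<lambda>k. fp k 0) \<delta>p" unfolding \<delta>p_def[abs_def] by (rule jost_plus_data[OF assms(1,2,3)])
  have m: "jost_data (j - 1) (\<lambda>k. fm k 0) \<delta>m" unfolding \<delta>m_def[abs_def] by (rule jost_minus_data[OF assms(1,2,4)])
  have W: "wronskian (fm k) (fp l) = fm k 0 * \<delta>p l + \<delta>m k * fp l 0" for k l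
    unfolding wronskian_def \<delta>p_def \<delta>m_def by simp
  have W': "wronskian (fp k) (fm l) = - (fp k 0 * \<delta>m l + \<delta>p k * fm l 0)" for k l
    unfolding wronskian_def \<delta>p_def \<delta>m_def by simp
  obtain c d T R where T: "wquot (j - 1) c T" "wquot (j - 1) d R"
    "\<And>k. k \<noteq> 0 \<Longrightarrow> 2 * \<i> * complex_of_real k / (fm k 0 * \<delta>p k + \<delta>m k * fp k 0) = T k"
    "\<And>k. k \<noteq> 0 \<Longrightarrow> - ((fm k 0 * \<delta>p (- k) + \<delta>m k * fp (- k) 0) / (fm k 0 * \<delta>p k + \<delta>m k * fp k 0)) = R k"
    by (rule scattering_wquot[OF p m]) (rule that)
  \<comment> \<open>The left reflection coefficient is the right one of the mirrored problem, so the
    two sets of data are exchanged; the denominator is symmetric in them.\<close>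
  obtain d' R' where R': "wquot (j - 1) d' R'"
    "\<And>k. k \<noteq> 0 \<Longrightarrow> - ((fp k 0 * \<delta>m (- k) + \<delta>p k * fm (- k) 0) / (fp k 0 * \<delta>m k + \<delta>p k * fm k 0)) = R' k"
    by (rule scattering_wquot[OF m p]) (rule that)
  have "transmission fp fm = T" unfolding transmission_def by (rule ext0_eq_of_wquot[OF T(1)]) (simp add: W T(3))
  moreover have "reflection_plus fp fm = R" unfolding reflection_plus_def by (rule ext0_eq_of_wquot[OF T(2)], unfold W, rule T(4))
  moreover have "reflection_minus fp fm = R'" unfolding reflection_minus_def
  proof (rule ext0_eq_of_wquot[OF R'(1)])
    fix k :: real assume "k \<noteq> 0"
    have "fp k 0 * \<delta>m k + \<delta>p k * fm k 0 = fm k 0 * \<delta>p k + \<delta>m k * fp k 0" by (simp add: mult.commute add.commute)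
    from R'(2)[OF \<open>k \<noteq> 0\<close>, unfolded this] show "wronskian (fp k) (fm (- k)) / wronskian (fm k) (fp k) = R' k"
      unfolding W W' by (simp only: minus_divide_left)
  qed
  ultimately show ?thesis using diff_quot_of_wquot T(1,2) R'(1) by metis
qed

end
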